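(* There is an algorithm which, given a permutation $t:[n]\to[n]$ and a Jordan permutation $\pi:[k]\to[k]$ with $n\ge k$, decides whether $t$ contains $\pi$ in time $n^{O(\sqrt{k})}$.
   Context: $[n]=\{1,\dots,n\}$. A permutation $t:[n]\to[n]$ contains $\pi:[k]\to[k]$ if there are indices $1\le i_1<\dots<i_k\le n$ such that for all $1\le j,\ell\le k$, $t(i_j)<t(i_\ell)$ if and only if $\pi(j)<\pi(\ell)$. A Jordan permutation is a permutation generated by the intersection pattern of two simple curves in the plane intersecting in finitely many points: label the $k$ intersection points $1,\dots,k$ in increasing order along the first curve, and read out the labels in order along the second curve; the resulting sequence $(\pi(1),\dots,\pi(k))$ is a Jordan permutation. *)

theory Defs
  imports "HOL-Analysis.Analysis" "HOL-Combinatorics.Permutations"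
begin

definition contains_pattern :: "nat \<Rightarrow> (nat \<Rightarrow> nat) \<Rightarrow> nat \<Rightarrow> (nat \<Rightarrow> nat) \<Rightarrow> bool" where
  "contains_pattern n t k \<pi> \<longleftrightarrow>
     (\<exists>i :: nat \<Rightarrow> nat. strict_mono_on {1..k} i \<and> i ` {1..k} \<subseteq> {1..n} \<and>
        (\<forall>j\<in>{1..k}. \<forall>l\<in>{1..k}. t (i j) < t (i l) \<longleftrightarrow> \<pi> j < \<pi> l))"

text \<open>
  The intersection points are \<open>f (a 1), \<dots>, f (a k)\<close> in their order along the first curve \<open>f\<close>,
  so \<open>f (a m)\<close> is the point labelled \<open>m\<close>. They are \<open>g (b 1), \<dots>, g (b k)\<close> in their order along
  the second curve \<open>g\<close>, and \<open>\<pi> j\<close> is the label of the \<open>j\<close>-th of these. The bijection makes the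
  number of intersection points finite and equal to \<open>k\<close>. The predicate \<open>simple_path\<close> also
  admits closed curves, which are traversed from their base point; should the base point be an
  intersection point, the bijection ensures that it is listed only once, as the first or as the
  last point. The intersections need not be crossings.
\<close>

definition jordan_permutation :: "nat \<Rightarrow> (nat \<Rightarrow> nat) \<Rightarrow> bool" where
  "jordan_permutation k \<pi> \<longleftrightarrow> \<pi> permutes {1..k} \<and>
     (\<exists>(f :: real \<Rightarrow> complex) (g :: real \<Rightarrow> complex) (a :: nat \<Rightarrow> real) (b :: nat \<Rightarrow> real).
        simple_path f \<and> simple_path g \<and>
        strict_mono_on {1..k} a \<and> a ` {1..k} \<subseteq> {0..1} \<and>
        strict_mono_on {1..k} b \<and> b ` {1..k} \<subseteq> {0..1} \<and>
        bij_betw (\<lambda>m. f (a m)) {1..k} (path_image f \<inter> path_image g) \<and>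
        (\<forall>j\<in>{1..k}. g (b j) = f (a (\<pi> j))))"

text \<open>
  The machine model is a random access machine with structured control flow. A program uses
  finitely many registers, and an unbounded memory that is addressed indirectly; all of them hold
  natural numbers. Every operation takes one time unit. The only arithmetic operations are
  addition and truncated subtraction, so that in \<open>T\<close> steps numbers grow by at most \<open>O(T)\<close> bits,
  and running time is polynomially related to that of Turing machines. (With multiplication at
  unit cost it would not be.)
\<close>

type_synonym reg = string
type_synonym state = "(reg \<Rightarrow> nat) \<times> (nat \<Rightarrow> nat)"

datatype aexp = N nat | V reg | Mem aexp | Plus aexp aexp | Minus aexp aexp

fun aval :: "aexp \<Rightarrow> state \<Rightarrow> nat" where
  "aval (N c) s = c"
| "aval (V x) s = fst s x"
| "aval (Mem e) s = snd s (aval e s)"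
| "aval (Plus e1 e2) s = aval e1 s + aval e2 s"
| "aval (Minus e1 e2) s = aval e1 s - aval e2 s"

fun acost :: "aexp \<Rightarrow> nat" where
  "acost (N c) = 1"
| "acost (V x) = 1"
| "acost (Mem e) = acost e + 1"
| "acost (Plus e1 e2) = acost e1 + acost e2 + 1"
| "acost (Minus e1 e2) = acost e1 + acost e2 + 1"

datatype com =
    Skip
  | Assign reg aexp
  | Store aexp aexp
  | Seq com com
  | Cond aexp com com
  | While aexp com

text \<open>\<open>exec c s T s'\<close>: started in state \<open>s\<close>, the program \<open>c\<close> halts after exactly \<open>T\<close> time units in
  state \<open>s'\<close>. Tests succeed on nonzero values.\<close>

inductive exec :: "com \<Rightarrow> state \<Rightarrow> nat \<Rightarrow> state \<Rightarrow> bool" where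
  Skip: "exec Skip s 1 s"
| Assign: "exec (Assign x e) s (acost e + 1) ((fst s)(x := aval e s), snd s)"
| Store: "exec (Store e1 e2) s (acost e1 + acost e2 + 1)
            (fst s, (snd s)(aval e1 s := aval e2 s))"
| Seq: "exec c1 s T1 s' \<Longrightarrow> exec c2 s' T2 s'' \<Longrightarrow> exec (Seq c1 c2) s (T1 + T2) s''"
| CondTrue: "aval e s \<noteq> 0 \<Longrightarrow> exec c1 s T s' \<Longrightarrow> exec (Cond e c1 c2) s (acost e + 1 + T) s'"
| CondFalse: "aval e s = 0 \<Longrightarrow> exec c2 s T s' \<Longrightarrow> exec (Cond e c1 c2) s (acost e + 1 + T) s'"
| WhileFalse: "aval e s = 0 \<Longrightarrow> exec (While e c) s (acost e + 1) s"
| WhileTrue: "aval e s \<noteq> 0 \<Longrightarrow> exec c s T1 s' \<Longrightarrow> exec (While e c) s' T2 s'' \<Longrightarrow>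
                exec (While e c) s (acost e + 1 + T1 + T2) s''"

lemma exec_deterministic:
  "exec c s T s' \<Longrightarrow> exec c s T2 s2 \<Longrightarrow> T2 = T \<and> s2 = s'"
proof (induction arbitrary: T2 s2 rule: exec.induct)
  case Skip then show ?case by (auto elim: exec.cases)
next
  case Assign then show ?case by (auto elim: exec.cases)
next
  case Store then show ?case by (auto elim: exec.cases)
next
  case Seq
  from Seq.prems show ?case by cases (use Seq.IH in blast)+
next
  case CondTrue
  from CondTrue.prems show ?case by cases (use CondTrue in blast)+
next
  case CondFalse
  from CondFalse.prems show ?case by cases (use CondFalse in blast)+
next
  case WhileFalse
  from WhileFalse.prems show ?case by cases (use WhileFalse in auto)
next
  case WhileTrue
  from WhileTrue.prems show ?case by cases (use WhileTrue in blast)+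
qed

text \<open>Only the sizes and the values of the two permutations are given as input; in particular,
  a pair of curves generating the pattern is not.\<close>

definition input_state :: "nat \<Rightarrow> (nat \<Rightarrow> nat) \<Rightarrow> nat \<Rightarrow> (nat \<Rightarrow> nat) \<Rightarrow> state" where
  "input_state n t k \<pi> =
     ((\<lambda>x. 0)(''n'' := n, ''k'' := k),
      (\<lambda>i. if i \<in> {1..n} then t i else if i \<in> {n + 1..n + k} then \<pi> (i - n) else 0))"

definition accepting :: "state \<Rightarrow> bool" where
  "accepting s \<longleftrightarrow> fst s ''out'' \<noteq> 0"

end

theory Submission
  imports Defs
begin

text \<open>
  Join two positions of the pattern if they are neighbours or have neighbouring values. For a Jordan
  permutation, the arcs of the two curves between consecutive intersection points draw this graph
  in the plane, so it has no \<open>K\<^sub>6\<close> minor. By a variant of the argument of Alon, Seymour and Thomas,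
  graphs without such a minor have separators of order \<open>sqrt n\<close>. Placing a separator first and
  then the components one after another yields an order of the \<open>k\<close> positions in which every prefix
  has only \<open>O(sqrt k)\<close> vertices with a neighbour outside.

  The algorithm explores partial embeddings of the pattern and forgets the image of a position as soon as
  all its neighbours are placed, allowing at most \<open>O(sqrt k)\<close> remembered images at a time. It need not
  know the order, whose existence guarantees that an embedding is found if there is one. Since a
  position next to a forgotten one is always placed, whether a position is placed can change only at
  remembered positions, which leaves \<open>n\<close> to the power \<open>O(sqrt k)\<close> partial embeddings.
\<close>

section \<open>Separators of graphs without large clique minors\<close>

text \<open>The topological input is reduced to the nonplanarity of the complete bipartite graph on
  3 + 3 vertices, for which Janiszewski's theorems suffice. Six pairwise adjacent branch sets
  contain it after any split into two triples, which is why \<open>K\<^sub>6\<close> is excluded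
  instead of \<open>K\<^sub>5\<close>; only the constant suffers. The separator argument sees
  nothing but the excluded clique, so no faces or triangulations occur, and the curves matter only
  for excluding it. Forgetting is safe because neighbouring positions and neighbouring values form
  two Hamiltonian paths of the pattern graph: by transitivity, an assignment that respects the
  orders along the edges is an embedding. This half holds for every pattern and every limit; the
  drawing enters only when the limit has to suffice for an embedding to be found. Duplicates are
  detected by linear search, so the time is quadratic in the number of configurations, which merely
  doubles the exponent.\<close>

definition conn :: "('a \<Rightarrow> 'a \<Rightarrow> bool) \<Rightarrow> 'a set \<Rightarrow> bool" where
  "conn E S \<longleftrightarrow> (\<forall>A. A \<subseteq> S \<longrightarrow> A \<noteq> {} \<longrightarrow> A \<noteq> S \<longrightarrow> (\<exists>x\<in>A. \<exists>y\<in>S - A. E x y))"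

definition is_component :: "('a \<Rightarrow> 'a \<Rightarrow> bool) \<Rightarrow> 'a set \<Rightarrow> 'a set \<Rightarrow> bool" where
  "is_component E S B \<longleftrightarrow> B \<noteq> {} \<and> B \<subseteq> S \<and> conn E B \<and> (\<forall>x\<in>B. \<forall>y\<in>S - B. \<not> E x y)"

definition clique_model :: "('a \<Rightarrow> 'a \<Rightarrow> bool) \<Rightarrow> 'a set \<Rightarrow> 'a set set \<Rightarrow> bool" where
  "clique_model E \<V> \<C> \<longleftrightarrow> finite \<C> \<and> (\<forall>C\<in>\<C>. C \<noteq> {} \<and> C \<subseteq> \<V> \<and> conn E C) \<and>
     (\<forall>C\<in>\<C>. \<forall>D\<in>\<C>. C \<noteq> D \<longrightarrow> C \<inter> D = {} \<and> (\<exists>x\<in>C. \<exists>y\<in>D. E x y))"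

definition no_clique_minor :: "('a \<Rightarrow> 'a \<Rightarrow> bool) \<Rightarrow> nat \<Rightarrow> 'a set \<Rightarrow> bool" where
  "no_clique_minor E h \<V> \<longleftrightarrow> (\<forall>\<C>. clique_model E \<V> \<C> \<longrightarrow> card \<C> \<noteq> h)"

definition boundary :: "('a \<Rightarrow> 'a \<Rightarrow> bool) \<Rightarrow> 'a set \<Rightarrow> 'a set \<Rightarrow> 'a set" where
  "boundary E \<V> P = {u \<in> P. \<exists>w\<in>\<V> - P. E u w}"

lemma clique_model_subset: "clique_model E W \<C> \<Longrightarrow> W \<subseteq> \<V> \<Longrightarrow> clique_model E \<V> \<C>"
  unfolding clique_model_def by fastforce

lemma no_clique_minor_subset: "no_clique_minor E h \<V> \<Longrightarrow> W \<subseteq> \<V> \<Longrightarrow> no_clique_minor E h W"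
  unfolding no_clique_minor_def using clique_model_subset by blast

lemma conn_singleton [simp]: "conn E {x}"
  by (auto simp: conn_def)

lemma conn_crossing:
  assumes "conn E S" "A \<inter> S \<noteq> {}" "\<not> S \<subseteq> A"
  shows "\<exists>x\<in>A \<inter> S. \<exists>y\<in>S - A. E x y"
proof -
  have "A \<inter> S \<subseteq> S" "A \<inter> S \<noteq> S" using assms(3) by auto
  with assms(1,2) have "\<exists>x\<in>A \<inter> S. \<exists>y\<in>S - A \<inter> S. E x y" by (simp add: conn_def)
  then show ?thesis by auto
qed

text \<open>Induction along a connected set: no edge inside \<open>D\<close> leaves the nonempty set
  \<open>D \<inter> Q\<close>, so this cannot be a proper subset of \<open>D\<close>. It stands in
  for following a path step by step.\<close>

lemma conn_closed:
  assumes "conn E D" "x \<in> D" "x \<in> Q" "\<And>u v. u \<in> D \<Longrightarrow> v \<in> D \<Longrightarrow> u \<in> Q \<Longrightarrow> E u v \<Longrightarrow> v \<in> Q"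
  shows "D \<subseteq> Q"
proof (rule ccontr)
  assume "\<not> D \<subseteq> Q"
  moreover have "Q \<inter> D \<noteq> {}" using assms(2,3) by blast
  ultimately obtain u v where "u \<in> Q \<inter> D" "v \<in> D - Q" "E u v"
    using conn_crossing[OF assms(1)] by blast
  with assms(4)[of u v] show False by blast
qed

lemma is_component_absorb:
  assumes "is_component E S B" "D \<subseteq> S" "conn E D" "D \<inter> B \<noteq> {}"
  shows "D \<subseteq> B"
proof -
  from assms(4) obtain x where "x \<in> D" "x \<in> B" by blast
  then show ?thesis
    by (rule conn_closed[OF assms(3)]) (use assms(1,2) in \<open>auto simp: is_component_def\<close>)
qed

locale symmetric_graph =
  fixes E :: "'a \<Rightarrow> 'a \<Rightarrow> bool"
  assumes E_sym: "E x y \<Longrightarrow> E y x"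
begin

text \<open>The alternative \<open>x = y\<close> treats overlapping sets together with sets joined
  by an edge.\<close>

lemma conn_Un_edge:
  assumes S: "conn E S" and T: "conn E T" and xy: "x \<in> S" "y \<in> T" "E x y \<or> x = y"
  shows "conn E (S \<union> T)"
  unfolding conn_def
proof (intro allI impI)
  fix A assume A: "A \<subseteq> S \<union> T" "A \<noteq> {}" "A \<noteq> S \<union> T"
  show "\<exists>x\<in>A. \<exists>y\<in>S \<union> T - A. E x y"
  proof (cases "(A \<inter> S \<noteq> {} \<and> A \<inter> S \<noteq> S) \<or> (A \<inter> T \<noteq> {} \<and> A \<inter> T \<noteq> T)")
    case True
    then show ?thesis
    proof
      assume "A \<inter> S \<noteq> {} \<and> A \<inter> S \<noteq> S"
      then have "\<exists>x\<in>A \<inter> S. \<exists>y\<in>S - A. E x y" by (intro conn_crossing[OF S]) auto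
      then show ?thesis by blast
    next
      assume "A \<inter> T \<noteq> {} \<and> A \<inter> T \<noteq> T"
      then have "\<exists>x\<in>A \<inter> T. \<exists>y\<in>T - A. E x y" by (intro conn_crossing[OF T]) auto
      then show ?thesis by blast
    qed
  next
    case False
    then consider "A \<inter> S = {}" "T \<subseteq> A" | "A \<inter> T = {}" "S \<subseteq> A"
      using A by blast
    then show ?thesis
    proof cases
      case 1
      then have "x \<notin> A" "y \<in> A" using xy by auto
      then show ?thesis using xy E_sym[of x y] by blast
    next
      case 2
      then have "x \<in> A" "y \<notin> A" using xy by auto
      then show ?thesis using xy by blast
    qed
  qed
qed

lemma conn_Un_adjacent:
  assumes S: "conn E S" and T: "\<And>y. y \<in> T \<Longrightarrow> \<exists>x\<in>S. E x y"
  shows "conn E (S \<union> T)"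
  unfolding conn_def
proof (intro allI impI)
  fix A assume A: "A \<subseteq> S \<union> T" "A \<noteq> {}" "A \<noteq> S \<union> T"
  consider "A \<inter> S \<noteq> {} \<and> A \<inter> S \<noteq> S" | "A \<inter> S = {}" | "S \<subseteq> A" by blast
  then show "\<exists>x\<in>A. \<exists>y\<in>S \<union> T - A. E x y"
  proof cases
    case 1
    then have "\<exists>x\<in>A \<inter> S. \<exists>y\<in>S - A. E x y" by (intro conn_crossing[OF S]) auto
    then show ?thesis by blast
  next
    case 2
    with A obtain y where y: "y \<in> A" "y \<in> T" by blast
    from T[OF y(2)] obtain x where "x \<in> S" "E x y" by blast
    then show ?thesis using y 2 E_sym[of x y] by blast
  next
    case 3
    with A obtain y where y: "y \<notin> A" "y \<in> T" by blast
    from T[OF y(2)] obtain x where "x \<in> S" "E x y" by blast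
    then show ?thesis using y 3 by blast
  qed
qed

text \<open>Inserting \<open>v\<close> matters for empty \<open>I\<close>: the first branch set of a
  covey is grown when there are no others to reach.\<close>

lemma conn_UNION_common:
  assumes "finite I" "\<And>i. i \<in> I \<Longrightarrow> conn E (Q i) \<and> v \<in> Q i"
  shows "conn E (insert v (\<Union>i\<in>I. Q i))"
  using assms
proof (induction I rule: finite_induct)
  case (insert j I)
  have "conn E (insert v (\<Union>i\<in>I. Q i) \<union> Q j)"
    by (rule conn_Un_edge[of _ _ v v]) (use insert in auto)
  then show ?case by (simp add: Un_commute)
qed auto

lemma component_exists:
  assumes "finite S" "x \<in> S"
  obtains B where "is_component E S B" "x \<in> B"
proof -
  let ?F = "{B. B \<subseteq> S \<and> x \<in> B \<and> conn E B}"
  have "finite ?F" by (rule finite_subset[of _ "Pow S"]) (use assms in auto)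
  moreover have "{x} \<in> ?F" using assms by auto
  ultimately have "\<exists>B\<in>?F. {x} \<subseteq> B \<and> (\<forall>D\<in>?F. B \<subseteq> D \<longrightarrow> B = D)"
    by (rule finite_has_maximal2)
  then obtain B where B: "B \<in> ?F" and mx: "\<forall>D\<in>?F. B \<subseteq> D \<longrightarrow> B = D" by (elim bexE conjE)
  have "\<not> E u v" if "u \<in> B" "v \<in> S - B" for u v
  proof
    assume "E u v"
    then have "conn E (B \<union> {v})" by (intro conn_Un_edge[of _ _ u v]) (use B that in auto)
    then have "B \<union> {v} \<in> ?F" using B that by auto
    from bspec[OF mx this] have "v \<in> B" by auto
    with that show False by auto
  qed
  then have "is_component E S B" using B by (auto simp: is_component_def)
  with B show ?thesis using that by blast
qed

section \<open>Breadth-first balls and layers inside a component\<close>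

fun ball_in :: "'a set \<Rightarrow> 'a set \<Rightarrow> nat \<Rightarrow> 'a set" where
  "ball_in B A 0 = A"
| "ball_in B A (Suc i) = ball_in B A i \<union> {v \<in> B. \<exists>u\<in>ball_in B A i. E u v}"

fun layer_in :: "'a set \<Rightarrow> 'a set \<Rightarrow> nat \<Rightarrow> 'a set" where
  "layer_in B A 0 = A"
| "layer_in B A (Suc i) = ball_in B A (Suc i) - ball_in B A i"

lemma ball_in_subset: "A \<subseteq> B \<Longrightarrow> ball_in B A i \<subseteq> B"
  by (induction i) auto

lemma ball_in_centre: "A \<subseteq> ball_in B A i"
  by (induction i) auto

lemma layer_in_subset: "layer_in B A i \<subseteq> ball_in B A i"
  by (cases i) auto

lemma conn_ball_in:
  assumes "conn E C" "\<And>y. y \<in> A \<Longrightarrow> \<exists>x\<in>C. E x y"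
  shows "conn E (C \<union> ball_in B A i)"
proof (induction i)
  case 0
  then show ?case using conn_Un_adjacent[OF assms] by simp
next
  case (Suc i)
  have "conn E ((C \<union> ball_in B A i) \<union> {v \<in> B. \<exists>u\<in>ball_in B A i. E u v})"
    by (rule conn_Un_adjacent[OF Suc]) blast
  then show ?case by (simp add: Un_assoc)
qed

text \<open>\<open>Q\<close> is the vertex set of a path traced back to the centre, with one vertex
  more than it has edges.\<close>

lemma ball_in_path:
  assumes "A \<subseteq> B" "v \<in> ball_in B A i"
  obtains Q where "conn E Q" "v \<in> Q" "Q \<subseteq> B" "Q \<inter> A \<noteq> {}" "finite Q" "card Q \<le> Suc i"
  using assms(2)
proof (induction i arbitrary: v thesis)
  case 0
  then show ?case using assms(1) by (intro "0.prems"(1)[of "{v}"]) auto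
next
  case (Suc i)
  show ?case
  proof (cases "v \<in> ball_in B A i")
    case True
    then show ?thesis using Suc.IH[of v] Suc.prems(1) by (metis le_SucI)
  next
    case False
    with Suc.prems obtain u where u: "v \<in> B" "u \<in> ball_in B A i" "E u v" by auto
    then obtain Q where Q: "conn E Q" "u \<in> Q" "Q \<subseteq> B" "Q \<inter> A \<noteq> {}" "finite Q" "card Q \<le> Suc i"
      using Suc.IH by metis
    have "conn E (Q \<union> {v})" by (rule conn_Un_edge[of _ _ u v]) (use Q u in auto)
    then show ?thesis using Q u by (intro Suc.prems(1)[of "Q \<union> {v}"]) (auto simp: card_insert_if)
  qed
qed

text \<open>All neighbours within \<open>B\<close> of the previous ball belong to the current one,
  so a vertex outside can only be adjacent to the last layer. Deleting this layer cuts off the whole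
  ball.\<close>

lemma ball_in_exit:
  assumes "y \<in> B - ball_in B A i" "z \<in> ball_in B A i" "E y z"
  shows "z \<in> layer_in B A i"
proof (cases i)
  case (Suc j)
  then show ?thesis using assms E_sym by auto
qed (use assms in auto)

lemma ball_in_mono: "i \<le> j \<Longrightarrow> ball_in B A i \<subseteq> ball_in B A j"
  by (induction j) (auto simp: le_Suc_eq)

lemma layer_in_disjoint: "i < j \<Longrightarrow> layer_in B A i \<inter> layer_in B A j = {}"
proof (cases j)
  case (Suc m)
  assume "i < j"
  then have "layer_in B A i \<subseteq> ball_in B A m"
    using layer_in_subset[of B A i] ball_in_mono[of i m B A] Suc by auto
  then show ?thesis using Suc by auto
qed auto

text \<open>Pigeonhole: \<open>r\<close> disjoint layers share at most \<open>r * r\<close>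
  vertices.\<close>

lemma small_layer_exists:
  assumes "finite B" "A \<subseteq> B" "card B \<le> r * r" "0 < r"
  obtains i where "i < r" "card (layer_in B A i) \<le> r"
proof -
  have sub: "layer_in B A i \<subseteq> B" for i
    using layer_in_subset ball_in_subset[OF assms(2)] by blast
  have "\<exists>i<r. card (layer_in B A i) \<le> r"
  proof (rule ccontr)
    assume "\<not> ?thesis"
    then have big: "Suc r \<le> card (layer_in B A i)" if "i < r" for i using that by (auto simp: not_le Suc_le_eq)
    have "r * Suc r = (\<Sum>i<r. Suc r)" by simp
    also have "\<dots> \<le> (\<Sum>i<r. card (layer_in B A i))" by (rule sum_mono) (use big in auto)
    also have "\<dots> = card (\<Union>i<r. layer_in B A i)"
    proof (rule card_UN_disjoint[symmetric])
      show "\<forall>i\<in>{..<r}. \<forall>j\<in>{..<r}. i \<noteq> j \<longrightarrow> layer_in B A i \<inter> layer_in B A j = {}"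
        using layer_in_disjoint by (metis inf_commute nat_neq_iff)
        qed (use finite_subset[OF sub assms(1)] in auto)
    also have "\<dots> \<le> card B" by (rule card_mono) (use sub assms(1) in auto)
    also have "\<dots> \<le> r * r" by fact
    finally show False using assms(4) by simp
  qed
  then show ?thesis using that by blast
qed

section \<open>Clique models and the induction over coveys\<close>

lemma clique_model_insert:
  assumes "clique_model E \<V> \<C>" "T \<noteq> {}" "T \<subseteq> \<V>" "conn E T"
    and "\<And>C. C \<in> \<C> \<Longrightarrow> C \<inter> T = {}" "\<And>C. C \<in> \<C> \<Longrightarrow> \<exists>x\<in>C. \<exists>y\<in>T. E x y"
  shows "clique_model E \<V> (insert T \<C>)"
proof -
  have "\<exists>x\<in>T. \<exists>y\<in>C. E x y" if "C \<in> \<C>" for C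
    using assms(6)[OF that] E_sym by blast
  then show ?thesis
    using assms unfolding clique_model_def by (simp add: Int_commute)
qed

lemma clique_model_adjacent:
  "clique_model E \<V> \<C> \<Longrightarrow> C \<in> \<C> \<Longrightarrow> D \<in> \<C> \<Longrightarrow> C \<noteq> D \<Longrightarrow> \<exists>x\<in>C. \<exists>y\<in>D. E x y"
  unfolding clique_model_def by simp

lemma clique_model_disjoint:
  "clique_model E \<V> \<C> \<Longrightarrow> C \<in> \<C> \<Longrightarrow> D \<in> \<C> \<Longrightarrow> C \<noteq> D \<Longrightarrow> C \<inter> D = {}"
  unfolding clique_model_def by simp

lemma clique_model_part:
  "clique_model E \<V> \<C> \<Longrightarrow> C \<in> \<C> \<Longrightarrow> C \<noteq> {} \<and> C \<subseteq> \<V> \<and> conn E C"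
  unfolding clique_model_def by simp

lemma clique_model_remove:
  "clique_model E \<V> \<C> \<Longrightarrow> clique_model E \<V> (\<C> - {C})"
  unfolding clique_model_def by auto

text \<open>
  A component with more than half of the vertices plays the role of the value of a haven.
  A triple \<open>(\<C>, X, B)\<close> consists of a clique model, a small set \<open>X\<close> inside it, and the big
  component \<open>B\<close> of the complement of \<open>X\<close>, which the model avoids.
\<close>

definition covey :: "'a set \<Rightarrow> nat \<Rightarrow> nat \<Rightarrow> 'a set set \<Rightarrow> 'a set \<Rightarrow> 'a set \<Rightarrow> bool" where
  "covey \<V> h r \<C> X B \<longleftrightarrow> clique_model E \<V> \<C> \<and> card \<C> < h \<and> X \<subseteq> \<Union>\<C> \<and>
     (\<forall>C\<in>\<C>. card (X \<inter> C) \<le> h * r \<and> B \<inter> C = {}) \<and>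
     is_component E (\<V> - X) B \<and> card \<V> < 2 * card B"

lemma covey_card:
  assumes "covey \<V> h r \<C> X B" "finite \<V>"
  shows "card X \<le> (h - 1) * (h * r)"
proof -
  have fin: "finite \<C>" and X: "X \<subseteq> \<Union>\<C>"
    using assms by (auto simp: covey_def clique_model_def)
  have "card X = card (\<Union>C\<in>\<C>. X \<inter> C)" using X by (intro arg_cong[of _ _ card]) auto
  also have "\<dots> \<le> (\<Sum>C\<in>\<C>. card (X \<inter> C))" by (rule card_UN_le[OF fin])
  also have "\<dots> \<le> (\<Sum>C\<in>\<C>. h * r)" by (rule sum_mono) (use assms in \<open>auto simp: covey_def\<close>)
  also have "\<dots> = card \<C> * (h * r)" by simp
  also have "\<dots> \<le> (h - 1) * (h * r)" using assms by (intro mult_right_mono) (auto simp: covey_def)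
  finally show ?thesis .
qed

lemma big_components_meet:
  assumes "finite \<V>" "B \<subseteq> \<V>" "D \<subseteq> \<V>" "card \<V> < 2 * card B" "card \<V> < 2 * card D"
  shows "B \<inter> D \<noteq> {}"
proof
  assume "B \<inter> D = {}"
  then have "card B + card D = card (B \<union> D)"
    using assms finite_subset by (intro card_Un_disjoint[symmetric]) auto
  also have "\<dots> \<le> card \<V>" using assms by (intro card_mono) auto
  finally show False using assms by simp
qed

text \<open>Without edges between \<open>C\<close> and \<open>B\<close>, the vertices of
  \<open>X\<close> inside \<open>C\<close> do not help to cut off \<open>B\<close>. They can be
  released together with \<open>C\<close>, and \<open>B\<close> remains a component.\<close>

lemma covey_detached:
  assumes cov: "covey \<V> h r \<C> X B" and C: "C \<in> \<C>" and no: "\<And>u v. u \<in> C \<Longrightarrow> v \<in> B \<Longrightarrow> \<not> E u v"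
  shows "covey \<V> h r (\<C> - {C}) (X - C) B"
proof -
  have BC: "B \<inter> C = {}" and fin: "finite \<C>" and comp: "is_component E (\<V> - X) B"
    using cov C by (auto simp: covey_def clique_model_def)
  have "is_component E (\<V> - (X - C)) B"
    using comp no E_sym unfolding is_component_def by blast
  moreover have "card (\<C> - {C}) < h"
    using cov le_less_trans[OF card_Diff1_le[of \<C> C]] by (simp add: covey_def)
  moreover have "card ((X - C) \<inter> D) \<le> h * r" if "D \<in> \<C> - {C}" for D
  proof -
    have "C \<inter> D = {}" using that C cov by (auto simp: covey_def clique_model_def)
    then have "(X - C) \<inter> D = X \<inter> D" by auto
    then show ?thesis using cov that by (auto simp: covey_def)
  qed
  ultimately show ?thesis
    using cov clique_model_remove[of \<V> \<C> C] unfolding covey_def by auto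
qed

text \<open>\<open>T\<close> becomes a new branch set. The excluded minor keeps the model below
  \<open>h\<close> members. Two sets with more than half of the vertices intersect, so the new big
  component lies in \<open>B\<close>, and it is strictly smaller because it avoids the nonempty
  \<open>T\<close>.\<close>

lemma covey_add_tree:
  assumes cov: "covey \<V> h r \<C> X B" and fin: "finite \<V>" and nm: "no_clique_minor E h \<V>"
    and T: "conn E T" "T \<noteq> {}" "T \<subseteq> B" "card T \<le> h * r"
    and adj: "\<And>C. C \<in> \<C> \<Longrightarrow> \<exists>x\<in>C. \<exists>y\<in>T. E x y"
    and B': "is_component E (\<V> - (X \<union> T)) B'" "card \<V> < 2 * card B'"
  shows "covey \<V> h r (insert T \<C>) (X \<union> T) B'" "card B' < card B"
proof -
  have comp: "is_component E (\<V> - X) B" and big: "card \<V> < 2 * card B"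
    and model: "clique_model E \<V> \<C>" and BC: "\<And>C. C \<in> \<C> \<Longrightarrow> B \<inter> C = {}"
    using cov by (auto simp: covey_def)
  have sub: "B \<subseteq> \<V>" "B' \<subseteq> \<V>" using comp B'(1) by (auto simp: is_component_def)
  have B'B: "B' \<subseteq> B"
    using B'(1) big_components_meet[OF fin sub(2,1) B'(2) big]
    by (intro is_component_absorb[OF comp]) (auto simp: is_component_def)
  have B'T: "B' \<inter> T = {}" using B'(1) by (auto simp: is_component_def)
  have "B' \<subset> B" using B'B B'T T(2,3) by auto
  then show "card B' < card B" using fin sub by (meson finite_subset psubset_card_mono)
  have model': "clique_model E \<V> (insert T \<C>)"
    using clique_model_insert[OF model T(2) _ T(1) _ adj] T(3) sub BC by blast
  have TC: "C \<inter> T = {}" if "C \<in> \<C>" for C using BC[OF that] T(3) by auto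
  have XB: "X \<inter> B = {}" using comp by (auto simp: is_component_def)
  have "T \<notin> \<C>" using BC[of T] T by auto
  then have "card (insert T \<C>) = Suc (card \<C>)" using model by (simp add: clique_model_def)
  moreover have "card (insert T \<C>) \<noteq> h" using nm model' by (auto simp: no_clique_minor_def)
  ultimately have c': "card (insert T \<C>) < h" using cov by (auto simp: covey_def)
  have cX': "card ((X \<union> T) \<inter> C) \<le> h * r" if "C \<in> insert T \<C>" for C
  proof (cases "C = T")
    case True
    then have "(X \<union> T) \<inter> C = T" by auto
    then show ?thesis using T(4) by simp
  next
    case False
    then have "(X \<union> T) \<inter> C = X \<inter> C" using that TC by auto
    then show ?thesis using cov that False by (auto simp: covey_def)
  qed
  have XC': "X \<union> T \<subseteq> \<Union>(insert T \<C>)" using cov by (auto simp: covey_def)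
  have BC': "B' \<inter> C = {}" if "C \<in> insert T \<C>" for C
    using that B'T B'B BC by auto
  show "covey \<V> h r (insert T \<C>) (X \<union> T) B'"
    unfolding covey_def by (intro conjI ballI model' c' XC' cX' BC' B')
qed

text \<open>\<open>C\<close> swallows a ball around its neighbourhood in \<open>B\<close>, and the
  layer bounding this ball takes over from \<open>X \<inter> C\<close>. The set \<open>D\<close>
  witnesses that a big connected set remains beyond the layer.\<close>

lemma covey_absorb:
  assumes cov: "covey \<V> h r \<C> X B" and fin: "finite \<V>" and C: "C \<in> \<C>"
    and A: "A = {v \<in> B. \<exists>u\<in>C. E u v}" "A \<noteq> {}"
    and L: "card (layer_in B A i) \<le> h * r"
    and D: "conn E D" "D \<subseteq> B" "D \<inter> layer_in B A i = {}" "x \<in> D" "x \<notin> ball_in B A i"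
      "card \<V> < 2 * card D"
  obtains \<C>' X' B' where "covey \<V> h r \<C>' X' B'" "card B' < card B" "card \<C>' \<le> card \<C>"
proof -
  let ?F = "ball_in B A i" and ?L = "layer_in B A i"
  let ?C' = "C \<union> ?F" and ?X' = "(X - C) \<union> ?L"
  let ?\<C>' = "insert ?C' (\<C> - {C})"
  have comp: "is_component E (\<V> - X) B" and big: "card \<V> < 2 * card B"
    and model: "clique_model E \<V> \<C>" and BC: "\<And>C. C \<in> \<C> \<Longrightarrow> B \<inter> C = {}"
    using cov by (auto simp: covey_def)
  have BV: "B \<subseteq> \<V>" and XB: "X \<inter> B = {}" using comp by (auto simp: is_component_def)
  have AB: "A \<subseteq> B" using A by auto
  have FB: "?F \<subseteq> B" by (rule ball_in_subset[OF AB])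
  have LF: "?L \<subseteq> ?F" by (rule layer_in_subset)
  have AF: "A \<subseteq> ?F" by (rule ball_in_centre)
  have xV: "x \<in> \<V> - ?X'" using D XB BV by auto
  obtain B' where B': "is_component E (\<V> - ?X') B'" "x \<in> B'"
    using component_exists[OF _ xV] fin by blast
  \<comment> \<open>An edge leaving \<open>B - ?F\<close> inside \<open>B'\<close> would lead either
    to \<open>X\<close>, hence to \<open>C\<close>, although all vertices of \<open>B\<close> next
    to \<open>C\<close> lie in the ball; or into the ball through its last layer, which is
    deleted.\<close>
  have B'sub: "B' \<subseteq> B - ?F"
  proof (rule conn_closed[OF _ B'(2)])
    show "conn E B'" using B' by (simp add: is_component_def)
    show "x \<in> B - ?F" using D by auto
    fix y z assume yz: "y \<in> B'" "z \<in> B'" "y \<in> B - ?F" "E y z"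
    have zV: "z \<in> \<V>" "z \<notin> ?X'" using B' yz(2) by (auto simp: is_component_def)
    have "z \<notin> X"
    proof
      assume "z \<in> X"
      then have "z \<in> C" using zV by auto
      then have "y \<in> A" using A(1) yz E_sym[OF yz(4)] by auto
      then show False using AF yz(3) by auto
    qed
    then have zB: "z \<in> B" using comp yz(3,4) zV by (auto simp: is_component_def)
    moreover have "z \<notin> ?F" using ball_in_exit[OF yz(3) _ yz(4)] zV by auto
    ultimately show "z \<in> B - ?F" by auto
  qed
  have "D \<subseteq> B'"
    using is_component_absorb[OF B'(1) _ D(1)] D(2,3,4) B'(2) XB BV by blast
  have finB: "finite B" by (rule finite_subset[OF BV fin])
  have finB': "finite B'" by (rule finite_subset[OF _ finB]) (use B'sub in auto)
  have "card D \<le> card B'" by (rule card_mono[OF finB' \<open>D \<subseteq> B'\<close>])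
  then have big': "card \<V> < 2 * card B'" using D(6) by linarith
  have "B' \<subset> B" using B'sub AF A(2) AB by blast
  then have lt: "card B' < card B" by (rule psubset_card_mono[OF finB])
  have connC': "conn E ?C'"
    by (rule conn_ball_in) (use clique_model_part[OF model C] A in auto)
  have "clique_model E \<V> (\<C> - {C})" by (rule clique_model_remove[OF model])
  moreover have "K \<inter> ?C' = {}" if "K \<in> \<C> - {C}" for K
    using that clique_model_disjoint[OF model _ C, of K] BC[of K] FB by blast
  moreover have "\<exists>x\<in>K. \<exists>y\<in>?C'. E x y" if "K \<in> \<C> - {C}" for K
    using that clique_model_adjacent[OF model _ C, of K] by blast
  moreover have "?C' \<subseteq> \<V>" "?C' \<noteq> {}"
    using clique_model_part[OF model C] FB BV by auto
  ultimately have model': "clique_model E \<V> ?\<C>'"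
    using connC' by (intro clique_model_insert) auto
  have "finite \<C>" "card \<C> > 0" using model C by (auto simp: clique_model_def card_gt_0_iff)
  then have card': "card ?\<C>' \<le> card \<C>"
    using C card_insert_le_m1[of "card \<C>" "\<C> - {C}" ?C'] by simp
  have cX': "card (?X' \<inter> K) \<le> h * r" if "K \<in> ?\<C>'" for K
  proof (cases "K = ?C'")
    case True
    then have "?X' \<inter> K = ?L" using XB FB LF by auto
    then show ?thesis using L by simp
  next
    case False
    then have K: "K \<in> \<C>" "K \<noteq> C" using that by auto
    have "K \<inter> C = {}" using K C model by (auto simp: clique_model_def)
    moreover have "K \<inter> ?L = {}" using BC[OF K(1)] LF FB by auto
    ultimately have "?X' \<inter> K = X \<inter> K" by auto
    then show ?thesis using cov K by (auto simp: covey_def)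
  qed
  have XC': "?X' \<subseteq> \<Union>?\<C>'"
    using cov LF unfolding covey_def by blast
  have BC': "B' \<inter> K = {}" if "K \<in> ?\<C>'" for K
    using that B'sub BC C by blast
  have "card ?\<C>' < h" using cov by (intro le_less_trans[OF card']) (simp add: covey_def)
  then have "covey \<V> h r ?\<C>' ?X' B'"
    unfolding covey_def by (intro conjI ballI model' XC' cX' BC' B'(1) big')
  then show ?thesis using that lt card' by blast
qed

text \<open>If every branch set has neighbours in \<open>B\<close>, grow a ball around each
  neighbourhood up to a layer of at most \<open>r\<close> vertices. A vertex in all balls is the
  root of a small tree touching all branch sets. Otherwise every vertex of \<open>B\<close> misses
  some ball, and a vertex of the big component that avoids all these layers tells which branch set
  can absorb its ball.\<close>

lemma covey_step:
  assumes cov: "covey \<V> h r \<C> X B" and fin: "finite \<V>" and nm: "no_clique_minor E h \<V>"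
    and r: "card \<V> \<le> r * r" "0 < r"
    and haven: "\<And>X. X \<subseteq> \<V> \<Longrightarrow> card X \<le> h * h * r \<Longrightarrow>
                  \<exists>B. is_component E (\<V> - X) B \<and> card \<V> < 2 * card B"
  obtains \<C>' X' B' where "covey \<V> h r \<C>' X' B'"
    "card B' < card B \<and> card \<C>' \<le> Suc (card \<C>) \<or> card B' \<le> card B \<and> card \<C>' < card \<C>"
proof -
  have comp: "is_component E (\<V> - X) B" and big: "card \<V> < 2 * card B"
    and model: "clique_model E \<V> \<C>" and BC: "\<And>C. C \<in> \<C> \<Longrightarrow> B \<inter> C = {}"
    and XC: "X \<subseteq> \<Union>\<C>" and cardC: "card \<C> \<le> h - 1" and h: "0 < h"
    using cov by (auto simp: covey_def)
  have finC: "finite \<C>" using model by (simp add: clique_model_def)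
  have BV: "B \<subseteq> \<V>" and XB: "X \<inter> B = {}" and Bne: "B \<noteq> {}"
    using comp by (auto simp: is_component_def)
  have finB: "finite B" using BV fin finite_subset by blast
  have XV: "X \<subseteq> \<V>" using XC model by (auto simp: clique_model_def)
  \<comment> \<open>The budget of \<open>haven\<close>: \<open>X\<close> takes up at most
    \<open>(h - 1) * (h * r)\<close>, which leaves \<open>h * r\<close> for the tree or for the
    layers.\<close>
  have hh: "(h - 1) * (h * r) + h * r = h * h * r"
    using h by (cases h) (auto simp: algebra_simps)
  have cX: "card X \<le> (h - 1) * (h * r)" by (rule covey_card[OF cov fin])
  define A where "A C = {v \<in> B. \<exists>u\<in>C. E u v}" for C
  have AB: "A C \<subseteq> B" for C by (auto simp: A_def)
  show ?thesis
  proof (cases "\<exists>C\<in>\<C>. A C = {}")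
    case True
    then obtain C where C: "C \<in> \<C>" "A C = {}" by blast
    have "covey \<V> h r (\<C> - {C}) (X - C) B"
      by (rule covey_detached[OF cov C(1)]) (use C(2) in \<open>auto simp: A_def\<close>)
    moreover have "card (\<C> - {C}) < card \<C>" using C finC by (meson card_Diff1_less)
    ultimately show ?thesis using that by blast
  next
    case False
    then have Ane: "A C \<noteq> {}" if "C \<in> \<C>" for C using that by blast
    have "\<exists>i<r. card (layer_in B (A C) i) \<le> r" for C
    proof -
      have "card B \<le> r * r" using card_mono[OF fin BV] r by simp
      then show ?thesis using small_layer_exists[OF finB AB _ r(2)] by metis
    qed
    then obtain i where i: "\<And>C. i C < r" "\<And>C. card (layer_in B (A C) (i C)) \<le> r" by metis
    show ?thesis
    proof (cases "\<exists>v\<in>B. \<forall>C\<in>\<C>. v \<in> ball_in B (A C) (i C)")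
      case True
      then obtain v where v: "v \<in> B" "\<And>C. C \<in> \<C> \<Longrightarrow> v \<in> ball_in B (A C) (i C)" by blast
      have "\<exists>Q. conn E Q \<and> v \<in> Q \<and> Q \<subseteq> B \<and> Q \<inter> A C \<noteq> {} \<and> finite Q \<and> card Q \<le> r"
        if C: "C \<in> \<C>" for C
      proof -
        obtain Q where "conn E Q" "v \<in> Q" "Q \<subseteq> B" "Q \<inter> A C \<noteq> {}" "finite Q" "card Q \<le> Suc (i C)"
          by (rule ball_in_path[OF AB v(2)[OF C]])
        moreover have "Suc (i C) \<le> r" using i(1)[of C] by simp
        ultimately show ?thesis using le_trans by blast
      qed
      then obtain Q where Q: "\<And>C. C \<in> \<C> \<Longrightarrow> conn E (Q C) \<and> v \<in> Q C \<and> Q C \<subseteq> B \<and>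
          Q C \<inter> A C \<noteq> {} \<and> finite (Q C) \<and> card (Q C) \<le> r" by metis
      define T where "T = insert v (\<Union>C\<in>\<C>. Q C)"
      have T: "conn E T" unfolding T_def by (rule conn_UNION_common[OF finC]) (use Q in blast)
      have TB: "T \<subseteq> B" using Q v by (auto simp: T_def)
      have finQ: "finite (\<Union>C\<in>\<C>. Q C)" using Q finC by blast
      have "card (\<Union>C\<in>\<C>. Q C) \<le> (\<Sum>C\<in>\<C>. card (Q C))" by (rule card_UN_le[OF finC])
      also have "\<dots> \<le> (\<Sum>C\<in>\<C>. r)" by (rule sum_mono) (use Q in blast)
      also have "\<dots> = card \<C> * r" by simp
      also have "\<dots> \<le> (h - 1) * r" by (rule mult_right_mono[OF cardC]) simp
      finally have "card T \<le> Suc ((h - 1) * r)"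
        unfolding T_def using finQ by (simp add: card_insert_if)
      \<comment> \<open>At most \<open>h - 1\<close> paths of \<open>r\<close> vertices each;
        \<open>0 < r\<close> makes room for the root.\<close>
      also have "\<dots> \<le> h * r" using h r(2) by (cases h) auto
      finally have cT: "card T \<le> h * r" .
      have "card (X \<union> T) \<le> h * h * r" using card_Un_le[of X T] cX cT hh by linarith
      then obtain B' where B': "is_component E (\<V> - (X \<union> T)) B'" "card \<V> < 2 * card B'"
        using haven[of "X \<union> T"] XV TB BV by blast
      have adj: "\<exists>x\<in>C. \<exists>y\<in>T. E x y" if C: "C \<in> \<C>" for C
      proof -
        obtain y where "y \<in> Q C" "y \<in> A C" using Q[OF C] by blast
        then show ?thesis using C unfolding T_def A_def by blast
      qed
      have ne: "T \<noteq> {}" by (simp add: T_def)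
      note step = covey_add_tree[OF cov fin nm T ne TB cT adj B']
      show ?thesis by (rule that[OF step(1)]) (use step(2) finC in \<open>auto simp: card_insert_if\<close>)
    next
      case False
      define Z where "Z = (\<Union>C\<in>\<C>. layer_in B (A C) (i C))"
      have ZB: "Z \<subseteq> B" using layer_in_subset ball_in_subset[OF AB] by (fastforce simp: Z_def)
      have "card Z \<le> (\<Sum>C\<in>\<C>. card (layer_in B (A C) (i C)))"
        unfolding Z_def by (rule card_UN_le[OF finC])
      also have "\<dots> \<le> (\<Sum>C\<in>\<C>. r)" by (rule sum_mono) (use i in blast)
      also have "\<dots> = card \<C> * r" by simp
      also have "\<dots> \<le> h * r" using cardC by (intro mult_right_mono) auto
      finally have "card (X \<union> Z) \<le> h * h * r" using card_Un_le[of X Z] cX hh by linarith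
      then obtain D where D: "is_component E (\<V> - (X \<union> Z)) D" "card \<V> < 2 * card D"
        using haven[of "X \<union> Z"] XV ZB BV by blast
      have DV: "D \<subseteq> \<V>" "D \<noteq> {}" "conn E D" "D \<inter> Z = {}" "D \<inter> X = {}"
        using D by (auto simp: is_component_def)
      have DB: "D \<subseteq> B"
        using DV big_components_meet[OF fin DV(1) BV D(2) big]
        by (intro is_component_absorb[OF comp]) auto
      obtain x where x: "x \<in> D" using DV by blast
      with False DB obtain C where C: "C \<in> \<C>" "x \<notin> ball_in B (A C) (i C)" by blast
      have "card (layer_in B (A C) (i C)) \<le> h * r"
        using i(2)[of C] h by (cases h) auto
      moreover have "D \<inter> layer_in B (A C) (i C) = {}" using DV(4) C by (auto simp: Z_def)
      ultimately obtain \<C>' X' B' where "covey \<V> h r \<C>' X' B'" "card B' < card B" "card \<C>' \<le> card \<C>"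
        using covey_absorb[OF cov fin C(1) A_def Ane[OF C(1)] _ DV(3) DB _ x C(2) D(2)] by blast
      then show ?thesis using that by (meson le_SucI)
    qed
  qed
qed

text \<open>If every small set left a big component, coveys could be improved forever. The measure
  \<open>h * card B + card \<C>\<close> rules this out: a model has fewer than \<open>h\<close>
  members, so losing one vertex of \<open>B\<close> outweighs any growth of the model.\<close>

theorem clique_minor_free_separator:
  assumes fin: "finite \<V>" and nm: "no_clique_minor E h \<V>" and r: "card \<V> \<le> r * r" "0 < r"
  obtains X where "X \<subseteq> \<V>" "card X \<le> h * h * r"
    "\<And>B. is_component E (\<V> - X) B \<Longrightarrow> 2 * card B \<le> card \<V>"
proof (rule ccontr)
  assume "\<not> thesis"
  with that have haven: "\<exists>B. is_component E (\<V> - X) B \<and> card \<V> < 2 * card B"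
    if "X \<subseteq> \<V>" "card X \<le> h * h * r" for X
    using that by (meson not_le)
  have none: "\<not> covey \<V> h r \<C> X B" for \<C> X B
  proof (induction "h * card B + card \<C>" arbitrary: \<C> X B rule: less_induct)
    case less
    show ?case
    proof
      assume cov: "covey \<V> h r \<C> X B"
      obtain \<C>' X' B' where cov': "covey \<V> h r \<C>' X' B'" and
        dec: "card B' < card B \<and> card \<C>' \<le> Suc (card \<C>) \<or> card B' \<le> card B \<and> card \<C>' < card \<C>"
        using covey_step[OF cov fin nm r haven] by blast
      have small: "card \<C>' < h" using cov' by (simp add: covey_def)
      have "h * card B' + card \<C>' < h * card B + card \<C>"
      proof (cases "card B' < card B")
        case True
        then have "h * Suc (card B') \<le> h * card B" by (intro mult_le_mono2) simp
        with small show ?thesis by simp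
      next
        case False
        with dec show ?thesis by (auto intro: add_le_less_mono mult_le_mono2)
      qed
      with less cov' show False by blast
    qed
  qed
  obtain B where "is_component E (\<V> - {}) B" "card \<V> < 2 * card B"
    using haven[of "{}"] by auto
  \<comment> \<open>For \<open>h = 0\<close> the empty model would already be the excluded minor.
    With \<open>0 < h\<close> the empty model is a covey to start from.\<close>
  moreover have "0 < h"
  proof (rule ccontr)
    assume "\<not> 0 < h"
    then have "clique_model E \<V> {}" "card ({} :: 'a set set) = h" by (auto simp: clique_model_def)
    with nm show False unfolding no_clique_minor_def by blast
  qed
  ultimately have "covey \<V> h r {} {} B"
    by (simp add: covey_def clique_model_def)
  with none show False by blast
qed

section \<open>Vertex orders with small prefix boundaries\<close>

definition layout :: "'a set \<Rightarrow> real \<Rightarrow> 'a list \<Rightarrow> bool" where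
  "layout \<V> b xs \<longleftrightarrow> distinct xs \<and> set xs = \<V> \<and> (\<forall>i. real (card (boundary E \<V> (set (take i xs)))) \<le> b)"

text \<open>No edge joins two components of the complement of \<open>X\<close>. While one of them is
  being listed, only \<open>X\<close> and the listed part of that component can have neighbours
  still to come.\<close>

lemma layout_from_separator:
  fixes b :: real
  assumes fin: "finite \<V>" and X: "X \<subseteq> \<V>" and b: "0 \<le> b"
    and lay: "\<And>D. is_component E (\<V> - X) D \<Longrightarrow> \<exists>ys. layout D b ys"
  shows "\<exists>xs. layout \<V> (card X + b) xs"
proof -
  let ?good = "\<lambda>xs. \<forall>i. real (card (boundary E \<V> (set (take i xs)))) \<le> card X + b"
  have finX: "finite X" using fin X finite_subset by blast
  \<comment> \<open>Generalised to any listed part \<open>xs\<close> that contains \<open>X\<close>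
    and has no edge from \<open>set xs - X\<close> to unlisted vertices. A component of the rest is
    then also a component of \<open>\<V> - X\<close>.\<close>
  have "\<exists>zs. distinct zs \<and> set zs = \<V> \<and> ?good zs"
    if "distinct xs" "X \<subseteq> set xs" "set xs \<subseteq> \<V>" "?good xs"
      "\<And>u w. u \<in> set xs - X \<Longrightarrow> w \<in> \<V> - set xs \<Longrightarrow> \<not> E u w" for xs
    using that
  proof (induction "card (\<V> - set xs)" arbitrary: xs rule: less_induct)
    case less
    show ?case
    proof (cases "set xs = \<V>")
      case True
      with less.prems show ?thesis by blast
    next
      case False
      then obtain y where "y \<in> \<V> - set xs" using less.prems by auto
      then obtain D where D: "is_component E (\<V> - set xs) D" using fin component_exists by (metis finite_Diff)
      then have Ds: "D \<subseteq> \<V>" "D \<inter> set xs = {}" "D \<noteq> {}" by (auto simp: is_component_def)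
      have nb: "w \<in> D \<or> w \<in> X" if "u \<in> D" "w \<in> \<V>" "E u w" for u w
      proof (rule ccontr)
        assume w: "\<not> (w \<in> D \<or> w \<in> X)"
        then have "w \<in> set xs" using D that by (auto simp: is_component_def)
        with w less.prems(5)[of w u] E_sym[OF that(3)] Ds that(1) show False by auto
      qed
      have "is_component E (\<V> - X) D"
        using D nb less.prems(2) unfolding is_component_def by blast
      then obtain ys where ys: "distinct ys" "set ys = D"
          "\<And>i. real (card (boundary E D (set (take i ys)))) \<le> b"
        using lay unfolding layout_def by blast
      have "?good (xs @ ys)"
      proof
        fix i
        show "real (card (boundary E \<V> (set (take i (xs @ ys))))) \<le> card X + b"
        proof (cases "i \<le> length xs")
          case True
          then show ?thesis using less.prems(4) by simp
        next
          case False
          let ?Y = "set (take (i - length xs) ys)"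
          have YD: "?Y \<subseteq> D" using ys(2) set_take_subset by fastforce
          have "boundary E \<V> (set (take i (xs @ ys))) \<subseteq> X \<union> boundary E D ?Y"
          proof
            fix u assume "u \<in> boundary E \<V> (set (take i (xs @ ys)))"
            then obtain w where uw: "u \<in> set xs \<union> ?Y" "w \<in> \<V>" "w \<notin> set xs" "w \<notin> ?Y" "E u w"
              using False by (auto simp: boundary_def)
            show "u \<in> X \<union> boundary E D ?Y"
            proof (cases "u \<in> set xs")
              case True
              then show ?thesis using less.prems(5)[of u w] uw by auto
            next
              case False
              then have "u \<in> ?Y" using uw by auto
              moreover have "w \<in> D" using nb[of u w] uw \<open>u \<in> ?Y\<close> YD less.prems(2) by auto
              ultimately show ?thesis using uw by (auto simp: boundary_def)
            qed
          qed
          moreover have "finite (X \<union> boundary E D ?Y)" using finX by (auto simp: boundary_def)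
          ultimately have "card (boundary E \<V> (set (take i (xs @ ys)))) \<le> card (X \<union> boundary E D ?Y)"
            by (intro card_mono)
          also have "\<dots> \<le> card X + card (boundary E D ?Y)" by (rule card_Un_le)
          finally show ?thesis using ys(3)[of "i - length xs"] by linarith
        qed
      qed
      moreover have "card (\<V> - set (xs @ ys)) < card (\<V> - set xs)"
      proof -
        obtain d where "d \<in> D" using Ds by auto
        then have "d \<in> \<V> - set xs" "d \<notin> \<V> - set (xs @ ys)" using Ds ys(2) by auto
        then show ?thesis using fin by (intro psubset_card_mono) auto
      qed
      moreover have "\<not> E u w" if "u \<in> set (xs @ ys) - X" "w \<in> \<V> - set (xs @ ys)" for u w
      proof
        assume "E u w"
        then show False using that less.prems(5)[of u w] nb[of u w] less.prems(2) ys(2) by auto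
      qed
      ultimately show ?thesis using less.prems(1-3) Ds ys(1,2)
        by (intro less.hyps[of "xs @ ys"]) auto
    qed
  qed
  moreover obtain xs where xs: "set xs = X" "distinct xs" using finite_distinct_list[OF finX] by blast
  moreover have "?good xs"
  proof
    fix i
    have "card (boundary E \<V> (set (take i xs))) \<le> card X"
      using finX xs set_take_subset by (intro card_mono) (fastforce simp: boundary_def)+
    then show "real (card (boundary E \<V> (set (take i xs)))) \<le> card X + b" using b by linarith
  qed
  ultimately show ?thesis using X unfolding layout_def by (metis Diff_cancel empty_iff subset_refl)
qed

text \<open>The constant \<open>7\<close> is chosen such that \<open>2 + 7 / sqrt 2 \<le> 7\<close>, where \<open>2 h\<^sup>2 sqrt n\<close> bounds the separator.\<close>

theorem clique_minor_free_layout: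
  assumes "finite \<V>" and "no_clique_minor E h \<V>"
  shows "\<exists>xs. layout \<V> (7 * (real h)\<^sup>2 * sqrt (card \<V>)) xs"
  using assms
proof (induction "card \<V>" arbitrary: \<V> rule: less_induct)
  case less
  show ?case
  proof (cases "\<V> = {}")
    case True
    then have "layout \<V> (7 * (real h)\<^sup>2 * sqrt (card \<V>)) []" by (simp add: layout_def boundary_def)
    then show ?thesis by blast
  next
    case False
    define n where "n = card \<V>"
    define r where "r = nat \<lceil>sqrt n\<rceil>"
    have n: "0 < n" using False less.prems by (simp add: n_def card_gt_0_iff)
    have r1: "sqrt n \<le> r" by (simp add: r_def)
    have "0 < r" using r1 n by (metis gr0I not_less of_nat_0 of_nat_0_less_iff real_sqrt_gt_zero)
    have "real n = sqrt n * sqrt n" by simp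
    also have "\<dots> \<le> real r * real r" using r1 by (intro mult_mono) auto
    finally have nr: "n \<le> r * r" by (metis of_nat_le_iff of_nat_mult)
    have "1 \<le> sqrt n" using n by simp
    then have r2: "real r \<le> 2 * sqrt n" unfolding r_def by linarith
    obtain X where X: "X \<subseteq> \<V>" "card X \<le> h * h * r"
        "\<And>B. is_component E (\<V> - X) B \<Longrightarrow> 2 * card B \<le> card \<V>"
      using clique_minor_free_separator[OF less.prems nr[unfolded n_def] \<open>0 < r\<close>] by blast
    define b where "b = 5 * (real h)\<^sup>2 * sqrt n"
    have "\<exists>ys. layout D b ys" if "is_component E (\<V> - X) D" for D
    proof -
      have D: "2 * card D \<le> n" "D \<subseteq> \<V>" using X(3)[OF that] that by (auto simp: n_def is_component_def)
      have "card D < card \<V>" using D(1) n unfolding n_def by linarith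
      then obtain ys where ys: "layout D (7 * (real h)\<^sup>2 * sqrt (card D)) ys"
        using less.hyps[OF _ finite_subset[OF D(2) less.prems(1)]
            no_clique_minor_subset[OF less.prems(2) D(2)]] by blast
      \<comment> \<open>Halving the number of vertices divides 7 by \<open>sqrt 2\<close>; compared
        as squares, \<open>49 \<le> 2 * 25\<close>. The remaining 2 of 7 pays for the
        separator.\<close>
      have "2 * (7 * sqrt (card D))\<^sup>2 \<le> (7 * sqrt n)\<^sup>2" using D(1) by (simp add: power_mult_distrib)
      also have "\<dots> \<le> 2 * (5 * sqrt n)\<^sup>2" by (simp add: power_mult_distrib)
      finally have "7 * sqrt (card D) \<le> 5 * sqrt n"
        by (intro power2_le_imp_le[of "7 * sqrt (card D)"]) auto
      then have "(real h)\<^sup>2 * (7 * sqrt (card D)) \<le> (real h)\<^sup>2 * (5 * sqrt n)"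
        by (rule mult_left_mono) simp
      then have "7 * (real h)\<^sup>2 * sqrt (card D) \<le> b" by (simp add: b_def algebra_simps)
      then show ?thesis using ys order_trans unfolding layout_def by blast
    qed
    then obtain xs where xs: "layout \<V> (real (card X) + b) xs"
      using layout_from_separator[OF less.prems(1) X(1), of b] by (auto simp: b_def)
    have "real (card X) \<le> real (h * h * r)" using X(2) by (simp only: of_nat_le_iff)
    also have "\<dots> = (real h)\<^sup>2 * real r" by (simp add: power2_eq_square)
    also have "\<dots> \<le> (real h)\<^sup>2 * (2 * sqrt n)" by (rule mult_left_mono[OF r2]) simp
    finally have "card X + b \<le> 7 * (real h)\<^sup>2 * sqrt n" by (simp add: b_def algebra_simps)
    then show ?thesis using xs order_trans unfolding layout_def n_def by blast
  qed
qed

end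

section \<open>Graphs drawn in the plane\<close>

lemma connected_open_closed_in:
  assumes "connected U" "D \<subseteq> U" "open D" "closure D \<inter> U \<subseteq> D" "D \<noteq> {}"
  shows "D = U"
proof -
  have "closedin (top_of_set U) D"
    unfolding closedin_closed using assms(2,4) closure_subset[of D]
    by (intro exI[of _ "closure D"]) auto
  moreover have "openin (top_of_set U) D"
    using assms(2,3) by (simp add: open_subset)
  ultimately show ?thesis using assms(1,5) connected_clopen by blast
qed

text \<open>\<open>D\<close> is the union of the components of the complement of \<open>J\<close>
  other than that of \<open>c\<close>. Components of open sets are open, so \<open>D\<close> and the
  part around \<open>c\<close> are both open, and \<open>D\<close> can only border on
  \<open>J\<close>.\<close>

lemma separation_residue:
  fixes J :: "'a :: euclidean_space set" and c :: 'a
  assumes "closed J"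
  defines "D \<equiv> - J - connected_component_set (- J) c"
  shows "open D" "closure D \<subseteq> D \<union> J"
proof -
  have "D = (\<Union>x\<in>D. connected_component_set (- J) x)"
  proof
    show "D \<subseteq> (\<Union>x\<in>D. connected_component_set (- J) x)"
      by (auto simp: D_def)
    show "(\<Union>x\<in>D. connected_component_set (- J) x) \<subseteq> D"
      unfolding D_def
      by (auto dest: connected_component_in connected_component_sym connected_component_trans)
  qed
  moreover have "open (\<Union>x\<in>D. connected_component_set (- J) x)"
    using assms(1) by (intro open_UN ballI open_connected_component) auto
  ultimately show "open D" by simp
  have "D \<union> J = - connected_component_set (- J) c"
    using connected_component_subset[of "- J" c] unfolding D_def by blast
  moreover have "open (connected_component_set (- J) c)"
    using assms(1) by (intro open_connected_component) auto
  ultimately have "closed (D \<union> J)" by (simp add: closed_Compl)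
  then show "closure D \<subseteq> D \<union> J" by (simp add: closure_minimal)
qed

text \<open>
  The nonplanarity of the complete bipartite graph on 3 + 3 vertices, with continua in place of vertices: \<open>A1\<close> and \<open>A2\<close> are two
  hubs joined by the three continua \<open>B j\<close>, and the third hub contains \<open>c\<close> and reaches \<open>B j\<close>
  inside \<open>M j\<close>. Each cycle through the hubs and two of the \<open>B j\<close> separates \<open>c\<close> from some \<open>D i j\<close>.
  These are disjoint, yet by Janiszewski's theorem a point of \<open>D 1 2\<close> cannot be separated from \<open>c\<close>
  without lying in \<open>D 0 1\<close> or \<open>D 0 2\<close>.
\<close>

theorem continua_K33:
  fixes A1 A2 :: "complex set" and B M :: "nat \<Rightarrow> complex set"
  assumes A: "compact A1" "connected A1" "compact A2" "connected A2" "A1 \<inter> A2 = {}"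
    and B: "\<And>j. j < 3 \<Longrightarrow> compact (B j)" "\<And>j. j < 3 \<Longrightarrow> connected (B j)"
    and AB: "\<And>j. j < 3 \<Longrightarrow> \<exists>p. A1 \<inter> B j = {p}" "\<And>j. j < 3 \<Longrightarrow> \<exists>p. A2 \<inter> B j = {p}"
    and BB: "\<And>i j. i < 3 \<Longrightarrow> j < 3 \<Longrightarrow> i \<noteq> j \<Longrightarrow> B i \<inter> B j \<subseteq> A1 \<union> A2"
    and Y: "\<And>j. j < 3 \<Longrightarrow> connected (- (A1 \<union> A2 \<union> B j))"
    and M: "\<And>j. j < 3 \<Longrightarrow> connected (M j)" "\<And>j. j < 3 \<Longrightarrow> c \<in> M j"
      "\<And>j. j < 3 \<Longrightarrow> B j - (A1 \<union> A2) \<subseteq> M j" "\<And>j. j < 3 \<Longrightarrow> M j \<inter> (A1 \<union> A2) = {}"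
      "\<And>i j. i < 3 \<Longrightarrow> j < 3 \<Longrightarrow> i \<noteq> j \<Longrightarrow> M i \<inter> B j = {}"
  shows False
proof -
  define J where "J i j = A1 \<union> A2 \<union> B i \<union> B j" for i j
  define K where "K i j = connected_component_set (- J i j) c" for i j
  define D where "D i j = - J i j - K i j" for i j
  have compJ: "compact (J i j)" if "i < 3" "j < 3" for i j
    unfolding J_def using A B that by (intro compact_Un) auto
  have closed: "closed (A1 \<union> A2 \<union> B i)" if "i < 3" for i
    using A B that by (intro compact_imp_closed compact_Un) auto
  have cn: "c \<notin> A1 \<union> A2 \<union> B i" if "i < 3" for i
  proof -
    obtain j :: nat where "j < 3" "j \<noteq> i" using that by (metis less_numeral_extra(1) one_less_numeral_iff semiring_norm(77) zero_less_numeral zero_neq_one)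
    then show ?thesis using M(2)[of j] M(4)[of j] M(5)[of j i] that by auto
  qed
  \<comment> \<open>\<open>M l\<close> avoids the cycle and contains \<open>c\<close>, so all of it
    lies on the side of \<open>c\<close>.\<close>
  have DM: "D i j \<inter> M l = {}" if "i < 3" "j < 3" "l < 3" "l \<noteq> i" "l \<noteq> j" for i j l
  proof -
    have "M l \<subseteq> - J i j" using that M(4)[of l] M(5)[of l i] M(5)[of l j] by (auto simp: J_def)
    then have "M l \<subseteq> K i j" unfolding K_def
      using M(1,2) that by (intro connected_component_maximal) auto
    then show ?thesis by (auto simp: D_def)
  qed
  have DB: "D i j \<inter> B l = {}" if "i < 3" "j < 3" "l < 3" for i j l
  proof (cases "l = i \<or> l = j")
    case True
    then show ?thesis by (auto simp: D_def J_def)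
  next
    case False
    then show ?thesis using DM[of i j l] M(3)[of l] that by (auto simp: D_def J_def)
  qed
  \<comment> \<open>If \<open>J i j\<close> did not separate the plane, Janiszewski's theorem would
    make the intersection of the continua \<open>A1 \<union> B i\<close> and
    \<open>A2 \<union> B j\<close> connected, but it consists of the two points \<open>p\<close> and
    \<open>q\<close>.\<close>
  have Dne: "D i j \<noteq> {}" if "i < 3" "j < 3" "i \<noteq> j" for i j
  proof
    assume "D i j = {}"
    then have "- J i j = K i j"
      unfolding D_def K_def using connected_component_subset[of "- J i j" c] by blast
    then have con: "connected (- ((A1 \<union> B i) \<union> (A2 \<union> B j)))"
      unfolding K_def J_def by (metis connected_connected_component sup_assoc sup_left_commute)
    have ne: "A1 \<inter> B i \<noteq> {}" "A2 \<inter> B j \<noteq> {}" using AB that by (metis empty_not_insert)+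
    have "connected ((A1 \<union> B i) \<inter> (A2 \<union> B j))"
      by (rule Janiszewski_dual[OF _ _ _ _ con])
        (use A B that ne in \<open>auto intro!: compact_Un connected_Un\<close>)
    moreover obtain p q where pq: "A1 \<inter> B j = {p}" "A2 \<inter> B i = {q}" using AB(1)[OF \<open>j < 3\<close>] AB(2)[OF \<open>i < 3\<close>] by blast
    have "(A1 \<union> B i) \<inter> (A2 \<union> B j) = {p, q}"
    proof -
      have "x = p \<or> x = q" if "x \<in> B i" "x \<in> B j" for x
        using BB[of i j] that \<open>i < 3\<close> \<open>j < 3\<close> \<open>i \<noteq> j\<close> pq by auto
      then show ?thesis using pq A(5) by auto
    qed
    moreover have "p \<noteq> q" using pq A(5) by auto
    ultimately show False using connected_finite_iff_sing[of "{p, q}"] by auto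
  qed
  \<comment> \<open>The intersection is open and borders only on
    \<open>A1 \<union> A2 \<union> B j\<close>, whose complement is connected. If nonempty, it would
    be all of that complement, including \<open>c\<close>.\<close>
  have Ddisj: "D i j \<inter> D j l = {}" if "i < 3" "j < 3" "l < 3" "i \<noteq> j" "j \<noteq> l" "i \<noteq> l" for i j l
  proof (rule ccontr)
    assume ne: "D i j \<inter> D j l \<noteq> {}"
    let ?D = "D i j \<inter> D j l"
    have cl: "closed (J i j)" "closed (J j l)" using compJ that by (auto intro: compact_imp_closed)
    have op: "open (D i j)" "open (D j l)"
      unfolding D_def K_def using separation_residue(1) cl by blast+
    have "closure (D i j) \<subseteq> D i j \<union> J i j" "closure (D j l) \<subseteq> D j l \<union> J j l"
      unfolding D_def K_def using separation_residue(2) cl by blast+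
    then have "closure ?D \<subseteq> (D i j \<union> J i j) \<inter> (D j l \<union> J j l)"
      using closure_mono[of ?D "D i j"] closure_mono[of ?D "D j l"] by blast
    also have "\<dots> \<subseteq> ?D \<union> (A1 \<union> A2 \<union> B j)"
      using DB[of i j l] DB[of j l i] BB[of i l] that by (auto simp: J_def D_def)
    finally have c: "closure ?D \<inter> - (A1 \<union> A2 \<union> B j) \<subseteq> ?D" by blast
    have "?D = - (A1 \<union> A2 \<union> B j)"
      using that op ne by (intro connected_open_closed_in[OF Y _ _ c]) (auto simp: D_def J_def)
    then have "c \<in> D i j" using cn that by auto
    then show False using cn[of i] cn[of j] that by (auto simp: D_def K_def J_def)
  qed
  obtain x where x: "x \<in> D 1 2" using Dne[of 1 2] by auto
  have JD: "D j i = D i j" for i j by (simp add: D_def K_def J_def Un_ac)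
  have "x \<notin> D 0 1" "x \<notin> D 0 2" using x Ddisj[of 0 1 2] Ddisj[of 0 2 1] JD[of 1 2] by auto
  moreover have "x \<notin> J 0 1" "x \<notin> J 0 2" using x DB[of 1 2 0] by (auto simp: D_def J_def)
  ultimately have "x \<in> K 0 1" "x \<in> K 0 2" by (auto simp: D_def)
  then have cc: "connected_component (- J 0 1) c x" "connected_component (- J 0 2) c x"
    by (auto simp: K_def)
  have "J 0 1 \<inter> J 0 2 = A1 \<union> (B 0 \<union> A2)"
    using BB[of 1 2] by (auto simp: J_def)
  moreover have "connected (A1 \<union> (B 0 \<union> A2))"
    using A B AB[of 0] by (intro connected_Un) auto
  ultimately have "connected_component (- (J 0 1 \<union> J 0 2)) c x"
    using cc compJ by (intro Janiszewski) (auto intro: compact_imp_closed)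
  moreover have "J 1 2 \<subseteq> J 0 1 \<union> J 0 2" by (auto simp: J_def)
  ultimately have "connected_component (- J 1 2) c x"
    by (meson Compl_anti_mono connected_component_of_subset)
  then show False using x by (auto simp: D_def K_def)
qed

text \<open>Janiszewski's theorem for a one-point intersection. It lets continua be glued like the
  edges of a tree without ever separating the plane.\<close>

lemma connected_Compl_Un_point:
  fixes S T :: "complex set"
  assumes "compact S" "compact T" "connected (- S)" "connected (- T)" "S \<inter> T = {p}"
  shows "connected (- (S \<union> T))"
  using assms by (intro Janiszewski_connected) (auto intro: compact_imp_closed)

text \<open>Arcs are replaced by the few properties that the topology uses. \<open>Ar_Compl\<close>
  lets edges be glued to trees, \<open>Ar_half\<close> lets an edge be detached from the hub where
  it starts. Edges are compared as unordered pairs, since \<open>Ar u v\<close> and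
  \<open>Ar v u\<close> draw the same edge.\<close>

locale arc_embedding = symmetric_graph E for E :: "'a \<Rightarrow> 'a \<Rightarrow> bool" +
  fixes \<V> :: "'a set" and pt :: "'a \<Rightarrow> complex" and Ar :: "'a \<Rightarrow> 'a \<Rightarrow> complex set"
  assumes inj_pt: "inj_on pt \<V>"
    and Ar_compact: "\<And>u v. u \<in> \<V> \<Longrightarrow> v \<in> \<V> \<Longrightarrow> E u v \<Longrightarrow> compact (Ar u v)"
    and Ar_connected: "\<And>u v. u \<in> \<V> \<Longrightarrow> v \<in> \<V> \<Longrightarrow> E u v \<Longrightarrow> connected (Ar u v)"
    and Ar_Compl: "\<And>u v. u \<in> \<V> \<Longrightarrow> v \<in> \<V> \<Longrightarrow> E u v \<Longrightarrow> connected (- Ar u v)"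
    and Ar_ends: "\<And>u v. u \<in> \<V> \<Longrightarrow> v \<in> \<V> \<Longrightarrow> E u v \<Longrightarrow> pt u \<in> Ar u v \<and> pt v \<in> Ar u v"
    and Ar_half: "\<And>u v. u \<in> \<V> \<Longrightarrow> v \<in> \<V> \<Longrightarrow> E u v \<Longrightarrow> connected (Ar u v - {pt u})"
    and Ar_pt: "\<And>u v. u \<in> \<V> \<Longrightarrow> v \<in> \<V> \<Longrightarrow> E u v \<Longrightarrow> Ar u v \<inter> pt ` \<V> \<subseteq> {pt u, pt v}"
    and Ar_cross: "\<And>u v x y. u \<in> \<V> \<Longrightarrow> v \<in> \<V> \<Longrightarrow> E u v \<Longrightarrow> x \<in> \<V> \<Longrightarrow> y \<in> \<V> \<Longrightarrow> E x y \<Longrightarrow>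
       {u, v} \<noteq> {x, y} \<Longrightarrow> Ar u v \<inter> Ar x y \<subseteq> pt ` \<V>"
begin

definition skeleton :: "'a set \<Rightarrow> complex set" where
  "skeleton C = pt ` C \<union> \<Union>{Ar u v |u v. u \<in> C \<and> v \<in> C \<and> E u v}"

lemma skeleton_mono: "C \<subseteq> D \<Longrightarrow> skeleton C \<subseteq> skeleton D"
  unfolding skeleton_def by blast

lemma Ar_Int_Ar:
  assumes "u \<in> \<V>" "v \<in> \<V>" "E u v" "x \<in> \<V>" "y \<in> \<V>" "E x y" "{u, v} \<noteq> {x, y}"
  shows "Ar u v \<inter> Ar x y \<subseteq> pt ` ({u, v} \<inter> {x, y})"
proof
  fix z assume z: "z \<in> Ar u v \<inter> Ar x y"
  then obtain w where w: "w \<in> \<V>" "z = pt w" using Ar_cross[OF assms] by blast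
  then have "pt w \<in> {pt u, pt v}" "pt w \<in> {pt x, pt y}"
    using z Ar_pt[OF assms(1-3)] Ar_pt[OF assms(4-6)] by blast+
  then have "w \<in> {u, v}" "w \<in> {x, y}"
    using assms(1,2,4,5) w(1) inj_onD[OF inj_pt] by blast+
  then show "z \<in> pt ` ({u, v} \<inter> {x, y})" using w by blast
qed

lemma Ar_Int_skeleton:
  assumes "u \<in> \<V>" "v \<in> \<V>" "E u v" "C \<subseteq> \<V>" "\<not> {u, v} \<subseteq> C"
  shows "Ar u v \<inter> skeleton C \<subseteq> pt ` ({u, v} \<inter> C)"
proof
  fix z assume z: "z \<in> Ar u v \<inter> skeleton C"
  consider w where "w \<in> C" "z = pt w" | x y where "x \<in> C" "y \<in> C" "E x y" "z \<in> Ar x y"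
    using z unfolding skeleton_def by blast
  then show "z \<in> pt ` ({u, v} \<inter> C)"
  proof cases
    case 1
    then have "pt w \<in> {pt u, pt v}" using z Ar_pt[OF assms(1-3)] assms(4) by blast
    then have "w \<in> {u, v}" using 1 assms(1,2,4) inj_onD[OF inj_pt] by blast
    then show ?thesis using 1 by blast
  next
    case 2
    then have "x \<in> \<V>" "y \<in> \<V>" "{u, v} \<noteq> {x, y}" using assms(4,5) by auto
    then have "z \<in> pt ` ({u, v} \<inter> {x, y})"
      using z 2 Ar_Int_Ar[OF assms(1-3), of x y] by auto
    then show ?thesis using 2 by auto
  qed
qed

lemma skeleton_disjoint:
  assumes "C \<subseteq> \<V>" "D \<subseteq> \<V>" "C \<inter> D = {}"
  shows "skeleton C \<inter> skeleton D = {}"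
proof -
  have A: "Ar x y \<inter> skeleton P = {}"
    if "x \<in> Q" "y \<in> Q" "E x y" "P \<inter> Q = {}" "P \<subseteq> \<V>" "Q \<subseteq> \<V>" for x y P Q
    using Ar_Int_skeleton[of x y P] that by blast
  have "pt ` C \<inter> pt ` D = {}" using assms inj_pt by (simp add: inj_on_image_Int[symmetric])
  then have pts: "z \<notin> pt ` D" if "z \<in> pt ` C" for z using that by blast
  have D: "Ar x y \<inter> skeleton C = {}" if "x \<in> D" "y \<in> D" "E x y" for x y
    by (rule A[OF that assms(3,1,2)])
  have C: "Ar x y \<inter> skeleton D = {}" if "x \<in> C" "y \<in> C" "E x y" for x y
    by (rule A[OF that _ assms(2,1)]) (use assms(3) in auto)
  have "z \<notin> skeleton D" if z: "z \<in> skeleton C" for z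
  proof
    assume z': "z \<in> skeleton D"
    have "z \<in> pt ` C" using z z' C unfolding skeleton_def[of C] by auto
    moreover have "z \<in> pt ` D" using z z' D unfolding skeleton_def[of D] by auto
    ultimately show False using pts by blast
  qed
  then show ?thesis by blast
qed

text \<open>The whole skeleton of \<open>W\<close> may contain cycles and separate the plane, so a
  spanning tree is drawn instead. If a maximal \<open>U\<close> carrying such a tree were not
  \<open>W\<close>, some edge would leave it; this edge meets the tree in a single point and extends
  it.\<close>

lemma spanning_continuum:
  assumes "finite W" "W \<subseteq> \<V>" "conn E W" "W \<noteq> {}"
  shows "\<exists>K. compact K \<and> connected K \<and> connected (- K) \<and> pt ` W \<subseteq> K \<and> K \<subseteq> skeleton W"
proof -
  let ?P = "\<lambda>U K. compact K \<and> connected K \<and> connected (- K) \<and> pt ` U \<subseteq> K \<and> K \<subseteq> skeleton U"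
  let ?F = "{U. U \<subseteq> W \<and> U \<noteq> {} \<and> (\<exists>K. ?P U K)}"
  obtain w where w: "w \<in> W" using assms by blast
  have "finite ?F" by (rule finite_subset[of _ "Pow W"]) (use assms in auto)
  moreover have "{w} \<in> ?F"
  proof -
    have "connected (- {pt w})" by (rule connected_punctured_universe) simp
    then have "?P {w} {pt w}" by (auto simp: skeleton_def)
    then show ?thesis using w by blast
  qed
  ultimately have "\<exists>U\<in>?F. {w} \<subseteq> U \<and> (\<forall>D\<in>?F. U \<subseteq> D \<longrightarrow> U = D)"
    by (rule finite_has_maximal2)
  then obtain U where U: "U \<in> ?F" and mx: "\<forall>D\<in>?F. U \<subseteq> D \<longrightarrow> U = D" by (elim bexE conjE)
  from U obtain K where K: "?P U K" and UW: "U \<subseteq> W" "U \<noteq> {}" by blast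
  have "U = W"
  proof (rule ccontr)
    assume "U \<noteq> W"
    then obtain x y where xy: "x \<in> U" "y \<in> W" "y \<notin> U" "E x y"
      using conn_crossing[OF assms(3), of U] UW by blast
    then have \<V>: "x \<in> \<V>" "y \<in> \<V>" "U \<subseteq> \<V>" using UW assms(2) by auto
    have "Ar x y \<inter> skeleton U \<subseteq> {pt x}" using Ar_Int_skeleton[OF \<V>(1,2) xy(4) \<V>(3)] xy by auto
    then have KA: "K \<inter> Ar x y = {pt x}" using K xy Ar_ends[OF \<V>(1,2) xy(4)] by blast
    have "connected (K \<union> Ar x y)"
      using K KA Ar_connected[OF \<V>(1,2) xy(4)] by (intro connected_Un) auto
    moreover have "connected (- (K \<union> Ar x y))"
      using K KA Ar_compact[OF \<V>(1,2) xy(4)] Ar_Compl[OF \<V>(1,2) xy(4)]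
      by (intro connected_Compl_Un_point) auto
    moreover have "compact (K \<union> Ar x y)" using K Ar_compact[OF \<V>(1,2) xy(4)] by auto
    moreover have "pt ` insert y U \<subseteq> K \<union> Ar x y" using K Ar_ends[OF \<V>(1,2) xy(4)] by auto
    moreover have "K \<union> Ar x y \<subseteq> skeleton (insert y U)"
    proof -
      have "K \<subseteq> skeleton (insert y U)" using K skeleton_mono[of U "insert y U"] by blast
      moreover have "Ar x y \<subseteq> skeleton (insert y U)" unfolding skeleton_def using xy by blast
      ultimately show ?thesis by blast
    qed
    ultimately have "?P (insert y U) (K \<union> Ar x y)" by blast
    then have "insert y U \<in> ?F" using UW xy by blast
    from bspec[OF mx this] xy(3) show False by auto
  qed
  with K show ?thesis by blast
qed

text \<open>The branch sets are split into \<open>h 0\<close>, \<open>h 1\<close>,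
  \<open>h 2\<close> and \<open>h 3\<close>, \<open>h 4\<close>, \<open>h 5\<close>. Each is drawn
  as a nonseparating continuum, and nine edges between the two sides yield the configuration
  excluded by \<open>continua_K33\<close>.\<close>

theorem no_clique_minor_6:
  assumes finV: "finite \<V>"
  shows "no_clique_minor E 6 \<V>"
  unfolding no_clique_minor_def
proof (intro allI impI notI)
  fix \<C> assume model: "clique_model E \<V> \<C>" and card: "card \<C> = 6"
  have "finite \<C>" using model by (simp add: clique_model_def)
  then obtain h where h: "bij_betw h {0..<6::nat} \<C>" using ex_bij_betw_nat_finite card by metis
  have hC: "h m \<in> \<C>" if "m < 6" for m using h that by (auto simp: bij_betw_def)
  have hne: "h m \<noteq> h l" if "m < 6" "l < 6" "m \<noteq> l" for m l
    using h that by (auto simp: bij_betw_def inj_on_def)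
  have hp: "h m \<noteq> {}" "h m \<subseteq> \<V>" "conn E (h m)" if "m < 6" for m
    using clique_model_part[OF model hC[OF that]] by auto
  have hd: "h m \<inter> h l = {}" if "m < 6" "l < 6" "m \<noteq> l" for m l
    using clique_model_disjoint[OF model hC hC hne] that by blast
  have "\<exists>K. compact K \<and> connected K \<and> connected (- K) \<and> pt ` h m \<subseteq> K \<and> K \<subseteq> skeleton (h m)"
    if "m < 6" for m
    using spanning_continuum[OF finite_subset[OF _ finV]] hp[OF that] by blast
  then obtain K where K: "\<And>m. m < 6 \<Longrightarrow> compact (K m)" "\<And>m. m < 6 \<Longrightarrow> connected (K m)"
      "\<And>m. m < 6 \<Longrightarrow> connected (- K m)" "\<And>m. m < 6 \<Longrightarrow> pt ` h m \<subseteq> K m"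
      "\<And>m. m < 6 \<Longrightarrow> K m \<subseteq> skeleton (h m)" by metis
  have "\<exists>x y. x \<in> h i \<and> y \<in> h (3 + j) \<and> E x y" if ij: "i < 3" "j < 3" for i j
  proof -
    have "i < 6" "3 + j < 6" "i \<noteq> 3 + j" using ij by auto
    then show ?thesis using clique_model_adjacent[OF model hC hC hne] by blast
  qed
  then obtain x y where xy: "\<And>i j. i < 3 \<Longrightarrow> j < 3 \<Longrightarrow> x i j \<in> h i"
      "\<And>i j. i < 3 \<Longrightarrow> j < 3 \<Longrightarrow> y i j \<in> h (3 + j)"
      "\<And>i j. i < 3 \<Longrightarrow> j < 3 \<Longrightarrow> E (x i j) (y i j)" by metis
  define e where "e i j = Ar (x i j) (y i j)" for i j
  have xV: "x i j \<in> \<V>" "y i j \<in> \<V>" if "i < 3" "j < 3" for i j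
    using xy(1,2)[OF that] hp(2)[of i] hp(2)[of "3 + j"] that by auto
  have mem: "x i j \<in> h m \<longleftrightarrow> m = i" "y i j \<in> h m \<longleftrightarrow> m = 3 + j"
    if "i < 3" "j < 3" "m < 6" for i j m
    using xy(1,2)[OF that(1,2)] hd[of m i] hd[of m "3 + j"] that by auto
  have e: "compact (e i j)" "connected (e i j)" "connected (- e i j)" "pt (x i j) \<in> e i j" "pt (y i j) \<in> e i j"
    "connected (e i j - {pt (x i j)})" if "i < 3" "j < 3" for i j
    unfolding e_def
    using Ar_compact Ar_connected Ar_Compl Ar_ends Ar_half xV[OF that] xy(3)[OF that] by blast+
  have Kx: "pt (x i j) \<in> K i" and Ky: "pt (y i j) \<in> K (3 + j)" if "i < 3" "j < 3" for i j
    using K(4)[of i] K(4)[of "3 + j"] xy that by auto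
  have KK: "K m \<inter> K l = {}" if "m < 6" "l < 6" "m \<noteq> l" for m l
    using K(5)[of m] K(5)[of l] skeleton_disjoint[OF hp(2) hp(2) hd] that by blast
  have eK: "e i j \<inter> K m \<subseteq> pt ` ({x i j, y i j} \<inter> h m)" if "i < 3" "j < 3" "m < 6" for i j m
  proof -
    have "\<not> {x i j, y i j} \<subseteq> h m" using mem that by auto
    then have "e i j \<inter> skeleton (h m) \<subseteq> pt ` ({x i j, y i j} \<inter> h m)"
      unfolding e_def using xV xy(3) hp(2) that by (intro Ar_Int_skeleton) auto
    then show ?thesis using K(5)[OF that(3)] by blast
  qed
  have eKx: "e i j \<inter> K i = {pt (x i j)}" if "i < 3" "j < 3" for i j
    using eK[of i j i] mem[of i j i] e(4) Kx that by auto
  have eKy: "e i j \<inter> K (3 + j) = {pt (y i j)}" if "i < 3" "j < 3" for i j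
    using eK[of i j "3 + j"] mem[of i j "3 + j"] e(5) Ky that by auto
  have eK0: "e i j \<inter> K m = {}" if "i < 3" "j < 3" "m < 6" "m \<noteq> i" "m \<noteq> 3 + j" for i j m
    using eK[of i j m] mem[of i j m] that by auto
  have xyne: "x i j \<noteq> y i' j'" if "i < 3" "j < 3" "i' < 3" "j' < 3" for i j i' j'
    using mem(1)[of i j i] mem(2)[of i' j' i] that by auto
  have ee: "e i j \<inter> e i' j' \<subseteq> pt ` ({x i j, y i j} \<inter> {x i' j', y i' j'})"
    if "i < 3" "j < 3" "i' < 3" "j' < 3" "(i, j) \<noteq> (i', j')" for i j i' j'
  proof -
    have "{x i j, y i j} \<noteq> {x i' j', y i' j'}"
    proof
      assume "{x i j, y i j} = {x i' j', y i' j'}"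
      then have "x i j = x i' j'" "y i j = y i' j'"
        using xyne[of i j i' j'] xyne[of i' j' i j] that by (auto simp: doubleton_eq_iff)
      then show False
        using mem(1)[of i j i] mem(1)[of i' j' i] mem(2)[of i j "3 + j"] mem(2)[of i' j' "3 + j"] that by auto
    qed
    then show ?thesis unfolding e_def using xV xy(3) that by (intro Ar_Int_Ar) auto
  qed
  have xne: "x i j \<noteq> x i' j'" if "i < 3" "j < 3" "i' < 3" "j' < 3" "i \<noteq> i'" for i j i' j'
    using mem(1)[of i j i] mem(1)[of i' j' i] that by auto
  have yne: "y i j \<noteq> y i' j'" if "i < 3" "j < 3" "i' < 3" "j' < 3" "j \<noteq> j'" for i j i' j'
    using mem(2)[of i j "3 + j"] mem(2)[of i' j' "3 + j"] that by auto
  have ee_row: "e i j \<inter> e i j' \<subseteq> {pt (x i j)}" if "i < 3" "j < 3" "j' < 3" "j \<noteq> j'" for i j j'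
    using ee[of i j i j'] xyne[of i j i j'] xyne[of i j' i j] yne[of i j i j'] that by auto
  have ee_col: "e i j \<inter> e i' j \<subseteq> {pt (y i j)}" if "i < 3" "j < 3" "i' < 3" "i \<noteq> i'" for i j i'
    using ee[of i j i' j] xyne[of i j i' j] xyne[of i' j i j] xne[of i j i' j] that by auto
  have ee_none: "e i j \<inter> e i' j' = {}"
    if "i < 3" "j < 3" "i' < 3" "j' < 3" "i \<noteq> i'" "j \<noteq> j'" for i j i' j'
    using ee[of i j i' j'] xyne[of i j i' j'] xyne[of i' j' i j] xne[of i j i' j'] yne[of i j i' j'] that
    by auto
  \<comment> \<open>\<open>B j\<close> links the hubs \<open>K 0\<close> and \<open>K 1\<close>
    through \<open>K (3 + j)\<close>. \<open>M j\<close> is what the third hub \<open>K 2\<close>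
    reaches through \<open>K (3 + j)\<close> without touching the other two; \<open>Ar_half\<close>
    keeps it connected when the ends of the edges are removed.\<close>
  define B where "B j = K (3 + j) \<union> e 0 j \<union> e 1 j" for j
  define M where "M j = K 2 \<union> e 2 j \<union> K (3 + j) \<union> (e 0 j - {pt (x 0 j)}) \<union> (e 1 j - {pt (x 1 j)})" for j
  have ptne: "pt (x i j) \<noteq> pt (y i j)" if "i < 3" "j < 3" for i j
    using inj_onD[OF inj_pt, of "x i j" "y i j"] xV[OF that] xyne[of i j i j] that by auto
  obtain c where c: "c \<in> h 2" using hp(1)[of 2] by auto
  have K0B: "K 0 \<inter> B j = {pt (x 0 j)}" and K1B: "K 1 \<inter> B j = {pt (x 1 j)}" if "j < 3" for j
    unfolding B_def using that KK[of 0 "3 + j"] KK[of 1 "3 + j"] eKx[of 0 j] eKx[of 1 j]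
      eK0[of 1 j 0] eK0[of 0 j 1] by auto
  have e01: "(K (3 + j) \<union> e 0 j) \<inter> e 1 j = {pt (y 1 j)}" if "j < 3" for j
    using eKy[of 1 j] ee_col[of 1 j 0] that by auto
  have compB: "compact (B j)" if "j < 3" for j
    unfolding B_def using K(1)[of "3 + j"] e(1)[of 0 j] e(1)[of 1 j] that by auto
  have connB: "connected (B j)" if "j < 3" for j
    unfolding B_def using K(2)[of "3 + j"] e(2)[of 0 j] e(2)[of 1 j] e01[OF that] eKy[of 0 j] that
    by (intro connected_Un) auto
  have ComplB: "connected (- B j)" if "j < 3" for j
    unfolding B_def using K(1,3)[of "3 + j"] e(1,3)[of 0 j] e(1,3)[of 1 j] e01[OF that] eKy[of 0 j] that
    by (intro connected_Compl_Un_point[where p = "pt (y 1 j)"] connected_Compl_Un_point[where p = "pt (y 0 j)"]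
        compact_Un) auto
  \<comment> \<open>A chain of three continua, glued at the points \<open>pt (x 0 j)\<close> and
    \<open>pt (x 1 j)\<close>.\<close>
  have "connected (- ((B j \<union> K 0) \<union> K 1))" if "j < 3" for j
    using ComplB[OF that] compB[OF that] K(1,3)[of 0] K(1,3)[of 1] K0B[OF that] K1B[OF that] KK[of 0 1]
    by (intro connected_Compl_Un_point[where p = "pt (x 1 j)"] connected_Compl_Un_point[where p = "pt (x 0 j)"]
        compact_Un) auto
  then have Y: "connected (- (K 0 \<union> K 1 \<union> B j))" if "j < 3" for j
    using that by (simp add: Un_ac)
  have connM: "connected (M j)" if "j < 3" for j
    unfolding M_def
    using K(2)[of 2] K(2)[of "3 + j"] e(2)[of 2 j] e(6)[of 0 j] e(6)[of 1 j] eKx[of 2 j] eKy[of 2 j]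
      eKy[of 0 j] eKy[of 1 j] ptne[of 0 j] ptne[of 1 j] that
    by (intro connected_Un) auto
  have MA: "M j \<inter> (K 0 \<union> K 1) = {}" if "j < 3" for j
    unfolding M_def
    using KK[of 2 0] KK[of 2 1] KK[of "3 + j" 0] KK[of "3 + j" 1] eK0[of 2 j 0] eK0[of 2 j 1]
      eKx[of 0 j] eKx[of 1 j] eK0[of 1 j 0] eK0[of 0 j 1] that by auto
  have BM: "B j - (K 0 \<union> K 1) \<subseteq> M j" if "j < 3" for j
    unfolding B_def M_def using Kx[of 0 j] Kx[of 1 j] that by auto
  have MB: "M i \<inter> B j = {}" if "i < 3" "j < 3" "i \<noteq> j" for i j
    unfolding M_def B_def
    using KK[of 2 "3 + j"] KK[of "3 + i" "3 + j"] eK0[of 0 j 2] eK0[of 1 j 2] eK0[of 2 i "3 + j"]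
      eK0[of 0 i "3 + j"] eK0[of 1 i "3 + j"] eK0[of 0 j "3 + i"] eK0[of 1 j "3 + i"]
      ee_none[of 2 i 0 j] ee_none[of 2 i 1 j] ee_none[of 0 i 1 j] ee_none[of 1 i 0 j]
      ee_row[of 0 i j] ee_row[of 1 i j] that
    by auto
  have BB: "B i \<inter> B j \<subseteq> K 0 \<union> K 1" if "i < 3" "j < 3" "i \<noteq> j" for i j
    using MB[OF that] BM[OF that(1)] by blast
  have KA: "K 0 \<inter> K 1 = {}" using KK[of 0 1] by simp
  have cM: "pt c \<in> M j" if "j < 3" for j using K(4)[of 2] c by (auto simp: M_def)
  have sing: "\<exists>p. K 0 \<inter> B j = {p}" "\<exists>p. K 1 \<inter> B j = {p}" if "j < 3" for j
    using K0B[OF that] K1B[OF that] by blast+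
  have K01: "compact (K 0)" "connected (K 0)" "compact (K 1)" "connected (K 1)" using K(1,2) by auto
  show False
    by (rule continua_K33[OF K01 KA compB connB sing BB Y connM cM BM MA MB])
qed

end

section \<open>From two curves to a drawing of the pattern graph\<close>

definition pattern_adj :: "(nat \<Rightarrow> nat) \<Rightarrow> nat \<Rightarrow> nat \<Rightarrow> bool" where
  "pattern_adj \<pi> j l \<longleftrightarrow> l = Suc j \<or> j = Suc l \<or> \<pi> l = Suc (\<pi> j) \<or> \<pi> j = Suc (\<pi> l)"

text \<open>Instantiated with both curves, so that the arcs between consecutive marks are studied
  once.\<close>

locale marked_path =
  fixes f :: "real \<Rightarrow> complex" and a :: "nat \<Rightarrow> real" and k :: nat
  assumes f: "simple_path f"
    and a_mono: "strict_mono_on {1..k} a"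
    and a_range: "a ` {1..k} \<subseteq> {0..1}"
    and inj_fa: "inj_on (\<lambda>m. f (a m)) {1..k}"
begin

lemma a_less: "l \<in> {1..k} \<Longrightarrow> m \<in> {1..k} \<Longrightarrow> l < m \<Longrightarrow> a l < a m"
  using a_mono by (auto simp: strict_mono_on_def)

lemma a_le: "l \<in> {1..k} \<Longrightarrow> m \<in> {1..k} \<Longrightarrow> l \<le> m \<Longrightarrow> a l \<le> a m"
  using a_less[of l m] by (cases "l = m") auto

lemma a_unit: "m \<in> {1..k} \<Longrightarrow> 0 \<le> a m \<and> a m \<le> 1"
  using a_range by (meson atLeastAtMost_iff image_subset_iff)

text \<open>A closed curve identifies the parameters 0 and 1. Both lie between the first and the
  last mark only if they are these marks, and then one point would be marked twice.\<close>

lemma inj_between: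
  assumes "0 < k"
  shows "inj_on f {a 1..a k}"
proof (rule inj_onI, rule ccontr)
  fix x y assume xy: "x \<in> {a 1..a k}" "y \<in> {a 1..a k}" "f x = f y" "x \<noteq> y"
  have k: "1 \<in> {1..k}" "k \<in> {1..k}" using assms by auto
  have u: "0 \<le> a 1" "a k \<le> 1" using a_unit k by auto
  have "x \<in> {0..1}" "y \<in> {0..1}" using xy(1,2) u by auto
  then have "x = 0 \<and> y = 1 \<or> x = 1 \<and> y = 0"
    using f xy(3,4) unfolding simple_path_def loop_free_def by blast
  then have "a 1 = 0" "a k = 1" "f 0 = f 1" using xy u by auto
  then have "1 = k" using inj_onD[OF inj_fa, of 1 k] k by auto
  then show False using \<open>a 1 = 0\<close> \<open>a k = 1\<close> by simp
qed

definition piece :: "nat \<Rightarrow> complex set" where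
  "piece m = f ` {a m..a (Suc m)}"

context
  fixes m assumes m: "m \<in> {1..k}" "Suc m \<in> {1..k}"
begin

lemma inj_between': "inj_on f {a 1..a k}"
  by (rule inj_between) (use m in auto)

lemma piece_sub: "{a m..a (Suc m)} \<subseteq> {a 1..a k}"
  using a_le[of 1 m] a_le[of "Suc m" k] m by auto

lemma piece_arc: "arc (subpath (a m) (a (Suc m)) f)" "piece m = path_image (subpath (a m) (a (Suc m)) f)"
proof -
  have "f (a m) \<noteq> f (a (Suc m))" using inj_onD[OF inj_fa, of m "Suc m"] m by auto
  then show "arc (subpath (a m) (a (Suc m)) f)"
    using a_unit[OF m(1)] a_unit[OF m(2)] by (intro arc_simple_path_subpath f) auto
  show "piece m = path_image (subpath (a m) (a (Suc m)) f)"
    using a_less[OF m] by (simp add: path_image_subpath piece_def)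
qed

lemma compact_piece: "compact (piece m)"
  and connected_piece: "connected (piece m)"
  and connected_Compl_piece: "connected (- piece m)"
  using piece_arc by (auto intro: compact_arc_image connected_arc_image connected_arc_complement)

lemma piece_subset: "piece m \<subseteq> path_image f"
  using a_unit[OF m(1)] a_unit[OF m(2)] by (auto simp: piece_def path_image_def)

lemma ends_in_piece: "f (a m) \<in> piece m" "f (a (Suc m)) \<in> piece m"
  using a_less[OF m] by (auto simp: piece_def)

lemma connected_piece_half: "x \<in> {m, Suc m} \<Longrightarrow> connected (piece m - {f (a x)})"
proof -
  assume x: "x \<in> {m, Suc m}"
  then have ax: "a x \<in> {a m..a (Suc m)}" using a_less[OF m] by auto
  have "piece m - {f (a x)} = f ` ({a m..a (Suc m)} - {a x})"
    using inj_on_image_set_diff[OF inj_on_subset[OF inj_between' piece_sub], of "{a m..a (Suc m)}" "{a x}"] ax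
    by (simp add: piece_def)
  moreover have "{a m..a (Suc m)} - {a x} = (if x = m then {a m<..a (Suc m)} else {a m..<a (Suc m)})"
    using x a_less[OF m] by auto
  moreover have "continuous_on {a m..a (Suc m)} f"
    using f a_unit[OF m(1)] a_unit[OF m(2)] unfolding simple_path_def path_def
    by (auto intro: continuous_on_subset)
  then have "continuous_on ({a m..a (Suc m)} - {a x}) f" by (rule continuous_on_subset) auto
  ultimately show ?thesis by (auto intro!: connected_continuous_image split: if_splits)
qed

lemma marks_in_piece:
  assumes "l \<in> {1..k}" "f (a l) \<in> piece m"
  shows "l = m \<or> l = Suc m"
proof -
  obtain s where s: "s \<in> {a m..a (Suc m)}" "f (a l) = f s" using assms(2) by (auto simp: piece_def)
  have "a l \<in> {a 1..a k}" using a_le[of 1 l] a_le[of l k] assms(1) by auto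
  then have "a l = s" using inj_onD[OF inj_between' s(2)] s(1) piece_sub by auto
  then show ?thesis using s(1) a_less[of l m] a_less[of "Suc m" l] m assms(1) by fastforce
qed

end

lemma pieces_meet:
  assumes "m \<in> {1..k}" "Suc m \<in> {1..k}" "l \<in> {1..k}" "Suc l \<in> {1..k}" "m \<noteq> l"
  shows "piece m \<inter> piece l \<subseteq> (\<lambda>m. f (a m)) ` {1..k}"
proof
  fix z assume "z \<in> piece m \<inter> piece l"
  then obtain s t where s: "s \<in> {a m..a (Suc m)}" "t \<in> {a l..a (Suc l)}" "z = f s" "z = f t"
    by (auto simp: piece_def)
  then have "s = t"
    using inj_onD[OF inj_between'[OF assms(1,2)], of s t] piece_sub[OF assms(1,2)] piece_sub[OF assms(3,4)] by auto
  have "s = a m \<or> s = a (Suc m)"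
  proof (cases "m < l")
    case True
    then show ?thesis using s \<open>s = t\<close> a_le[of "Suc m" l] assms by auto
  next
    case False
    then show ?thesis using s \<open>s = t\<close> a_le[of "Suc l" m] assms by auto
  qed
  then show "z \<in> (\<lambda>m. f (a m)) ` {1..k}" using s(3) assms by auto
qed

end

lemma symmetric_pattern_adj: "symmetric_graph (pattern_adj \<pi>)"
  by standard (auto simp: pattern_adj_def)

text \<open>Position \<open>j\<close> is drawn at its intersection point. Neighbouring positions are
  joined along \<open>g\<close>, neighbouring values along \<open>f\<close>. Arcs of different
  curves meet only in common points of the two curves, and all of these are vertices.\<close>

theorem jordan_no_clique_minor:
  assumes "jordan_permutation k \<pi>"
  shows "no_clique_minor (pattern_adj \<pi>) 6 {1..k}"
proof -
  let ?V = "{1..k}"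
  from assms[unfolded jordan_permutation_def] obtain f g :: "real \<Rightarrow> complex" and a b :: "nat \<Rightarrow> real"
    where \<pi>: "\<pi> permutes ?V"
    and f: "simple_path f" "strict_mono_on ?V a" "a ` ?V \<subseteq> {0..1}"
    and g: "simple_path g" "strict_mono_on ?V b" "b ` ?V \<subseteq> {0..1}"
    and bij: "bij_betw (\<lambda>m. f (a m)) ?V (path_image f \<inter> path_image g)"
    and gf_all: "\<forall>j\<in>?V. g (b j) = f (a (\<pi> j))"
    by (elim conjE exE) (rule that; assumption)
  have gf: "g (b j) = f (a (\<pi> j))" if "j \<in> ?V" for j using gf_all that by blast
  define pt where "pt j = f (a (\<pi> j))" for j
  have \<pi>V: "\<pi> j \<in> ?V \<longleftrightarrow> j \<in> ?V" for j using permutes_in_image[OF \<pi>] .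
  have \<pi>inj: "inj_on \<pi> ?V" using permutes_inj_on[OF \<pi>] .
  have inj: "inj_on (\<lambda>m. f (a m)) ?V" using bij by (simp add: bij_betw_def)
  have inj_pt: "inj_on pt ?V"
    using comp_inj_on[OF \<pi>inj, of "\<lambda>m. f (a m)"] inj permutes_image[OF \<pi>]
    by (simp only: comp_def pt_def[abs_def])
  have "inj_on (\<lambda>m. g (b m)) ?V"
    using inj_pt gf inj_on_cong[of ?V "\<lambda>m. g (b m)" pt] by (simp only: pt_def)
  then interpret F: marked_path f a k + G: marked_path g b k
    using f g inj by unfold_locales
  have ptV: "pt ` ?V = path_image f \<inter> path_image g"
  proof -
    have "pt ` ?V = (\<lambda>m. f (a m)) ` \<pi> ` ?V" by (simp add: pt_def image_image)
    then show ?thesis using bij permutes_image[OF \<pi>] by (simp add: bij_betw_def)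
  qed
  have ptF: "(\<lambda>m. f (a m)) ` ?V = pt ` ?V" using ptV bij by (simp add: bij_betw_def)
  have ptG: "(\<lambda>m. g (b m)) ` ?V = pt ` ?V" using gf by (auto simp: pt_def)
  have ptg: "pt j = g (b j)" if "j \<in> ?V" for j using gf[OF that] by (simp add: pt_def)
  \<comment> \<open>Positions that are neighbours in both senses get the arc of \<open>g\<close>, so
    each edge is drawn once.\<close>
  define Ar where "Ar j l = (if l = Suc j then G.piece j else if j = Suc l then G.piece l
      else if \<pi> l = Suc (\<pi> j) then F.piece (\<pi> j) else F.piece (\<pi> l))" for j l
  have cases: "(\<exists>m. m \<in> ?V \<and> Suc m \<in> ?V \<and> {j, l} = {m, Suc m} \<and> Ar j l = G.piece m) \<or>
      (\<exists>m. m \<in> ?V \<and> Suc m \<in> ?V \<and> {\<pi> j, \<pi> l} = {m, Suc m} \<and> Ar j l = F.piece m)"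
    if "j \<in> ?V" "l \<in> ?V" "pattern_adj \<pi> j l" for j l
    using that \<pi>V[of j] \<pi>V[of l] unfolding Ar_def pattern_adj_def
    by (smt (verit) insert_commute)
  interpret symmetric_graph "pattern_adj \<pi>" by (rule symmetric_pattern_adj)
  interpret arc_embedding "pattern_adj \<pi>" ?V pt Ar
  proof
    show "inj_on pt ?V" by fact
  next
    fix u v assume uv: "u \<in> ?V" "v \<in> ?V" "pattern_adj \<pi> u v"
    note c = cases[OF uv]
    show "compact (Ar u v)" using c F.compact_piece G.compact_piece by auto
    show "connected (Ar u v)" using c F.connected_piece G.connected_piece by auto
    show "connected (- Ar u v)" using c F.connected_Compl_piece G.connected_Compl_piece by auto
    show "pt u \<in> Ar u v \<and> pt v \<in> Ar u v"
      using c
    proof (elim disjE exE conjE)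
      fix m assume m: "m \<in> ?V" "Suc m \<in> ?V" "{u, v} = {m, Suc m}" "Ar u v = G.piece m"
      from m(3) have "u = m \<and> v = Suc m \<or> u = Suc m \<and> v = m" by (simp add: doubleton_eq_iff)
      then show ?thesis using G.ends_in_piece[OF m(1,2)] ptg[OF uv(1)] ptg[OF uv(2)] m(4)
        by (elim disjE conjE) simp_all
    next
      fix m assume m: "m \<in> ?V" "Suc m \<in> ?V" "{\<pi> u, \<pi> v} = {m, Suc m}" "Ar u v = F.piece m"
      from m(3) have "\<pi> u = m \<and> \<pi> v = Suc m \<or> \<pi> u = Suc m \<and> \<pi> v = m"
        by (simp add: doubleton_eq_iff)
      then show ?thesis using F.ends_in_piece[OF m(1,2)] m(4)
        by (elim disjE conjE) (simp_all add: pt_def)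
    qed
    show "connected (Ar u v - {pt u})"
      using c
    proof (elim disjE exE conjE)
      fix m assume m: "m \<in> ?V" "Suc m \<in> ?V" "{u, v} = {m, Suc m}" "Ar u v = G.piece m"
      then have "u \<in> {m, Suc m}" by auto
      from G.connected_piece_half[OF m(1,2) this] show ?thesis using m(4) ptg[OF uv(1)] by simp
    next
      fix m assume m: "m \<in> ?V" "Suc m \<in> ?V" "{\<pi> u, \<pi> v} = {m, Suc m}" "Ar u v = F.piece m"
      then have "\<pi> u \<in> {m, Suc m}" by auto
      from F.connected_piece_half[OF m(1,2) this] show ?thesis using m(4) by (simp add: pt_def)
    qed
    show "Ar u v \<inter> pt ` ?V \<subseteq> {pt u, pt v}"
    proof
      fix z assume "z \<in> Ar u v \<inter> pt ` ?V"
      then obtain w where w: "w \<in> ?V" "z = pt w" "pt w \<in> Ar u v" by auto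
      have "w \<in> {u, v} \<or> \<pi> w \<in> {\<pi> u, \<pi> v}"
        using c
      proof (elim disjE exE conjE)
        fix m assume m: "m \<in> ?V" "Suc m \<in> ?V" "{u, v} = {m, Suc m}" "Ar u v = G.piece m"
        then show ?thesis using G.marks_in_piece[OF m(1,2) w(1)] m(3,4) w(3) ptg[OF w(1)] by auto
      next
        fix m assume m: "m \<in> ?V" "Suc m \<in> ?V" "{\<pi> u, \<pi> v} = {m, Suc m}" "Ar u v = F.piece m"
        then show ?thesis using F.marks_in_piece[OF m(1,2), of "\<pi> w"] m(3,4) w \<pi>V[of w]
          by (auto simp: pt_def)
      qed
      then show "z \<in> {pt u, pt v}" using w(2) by (auto simp: pt_def)
    qed
    fix x y assume xy: "x \<in> ?V" "y \<in> ?V" "pattern_adj \<pi> x y" and ne: "{u, v} \<noteq> {x, y}"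
    note c' = cases[OF xy]
    have FG: "F.piece m \<inter> G.piece l \<subseteq> pt ` ?V"
      if "m \<in> ?V" "Suc m \<in> ?V" "l \<in> ?V" "Suc l \<in> ?V" for m l
      unfolding ptV using F.piece_subset[OF that(1,2)] G.piece_subset[OF that(3,4)] by blast
    \<comment> \<open>Arcs of \<open>f\<close> are indexed by values, so distinct edges must also
      differ in the values of their ends.\<close>
    have ne': "{\<pi> u, \<pi> v} \<noteq> {\<pi> x, \<pi> y}"
      using ne uv xy inj_onD[OF \<pi>inj] by (auto simp: doubleton_eq_iff)
    from c show "Ar u v \<inter> Ar x y \<subseteq> pt ` ?V"
    proof (elim disjE exE conjE)
      fix m assume m: "m \<in> ?V" "Suc m \<in> ?V" "{u, v} = {m, Suc m}" "Ar u v = G.piece m"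
      from c' show ?thesis
      proof (elim disjE exE conjE)
        fix l assume l: "l \<in> ?V" "Suc l \<in> ?V" "{x, y} = {l, Suc l}" "Ar x y = G.piece l"
        have "m \<noteq> l" using ne m(3) l(3) by auto
        then show ?thesis using G.pieces_meet[OF m(1,2) l(1,2)] m(4) l(4) ptG by simp
      next
        fix l assume l: "l \<in> ?V" "Suc l \<in> ?V" "{\<pi> x, \<pi> y} = {l, Suc l}" "Ar x y = F.piece l"
        show ?thesis using FG[OF l(1,2) m(1,2)] m(4) l(4) by (simp add: Int_commute)
      qed
    next
      fix m assume m: "m \<in> ?V" "Suc m \<in> ?V" "{\<pi> u, \<pi> v} = {m, Suc m}" "Ar u v = F.piece m"
      from c' show ?thesis
      proof (elim disjE exE conjE)
        fix l assume l: "l \<in> ?V" "Suc l \<in> ?V" "{x, y} = {l, Suc l}" "Ar x y = G.piece l"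
        show ?thesis using FG[OF m(1,2) l(1,2)] m(4) l(4) by simp
      next
        fix l assume l: "l \<in> ?V" "Suc l \<in> ?V" "{\<pi> x, \<pi> y} = {l, Suc l}" "Ar x y = F.piece l"
        have "m \<noteq> l" using ne' m(3) l(3) by auto
        then show ?thesis using F.pieces_meet[OF m(1,2) l(1,2)] m(4) l(4) ptF by simp
      qed
    qed
  qed
  show ?thesis by (rule no_clique_minor_6) simp
qed

section \<open>Searching through partial embeddings\<close>

text \<open>
  A configuration \<open>c\<close> gives for each pattern position \<open>w\<close> its image if \<open>w\<close> is active, \<open>0\<close> if \<open>w\<close>
  is not yet placed, and \<open>Suc n\<close> if \<open>w\<close> is placed, but its image has been forgotten because all
  neighbours of \<open>w\<close> in the pattern graph are placed as well. A move \<open>c(v := p)\<close> places \<open>v\<close>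
  if \<open>p \<le> n\<close> and forgets it if \<open>p = Suc n\<close>.
\<close>

locale pattern_search =
  fixes n :: nat and t :: "nat \<Rightarrow> nat" and k :: nat and \<pi> :: "nat \<Rightarrow> nat" and lim :: nat
  assumes t: "t permutes {1..n}" and \<pi>: "\<pi> permutes {1..k}"
begin

text \<open>The positions are compared in both directions, which forces distinct positions to have
  distinct images. One direction suffices for the values, since \<open>t\<close> and
  \<open>\<pi>\<close> are injective.\<close>

definition compatible :: "nat \<Rightarrow> nat \<Rightarrow> nat \<Rightarrow> nat \<Rightarrow> bool" where
  "compatible v p w q \<longleftrightarrow> (v < w \<longleftrightarrow> p < q) \<and> (w < v \<longleftrightarrow> q < p) \<and> (\<pi> v < \<pi> w \<longleftrightarrow> t p < t q)"

text \<open>The case \<open>w = v\<close> is included: it restricts placing to unplaced positions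
  and forgetting to placed ones. Placing is tested against every active position, so this test does
  not involve the graph.\<close>

definition admits :: "(nat \<Rightarrow> nat) \<Rightarrow> nat \<Rightarrow> nat \<Rightarrow> nat \<Rightarrow> bool" where
  "admits c v p w \<longleftrightarrow>
     (if p \<le> n then c w = 0 \<or> (w \<noteq> v \<and> (c w = Suc n \<or> compatible v p w (c w)))
      else (w = v \<or> pattern_adj \<pi> v w) \<longrightarrow> c w \<noteq> 0)"

definition active :: "(nat \<Rightarrow> nat) \<Rightarrow> nat set" where
  "active c = {w \<in> {1..k}. c w \<noteq> 0 \<and> c w < Suc n}"

definition legal :: "(nat \<Rightarrow> nat) \<Rightarrow> nat \<Rightarrow> nat \<Rightarrow> bool" where
  "legal c v p \<longleftrightarrow> (\<forall>w\<in>{1..k}. admits c v p w) \<and> card (active (c(v := p))) \<le> lim"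

inductive_set reachable :: "(nat \<Rightarrow> nat) set" where
  start: "(\<lambda>_. 0) \<in> reachable"
| move: "c \<in> reachable \<Longrightarrow> v \<in> {1..k} \<Longrightarrow> p \<in> {1..Suc n} \<Longrightarrow> legal c v p \<Longrightarrow> c(v := p) \<in> reachable"

definition complete :: "(nat \<Rightarrow> nat) \<Rightarrow> bool" where
  "complete c \<longleftrightarrow> (\<forall>w\<in>{1..k}. c w \<noteq> 0)"

lemma finite_active [simp]: "finite (active c)"
  by (simp add: active_def)

lemma adj_sym: "pattern_adj \<pi> u w \<Longrightarrow> pattern_adj \<pi> w u"
  by (auto simp: pattern_adj_def)

lemma adj_irrefl: "\<not> pattern_adj \<pi> u u"
  by (simp add: pattern_adj_def)

section \<open>Complete configurations and embeddings\<close>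

definition embeds :: "(nat \<Rightarrow> nat) \<Rightarrow> nat \<Rightarrow> nat \<Rightarrow> bool" where
  "embeds \<phi> u w \<longleftrightarrow> (u < w \<longleftrightarrow> \<phi> u < \<phi> w) \<and> (\<pi> u < \<pi> w \<longleftrightarrow> t (\<phi> u) < t (\<phi> w))"

text \<open>\<open>\<phi>\<close> also supplies the forgotten images. Order is claimed only along
  edges, because a new position is never compared with forgotten images.\<close>

definition sound :: "(nat \<Rightarrow> nat) \<Rightarrow> (nat \<Rightarrow> nat) \<Rightarrow> bool" where
  "sound c \<phi> \<longleftrightarrow>
     (\<forall>w\<in>{1..k}. c w \<noteq> 0 \<longrightarrow> \<phi> w \<in> {1..n} \<and> (c w < Suc n \<longrightarrow> \<phi> w = c w)) \<and>
     (\<forall>u\<in>{1..k}. \<forall>w\<in>{1..k}. c w = Suc n \<longrightarrow> pattern_adj \<pi> w u \<longrightarrow> c u \<noteq> 0) \<and>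
     (\<forall>u\<in>{1..k}. \<forall>w\<in>{1..k}. c u \<noteq> 0 \<longrightarrow> c w \<noteq> 0 \<longrightarrow> pattern_adj \<pi> u w \<longrightarrow> embeds \<phi> u w)"

definition wf_config :: "(nat \<Rightarrow> nat) \<Rightarrow> bool" where
  "wf_config c \<longleftrightarrow> (\<forall>w. c w \<le> Suc n) \<and> (\<forall>w. w \<notin> {1..k} \<longrightarrow> c w = 0) \<and> card (active c) \<le> lim \<and>
     (\<forall>u\<in>{1..k}. \<forall>w\<in>{1..k}. c w = Suc n \<longrightarrow> pattern_adj \<pi> w u \<longrightarrow> c u \<noteq> 0)"

lemma reachable_wf: "c \<in> reachable \<Longrightarrow> wf_config c"
proof (induction rule: reachable.induct)
  case start
  then show ?case by (simp add: wf_config_def active_def)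
next
  case (move c v p)
  have "(c(v := p)) u \<noteq> 0"
    if uw: "u \<in> {1..k}" "w \<in> {1..k}" "(c(v := p)) w = Suc n" "pattern_adj \<pi> w u" for u w
  proof (cases "u = v")
    case True
    then show ?thesis using move.hyps by simp
  next
    case False
    show ?thesis
    proof (cases "w = v")
      case True
      then have "p = Suc n" using uw by simp
      then have "c u \<noteq> 0" using move.hyps uw True by (auto simp: legal_def admits_def)
      then show ?thesis using False by simp
    next
      case w: False
      then show ?thesis using move.IH uw False by (auto simp: wf_config_def)
    qed
  qed
  moreover have "card (active (c(v := p))) \<le> lim" using move.hyps by (simp add: legal_def)
  ultimately show ?case using move.IH move.hyps unfolding wf_config_def by auto
qed

text \<open>When \<open>v\<close> is placed, none of its placed neighbours can have been forgotten,
  since \<open>v\<close> was unplaced until then. Their images are still known, so the test covers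
  every edge at \<open>v\<close>.\<close>

lemma reachable_sound: "c \<in> reachable \<Longrightarrow> \<exists>\<phi>. sound c \<phi>"
proof (induction rule: reachable.induct)
  case start
  then show ?case by (auto simp: sound_def)
next
  case (move c v p)
  then obtain \<phi> where \<phi>: "sound c \<phi>" by blast
  have wf: "\<And>u w. u \<in> {1..k} \<Longrightarrow> w \<in> {1..k} \<Longrightarrow> c w = Suc n \<Longrightarrow> pattern_adj \<pi> w u \<Longrightarrow> c u \<noteq> 0"
    and le: "\<And>w. c w \<le> Suc n"
    using reachable_wf[OF move.hyps(1)] by (auto simp: wf_config_def)
  have wf': "\<And>u w. u \<in> {1..k} \<Longrightarrow> w \<in> {1..k} \<Longrightarrow> (c(v := p)) w = Suc n \<Longrightarrow> pattern_adj \<pi> w u \<Longrightarrow> (c(v := p)) u \<noteq> 0"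
    using reachable_wf[OF reachable.move[OF move.hyps]] by (simp add: wf_config_def)
  show ?case
  proof (cases "p \<le> n")
    case False
    then have p: "p = Suc n" using move.hyps by auto
    have "c v \<noteq> 0" using move.hyps p by (auto simp: legal_def admits_def)
    then have nz: "(c(v := p)) w \<noteq> 0 \<longleftrightarrow> c w \<noteq> 0" for w using p by simp
    have "sound (c(v := p)) \<phi>"
      unfolding sound_def
    proof (intro conjI ballI impI)
      fix w assume w: "w \<in> {1..k}" "(c(v := p)) w \<noteq> 0"
      then show "\<phi> w \<in> {1..n}" using \<phi> nz by (auto simp: sound_def)
      assume "(c(v := p)) w < Suc n"
      then have "w \<noteq> v" using p by auto
      then show "\<phi> w = (c(v := p)) w" using \<phi> w \<open>(c(v := p)) w < Suc n\<close> by (auto simp: sound_def)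
    next
      fix u w assume "u \<in> {1..k}" "w \<in> {1..k}" "(c(v := p)) u \<noteq> 0" "(c(v := p)) w \<noteq> 0" "pattern_adj \<pi> u w"
      then show "embeds \<phi> u w" using \<phi> nz by (auto simp: sound_def)
    qed (use wf' in blast)
    then show ?thesis by blast
  next
    case True
    then have adm: "c w = 0 \<or> w \<noteq> v \<and> (c w = Suc n \<or> compatible v p w (c w))" if "w \<in> {1..k}" for w
      using move.hyps that by (auto simp: legal_def admits_def)
    have cv: "c v = 0" using adm[of v] move.hyps by auto
    have key: "embeds (\<phi>(v := p)) v w \<and> embeds (\<phi>(v := p)) w v"
      if w: "w \<in> {1..k}" "c w \<noteq> 0" "pattern_adj \<pi> v w" for w
    proof -
      have "w \<noteq> v" using w cv by auto
      have "c w \<noteq> Suc n" using wf[of v w] w cv move.hyps adj_sym by auto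
      then have cw: "c w < Suc n" using le[of w] by auto
      have comp: "compatible v p w (c w)" using adm[OF w(1)] w(2) \<open>c w \<noteq> Suc n\<close> by auto
      have \<phi>w: "\<phi> w = c w" using \<phi> w cw by (auto simp: sound_def)
      have "c w \<noteq> p" using comp \<open>w \<noteq> v\<close> by (auto simp: compatible_def)
      then have "t (c w) \<noteq> t p" using permutes_inj[OF t] by (meson injD)
      moreover have "\<pi> w \<noteq> \<pi> v" using permutes_inj[OF \<pi>] \<open>w \<noteq> v\<close> by (meson injD)
      ultimately show ?thesis
        using comp \<phi>w \<open>w \<noteq> v\<close> unfolding compatible_def embeds_def by auto
    qed
    have "sound (c(v := p)) (\<phi>(v := p))"
      unfolding sound_def
    proof (intro conjI ballI impI)
      fix w assume w: "w \<in> {1..k}" "(c(v := p)) w \<noteq> 0"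
      show "(\<phi>(v := p)) w \<in> {1..n}" using \<phi> w True move.hyps by (auto simp: sound_def)
      assume "(c(v := p)) w < Suc n"
      then show "(\<phi>(v := p)) w = (c(v := p)) w" using \<phi> w by (auto simp: sound_def)
    next
      fix u w assume uw: "u \<in> {1..k}" "w \<in> {1..k}" "(c(v := p)) u \<noteq> 0" "(c(v := p)) w \<noteq> 0" "pattern_adj \<pi> u w"
      show "embeds (\<phi>(v := p)) u w"
      proof (cases "u = v \<or> w = v")
        case True
        then show ?thesis using key[of u] key[of w] uw adj_sym[of u w] adj_irrefl[of v]
          by (cases "u = v"; cases "w = v") auto
      next
        case False
        then show ?thesis using \<phi> uw by (auto simp: sound_def embeds_def)
      qed
    qed (use wf' in blast)
    then show ?thesis by blast
  qed
qed

lemma strict_mono_onI_Suc: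
  fixes h :: "nat \<Rightarrow> nat"
  assumes "\<And>j. 1 \<le> j \<Longrightarrow> Suc j \<le> m \<Longrightarrow> h j < h (Suc j)"
  shows "strict_mono_on {1..m} h"
proof (rule strict_mono_onI)
  fix r s assume "r \<in> {1..m}" "s \<in> {1..m}" "r < s"
  then show "h r < h s"
  proof (induction s)
    case (Suc s)
    show ?case
    proof (cases "r = s")
      case False
      then have "h r < h s" using Suc by auto
      also have "h s < h (Suc s)" using Suc False by (intro assms) auto
      finally show ?thesis .
    qed (use Suc assms in auto)
  qed simp
qed

text \<open>Edges between consecutive positions make \<open>\<phi>\<close> increasing, edges between
  consecutive values make \<open>t \<circ> \<phi> \<circ> inv \<pi>\<close> increasing. Transitivity
  yields the other comparisons, even between positions that were never active together.\<close>

lemma complete_imp_contains: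
  assumes "c \<in> reachable" "complete c"
  shows "contains_pattern n t k \<pi>"
proof -
  obtain \<phi> where \<phi>: "sound c \<phi>" using reachable_sound[OF assms(1)] by blast
  have \<phi>r: "\<phi> ` {1..k} \<subseteq> {1..n}" using \<phi> assms(2) by (auto simp: sound_def complete_def)
  have emb: "embeds \<phi> u w" if "u \<in> {1..k}" "w \<in> {1..k}" "pattern_adj \<pi> u w" for u w
    using \<phi> assms(2) that by (auto simp: sound_def complete_def)
  have mono: "strict_mono_on {1..k} \<phi>"
  proof (rule strict_mono_onI_Suc)
    fix j assume "1 \<le> j" "Suc j \<le> k"
    then have "embeds \<phi> j (Suc j)" by (intro emb) (auto simp: pattern_adj_def)
    then show "\<phi> j < \<phi> (Suc j)" by (simp add: embeds_def)
  qed
  let ?i = "inv \<pi>"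
  have inv: "\<pi> (?i m) = m" "?i (\<pi> m) = m" for m using permutes_inverses[OF \<pi>] by auto
  have inv_in: "?i m \<in> {1..k} \<longleftrightarrow> m \<in> {1..k}" for m using permutes_in_image[OF permutes_inv[OF \<pi>]] .
  have tmono: "strict_mono_on {1..k} (\<lambda>m. t (\<phi> (?i m)))"
  proof (rule strict_mono_onI_Suc)
    fix j assume j: "1 \<le> j" "Suc j \<le> k"
    have "embeds \<phi> (?i j) (?i (Suc j))"
      using j inv_in[of j] inv_in[of "Suc j"] by (intro emb) (auto simp: pattern_adj_def inv)
    then show "t (\<phi> (?i j)) < t (\<phi> (?i (Suc j)))" by (simp add: embeds_def inv)
  qed
  have "t (\<phi> j) < t (\<phi> l) \<longleftrightarrow> \<pi> j < \<pi> l" if "j \<in> {1..k}" "l \<in> {1..k}" for j l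
    using strict_mono_on_less[OF tmono, of "\<pi> j" "\<pi> l"] that permutes_in_image[OF \<pi>] by (simp add: inv)
  then show ?thesis using mono \<phi>r unfolding contains_pattern_def by blast
qed

text \<open>Forgetting does not change which positions are placed, so the members of
  \<open>F\<close> can be forgotten one after another, and the number of active positions never
  rises.\<close>

lemma forget_reachable:
  assumes "finite F" "c \<in> reachable" "F \<subseteq> {1..k}"
    and "\<And>w. w \<in> F \<Longrightarrow> c w \<noteq> 0"
    and "\<And>w u. w \<in> F \<Longrightarrow> u \<in> {1..k} \<Longrightarrow> pattern_adj \<pi> w u \<Longrightarrow> c u \<noteq> 0"
  shows "(\<lambda>w. if w \<in> F then Suc n else c w) \<in> reachable"
  using assms
proof (induction F rule: finite_induct)
  case (insert v F)
  let ?d = "\<lambda>w. if w \<in> F then Suc n else c w"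
  have d: "?d \<in> reachable" using insert by auto
  have "card (active (?d(v := Suc n))) \<le> card (active ?d)"
    by (intro card_mono) (auto simp: active_def)
  also have "\<dots> \<le> lim" using reachable_wf[OF d] by (simp add: wf_config_def)
  finally have count: "card (active (?d(v := Suc n))) \<le> lim" .
  have "admits ?d v (Suc n) w" if "w \<in> {1..k}" for w
    using insert.prems(3)[of v] insert.prems(4)[of v w] that by (auto simp: admits_def)
  then have "legal ?d v (Suc n)" using count by (simp add: legal_def)
  then have "?d(v := Suc n) \<in> reachable" using d insert.prems by (intro reachable.move) auto
  moreover have "?d(v := Suc n) = (\<lambda>w. if w \<in> insert v F then Suc n else c w)" by auto
  ultimately show ?case by simp
qed auto

text \<open>Positions are placed in the order \<open>xs\<close>, and after each one everything
  outside the boundary of the prefix is forgotten. The new position is active before this cleaning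
  up, hence the \<open>Suc\<close> in the bound.\<close>

lemma contains_imp_complete:
  assumes cont: "contains_pattern n t k \<pi>"
    and xs: "distinct xs" "set xs = {1..k}"
    and bd: "\<And>m. Suc (card (boundary (pattern_adj \<pi>) {1..k} (set (take m xs)))) \<le> lim"
  shows "\<exists>c\<in>reachable. complete c"
proof -
  let ?V = "{1..k}" and ?E = "pattern_adj \<pi>"
  obtain i where i: "strict_mono_on ?V i" "i ` ?V \<subseteq> {1..n}"
    "\<And>j l. j \<in> ?V \<Longrightarrow> l \<in> ?V \<Longrightarrow> t (i j) < t (i l) \<longleftrightarrow> \<pi> j < \<pi> l"
    using cont unfolding contains_pattern_def by blast
  have i1: "1 \<le> i w" "i w \<le> n" if "w \<in> ?V" for w using i(2) that by fastforce+
  define conf where "conf P w = (if w \<in> P then if w \<in> boundary ?E ?V P then i w else Suc n else 0)" for P w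
  have reach: "conf (set (take m xs)) \<in> reachable" if "m \<le> length xs" for m
    using that
  proof (induction m)
    case 0
    have "conf {} = (\<lambda>_. 0)" by (auto simp: conf_def)
    then show ?case using reachable.start by simp
  next
    case (Suc m)
    define P where "P = set (take m xs)"
    define v where "v = xs ! m"
    let ?c = "conf P"
    have P': "set (take (Suc m) xs) = insert v P"
      using Suc.prems by (simp add: take_Suc_conv_app_nth P_def v_def)
    have "v \<in> set xs" using Suc.prems by (simp add: v_def)
    then have v: "v \<in> ?V" "v \<notin> P"
      using Suc.prems xs by (auto simp: v_def P_def in_set_conv_nth nth_eq_iff_index_eq)
    have PV: "P \<subseteq> ?V" using xs(2) set_take_subset by (force simp: P_def)
    have rc: "?c \<in> reachable" using Suc by (simp add: P_def)
    have act: "active ?c \<subseteq> boundary ?E ?V P" by (auto simp: active_def conf_def)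
    have "active (?c(v := i v)) \<subseteq> insert v (boundary ?E ?V P)"
      using act by (auto simp: active_def)
    moreover have fb: "finite (boundary ?E ?V P)" by (auto simp: boundary_def P_def)
    ultimately have "card (active (?c(v := i v))) \<le> card (insert v (boundary ?E ?V P))"
      by (intro card_mono) auto
    also have "\<dots> \<le> Suc (card (boundary ?E ?V P))" using fb by (simp add: card_insert_if)
    also have "\<dots> \<le> lim" using bd by (simp add: P_def)
    finally have cnt: "card (active (?c(v := i v))) \<le> lim" .
    have "admits ?c v (i v) w" if w: "w \<in> ?V" for w
    proof -
      have "compatible v (i v) w (i w)"
        using strict_mono_on_less[OF i(1)] i(3) v w by (simp add: compatible_def)
      then show ?thesis using i1(2)[OF v(1)] v(2) by (auto simp: admits_def conf_def)
    qed
    then have "legal ?c v (i v)" using cnt by (simp add: legal_def)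
    then have rd: "?c(v := i v) \<in> reachable"
      using rc v(1) i1[OF v(1)] by (intro reachable.move) auto
    define F where "F = insert v P - boundary ?E ?V (insert v P)"
    have nz: "(?c(v := i v)) w \<noteq> 0 \<longleftrightarrow> w \<in> insert v P" if "w \<in> ?V" for w
      using that i1(1)[OF v(1)] i1(1)[OF that] v(2) by (auto simp: conf_def)
    have "(\<lambda>w. if w \<in> F then Suc n else (?c(v := i v)) w) \<in> reachable"
    proof (rule forget_reachable[OF _ rd])
      show "finite F" by (simp add: F_def P_def)
      show "F \<subseteq> ?V" using PV v(1) by (auto simp: F_def)
      show "(?c(v := i v)) w \<noteq> 0" if "w \<in> F" for w
        using nz[of w] that PV v(1) by (auto simp: F_def)
      show "(?c(v := i v)) u \<noteq> 0" if "w \<in> F" "u \<in> ?V" "?E w u" for w u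
        using nz[of u] that by (auto simp: F_def boundary_def)
    qed
    also have "(\<lambda>w. if w \<in> F then Suc n else (?c(v := i v)) w) = conf (insert v P)"
    proof
      fix w
      show "(if w \<in> F then Suc n else (?c(v := i v)) w) = conf (insert v P) w"
        using v(2) by (auto simp: F_def conf_def boundary_def)
    qed
    finally show ?case by (simp add: P')
  qed
  have "conf ?V \<in> reachable" using reach[of "length xs"] xs(2) by simp
  moreover have "complete (conf ?V)" by (auto simp: complete_def conf_def boundary_def)
  ultimately show ?thesis by blast
qed

section \<open>Counting configurations\<close>

lemma wf_config_step:
  assumes "wf_config c" "j \<in> {1..k}" "Suc j \<in> {1..k}" "j \<notin> active c" "Suc j \<notin> active c"
  shows "c (Suc j) = c j"
proof -
  have "pattern_adj \<pi> j (Suc j)" "pattern_adj \<pi> (Suc j) j" by (auto simp: pattern_adj_def)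
  moreover have "c j = 0 \<or> c j = Suc n" "c (Suc j) = 0 \<or> c (Suc j) = Suc n"
    using assms unfolding wf_config_def active_def by (auto simp: le_less)
  ultimately show ?thesis using assms(1-3) unfolding wf_config_def by fastforce
qed

text \<open>Consecutive inactive positions are both unplaced or both forgotten, so the first value of a
  configuration and the values at and after its active positions determine the rest.\<close>

definition trace :: "(nat \<Rightarrow> nat) \<Rightarrow> (nat \<times> nat \<times> nat) set" where
  "trace c = (\<lambda>j. (j, c j, c (Suc j))) ` active c"

lemma wf_config_trace_inj:
  assumes wf: "wf_config c" "wf_config d" and "c 1 = d 1" "trace c = trace d"
  shows "c = d"
proof
  have mem: "(j, x, y) \<in> trace e \<longleftrightarrow> j \<in> active e \<and> x = e j \<and> y = e (Suc j)" for e j x y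
    by (auto simp: trace_def)
  have act: "active c = active d"
    using mem[of _ _ _ c] mem[of _ _ _ d] assms(4) by auto
  have val: "c j = d j \<and> c (Suc j) = d (Suc j)" if "j \<in> active c" for j
    using mem[of j "c j" "c (Suc j)" c] mem[of j "c j" "c (Suc j)" d] that assms(4) by simp
  fix w
  show "c w = d w"
  proof (cases "w \<in> {1..k}")
    case True
    then show ?thesis
    proof (induction w)
      case (Suc j)
      show ?case
      proof (cases "j = 0")
        case False
        then have j: "j \<in> {1..k}" using Suc.prems by auto
        then have IH: "c j = d j" using Suc.IH by simp
        consider "j \<in> active c" | "Suc j \<in> active c" | "j \<notin> active c" "Suc j \<notin> active c" by blast
        then show ?thesis
        proof cases
          case 3
          then show ?thesis
            using wf_config_step[OF wf(1) j Suc.prems] wf_config_step[OF wf(2) j Suc.prems] act IH by simp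
        qed (use val in auto)
      qed (use assms(3) in simp)
    qed simp
  qed (use wf in \<open>simp add: wf_config_def\<close>)
qed

text \<open>A subset with at most \<open>m\<close> elements is listed by a word of length
  \<open>m\<close> over \<open>U\<close> and the padding letter \<open>None\<close>.\<close>

lemma card_small_subsets:
  assumes "finite U"
  shows "finite {D. D \<subseteq> U \<and> card D \<le> m}" "card {D. D \<subseteq> U \<and> card D \<le> m} \<le> Suc (card U) ^ m"
proof -
  let ?L = "{xs. set xs \<subseteq> insert None (Some ` U) \<and> length xs = m}"
  let ?f = "\<lambda>xs. {u. Some u \<in> set xs}"
  have sub: "{D. D \<subseteq> U \<and> card D \<le> m} \<subseteq> ?f ` ?L"
  proof
    fix D assume "D \<in> {D. D \<subseteq> U \<and> card D \<le> m}"
    then have D: "D \<subseteq> U" "card D \<le> m" by auto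
    obtain ys where ys: "set ys = D" "distinct ys"
      using finite_distinct_list finite_subset[OF D(1) assms] by blast
    have "length ys \<le> m" using D(2) ys distinct_card by fastforce
    then have "map Some ys @ replicate (m - length ys) None \<in> ?L" using ys D by auto
    moreover have "?f (map Some ys @ replicate (m - length ys) None) = D" using ys by auto
    ultimately show "D \<in> ?f ` ?L" by blast
  qed
  have fin: "finite (insert None (Some ` U))" using assms by simp
  have L: "finite ?L" "card ?L = card (insert None (Some ` U)) ^ m"
    using finite_lists_length_eq[OF fin] card_lists_length_eq[OF fin] by auto
  have c: "card (insert None (Some ` U)) = Suc (card U)"
    using assms by (subst card_insert_disjoint) (auto simp: card_image)
  show "finite {D. D \<subseteq> U \<and> card D \<le> m}" using sub L(1) by (rule finite_subset[OF _ finite_imageI])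
  have "card {D. D \<subseteq> U \<and> card D \<le> m} \<le> card (?f ` ?L)" using sub L(1) by (intro card_mono) auto
  also have "\<dots> \<le> card ?L" using L(1) by (rule card_image_le)
  finally show "card {D. D \<subseteq> U \<and> card D \<le> m} \<le> Suc (card U) ^ m" using L(2) c by simp
qed

text \<open>The first factor counts the values at position 1, the second one the traces, which are
  sets of at most \<open>lim\<close> triples out of \<open>k * (n + 2)\<^sup>2\<close>.\<close>

definition max_configs :: nat where
  "max_configs = (n + 2) * Suc (k * (n + 2)\<^sup>2) ^ lim"

lemma card_reachable: "finite reachable" "card reachable \<le> max_configs"
proof -
  let ?U = "{1..k} \<times> {0..Suc n} \<times> {0..Suc n}"
  let ?R = "{0..Suc n} \<times> {D. D \<subseteq> ?U \<and> card D \<le> lim}"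
  let ?f = "\<lambda>c. (c 1, trace c)"
  have finU: "finite ?U" by simp
  have cU: "card ?U = k * (n + 2)\<^sup>2" by (simp add: power2_eq_square)
  have inj: "inj_on ?f reachable"
    using wf_config_trace_inj reachable_wf by (auto simp: inj_on_def)
  have sub: "?f ` reachable \<subseteq> ?R"
  proof
    fix z assume "z \<in> ?f ` reachable"
    then obtain c where c: "c \<in> reachable" "z = ?f c" by blast
    have wf: "\<And>w. c w \<le> Suc n" "card (active c) \<le> lim"
      using reachable_wf[OF c(1)] by (auto simp: wf_config_def)
    have "trace c \<subseteq> ?U" using wf(1) by (auto simp: trace_def active_def)
    moreover have "card (trace c) \<le> lim"
      using card_image_le[OF finite_active, of "\<lambda>j. (j, c j, c (Suc j))" c] wf(2) by (simp add: trace_def)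
    ultimately show "z \<in> ?R" using c(2) wf(1) by auto
  qed
  have finR: "finite ?R" using card_small_subsets(1)[OF finU] by blast
  show "finite reachable" using finite_imageD[OF finite_subset[OF sub finR] inj] .
  have "card reachable = card (?f ` reachable)" using card_image[OF inj] by simp
  also have "\<dots> \<le> card ?R" by (rule card_mono[OF finR sub])
  also have "\<dots> = (n + 2) * card {D. D \<subseteq> ?U \<and> card D \<le> lim}" by (simp add: card_cartesian_product)
  also have "\<dots> \<le> max_configs"
    unfolding max_configs_def using card_small_subsets(2)[OF finU, of lim] cU by (intro mult_le_mono2) simp
  finally show "card reachable \<le> max_configs" .
qed

end

section \<open>The program\<close>

abbreviation holds :: "aexp \<Rightarrow> state \<Rightarrow> bool" where
  "holds e s \<equiv> aval e s \<noteq> 0"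

text \<open>Truth is being nonzero. Hence \<open>Plus\<close> serves as disjunction, and truncated
  subtraction as negation and as strict comparison.\<close>

definition Not :: "aexp \<Rightarrow> aexp" where "Not e = Minus (N 1) e"
definition And :: "aexp \<Rightarrow> aexp \<Rightarrow> aexp" where "And a b = Not (Plus (Not a) (Not b))"
definition Iff :: "aexp \<Rightarrow> aexp \<Rightarrow> aexp" where "Iff a b = And (Plus (Not a) b) (Plus (Not b) a)"
abbreviation Less :: "aexp \<Rightarrow> aexp \<Rightarrow> aexp" where "Less a b \<equiv> Minus b a"
definition Eq :: "aexp \<Rightarrow> aexp \<Rightarrow> aexp" where "Eq a b = Not (Plus (Minus a b) (Minus b a))"

lemma aval_Not [simp]: "aval (Not e) s = of_bool (\<not> holds e s)"
  by (simp add: Not_def)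

lemma aval_And [simp]: "aval (And a b) s = of_bool (holds a s \<and> holds b s)"
  by (simp add: And_def)

lemma aval_Iff [simp]: "aval (Iff a b) s = of_bool (holds a s \<longleftrightarrow> holds b s)"
  by (auto simp: Iff_def)

lemma aval_Eq [simp]: "aval (Eq a b) s = of_bool (aval a s = aval b s)"
  by (auto simp: Eq_def)

definition runs :: "com \<Rightarrow> state \<Rightarrow> nat \<Rightarrow> (state \<Rightarrow> bool) \<Rightarrow> bool" where
  "runs c s B Q \<longleftrightarrow> (\<exists>T s'. exec c s T s' \<and> T \<le> B \<and> Q s')"

lemma runs_weaken: "runs c s B Q \<Longrightarrow> B \<le> B' \<Longrightarrow> (\<And>s'. Q s' \<Longrightarrow> Q' s') \<Longrightarrow> runs c s B' Q'"
  unfolding runs_def by (meson le_trans)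

lemma runs_bound: "runs c s B Q \<Longrightarrow> B \<le> B' \<Longrightarrow> runs c s B' Q"
  by (rule runs_weaken)

lemma runs_Skip: "Q s \<Longrightarrow> runs Skip s 1 Q"
  unfolding runs_def using exec.Skip by blast

lemma runs_Assign: "Q ((fst s)(x := aval e s), snd s) \<Longrightarrow> runs (Assign x e) s (acost e + 1) Q"
  unfolding runs_def using exec.Assign by blast

lemma runs_Store:
  "Q (fst s, (snd s)(aval e1 s := aval e2 s)) \<Longrightarrow> runs (Store e1 e2) s (acost e1 + acost e2 + 1) Q"
  unfolding runs_def using exec.Store by blast

lemma runs_Seq:
  assumes "runs c1 s B1 (\<lambda>s'. runs c2 s' B2 Q)"
  shows "runs (Seq c1 c2) s (B1 + B2) Q"
proof -
  obtain T1 s1 T2 s2 where "exec c1 s T1 s1" "T1 \<le> B1" "exec c2 s1 T2 s2" "T2 \<le> B2" "Q s2"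
    using assms unfolding runs_def by blast
  then show ?thesis unfolding runs_def
    by (intro exI[of _ "T1 + T2"] exI[of _ s2]) (auto intro: exec.Seq)
qed

lemma runs_Cond:
  assumes "holds e s \<Longrightarrow> runs c1 s B Q" "\<not> holds e s \<Longrightarrow> runs c2 s B Q"
  shows "runs (Cond e c1 c2) s (acost e + 1 + B) Q"
proof (cases "holds e s")
  case True
  with assms(1) obtain T s' where "exec c1 s T s'" "T \<le> B" "Q s'" unfolding runs_def by blast
  with exec.CondTrue[OF True] show ?thesis unfolding runs_def by (meson add_left_mono)
next
  case False
  with assms(2) obtain T s' where "exec c2 s T s'" "T \<le> B" "Q s'" unfolding runs_def by blast
  moreover have "exec (Cond e c1 c2) s (acost e + 1 + T) s'"
    using False calculation by (intro exec.CondFalse) auto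
  ultimately show ?thesis unfolding runs_def by (meson add_left_mono)
qed

text \<open>The invariant carries the number \<open>i\<close> of completed rounds. A round can start
  only if \<open>i < m\<close>, which gives termination and the time bound at once.\<close>

lemma runs_While:
  assumes start: "I (0::nat) s"
    and step: "\<And>i s. I i s \<Longrightarrow> holds e s \<Longrightarrow> i < m \<and> runs c s B (I (Suc i))"
    and stop: "\<And>i s. I i s \<Longrightarrow> \<not> holds e s \<Longrightarrow> Q s"
  shows "runs (While e c) s (m * (acost e + 1 + B) + (acost e + 1)) Q"
proof -
  have "runs (While e c) s ((m - i) * (acost e + 1 + B) + (acost e + 1)) Q" if "I i s" for i s
    using that
  proof (induction "m - i" arbitrary: i s rule: less_induct)
    case less
    show ?case
    proof (cases "holds e s")
      case False
      then have "exec (While e c) s (acost e + 1) s" by (intro exec.WhileFalse) simp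
      then show ?thesis using stop[OF less.prems False] unfolding runs_def
        by (intro exI[of _ "acost e + 1"] exI[of _ s]) simp
    next
      case True
      from step[OF less.prems True] obtain T1 s1 where
        1: "i < m" "exec c s T1 s1" "T1 \<le> B" "I (Suc i) s1" unfolding runs_def by blast
      then have "m - Suc i < m - i" by simp
      from less.hyps[OF this 1(4)] obtain T2 s2 where
        2: "exec (While e c) s1 T2 s2" "T2 \<le> (m - Suc i) * (acost e + 1 + B) + (acost e + 1)" "Q s2"
        unfolding runs_def by blast
      have "exec (While e c) s (acost e + 1 + T1 + T2) s2" by (rule exec.WhileTrue[OF True 1(2) 2(1)])
      moreover have "m - i = Suc (m - Suc i)" using 1(1) by simp
      then have "acost e + 1 + T1 + T2 \<le> (m - i) * (acost e + 1 + B) + (acost e + 1)"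
        using 1(3) 2(2) by simp
      ultimately show ?thesis using 2(3) unfolding runs_def by blast
    qed
  qed
  from this[OF start] show ?thesis by simp
qed

text \<open>Loop-free code is executed by simplification. The values of \<open>effect\<close> and
  \<open>cost\<close> at \<open>While\<close> are dummies, which \<open>straight\<close>
  excludes.\<close>

fun straight :: "com \<Rightarrow> bool" where
  "straight (Seq c1 c2) \<longleftrightarrow> straight c1 \<and> straight c2"
| "straight (Cond e c1 c2) \<longleftrightarrow> straight c1 \<and> straight c2"
| "straight (While e c) \<longleftrightarrow> False"
| "straight _ \<longleftrightarrow> True"

fun effect :: "com \<Rightarrow> state \<Rightarrow> state" where
  "effect Skip s = s"
| "effect (Assign x e) s = ((fst s)(x := aval e s), snd s)"
| "effect (Store e1 e2) s = (fst s, (snd s)(aval e1 s := aval e2 s))"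
| "effect (Seq c1 c2) s = effect c2 (effect c1 s)"
| "effect (Cond e c1 c2) s = (if holds e s then effect c1 s else effect c2 s)"
| "effect (While e c) s = s"

fun cost :: "com \<Rightarrow> nat" where
  "cost Skip = 1"
| "cost (Assign x e) = acost e + 1"
| "cost (Store e1 e2) = acost e1 + acost e2 + 1"
| "cost (Seq c1 c2) = cost c1 + cost c2"
| "cost (Cond e c1 c2) = acost e + 1 + max (cost c1) (cost c2)"
| "cost (While e c) = 0"

lemma runs_straight: "straight c \<Longrightarrow> Q (effect c s) \<Longrightarrow> runs c s (cost c) Q"
proof (induction c arbitrary: s Q)
  case (Seq c1 c2)
  then have "runs c1 s (cost c1) (\<lambda>s'. runs c2 s' (cost c2) Q)" by simp
  then show ?case by (simp add: runs_Seq)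
next
  case (Cond e c1 c2)
  have "runs c1 s (max (cost c1) (cost c2)) Q" if "holds e s"
    using Cond that by (intro runs_weaken[OF Cond.IH(1)]) auto
  moreover have "runs c2 s (max (cost c1) (cost c2)) Q" if "\<not> holds e s"
    using Cond that by (intro runs_weaken[OF Cond.IH(2)]) auto
  ultimately show ?case by (simp only: cost.simps) (rule runs_Cond)
next
  case Skip
  then show ?case using runs_Skip[of Q s] by simp
next
  case (Assign x e)
  then show ?case using runs_Assign[of Q s x e] by simp
next
  case (Store e1 e2)
  then show ?case using runs_Store[of Q s e1 e2] by simp
qed simp

text \<open>
  The configurations found so far are stored in blocks of length \<open>k\<close> behind the input, from
  \<open>base + 1\<close> up to \<open>end\<close>. The block behind \<open>end\<close> is scratch space for the result of a move from
  the configuration at \<open>cur\<close>; it is kept by increasing \<open>end\<close>.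
\<close>

definition check_expr :: aexp where
  "check_expr =
     Plus
      (And (Less (V ''p'') (Plus (V ''n'') (N 1)))
           (Plus (Not (Mem (Plus (V ''cur'') (V ''w''))))
              (And (Not (Eq (V ''w'') (V ''v'')))
                (Plus (Eq (Mem (Plus (V ''cur'') (V ''w''))) (Plus (V ''n'') (N 1)))
                   (And (Iff (Less (V ''v'') (V ''w'')) (Less (V ''p'') (Mem (Plus (V ''cur'') (V ''w'')))))
                   (And (Iff (Less (V ''w'') (V ''v'')) (Less (Mem (Plus (V ''cur'') (V ''w''))) (V ''p'')))
                        (Iff (Less (Mem (Plus (V ''n'') (V ''v''))) (Mem (Plus (V ''n'') (V ''w''))))
                             (Less (Mem (V ''p'')) (Mem (Mem (Plus (V ''cur'') (V ''w'')))))))))))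
      )
      (And (Not (Less (V ''p'') (Plus (V ''n'') (N 1))))
           (Plus (Mem (Plus (V ''cur'') (V ''w'')))
             (Not (Plus (Eq (V ''w'') (V ''v''))
               (Plus (Plus (Eq (V ''w'') (Plus (V ''v'') (N 1))) (Eq (V ''v'') (Plus (V ''w'') (N 1))))
                     (Plus (Eq (Mem (Plus (V ''n'') (V ''w''))) (Plus (Mem (Plus (V ''n'') (V ''v''))) (N 1)))
                           (Eq (Mem (Plus (V ''n'') (V ''v''))) (Plus (Mem (Plus (V ''n'') (V ''w''))) (N 1)))))))))"

definition store_entry :: com where
  "store_entry = Cond (Eq (V ''w'') (V ''v''))
     (Store (Plus (V ''end'') (V ''w'')) (V ''p''))
     (Store (Plus (V ''end'') (V ''w'')) (Mem (Plus (V ''cur'') (V ''w''))))"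

text \<open>\<open>ok\<close> stays nonzero while all tests succeed, \<open>cnt\<close> counts
  active entries and \<open>zero\<close> unplaced ones; they decide admissibility, the limit and
  completeness of the new configuration.\<close>

definition inspect_entry :: com where
  "inspect_entry =
     Seq (Assign ''ok'' (And (V ''ok'') check_expr))
    (Seq (Assign ''cnt'' (Plus (V ''cnt'')
            (And (Mem (Plus (V ''end'') (V ''w'')))
                 (Less (Mem (Plus (V ''end'') (V ''w''))) (Plus (V ''n'') (N 1))))))
    (Seq (Assign ''zero'' (Plus (V ''zero'') (Not (Mem (Plus (V ''end'') (V ''w''))))))
         (Assign ''w'' (Plus (V ''w'') (N 1)))))"

definition build :: com where
  "build =
     Seq (Seq (Assign ''ok'' (N 1)) (Seq (Assign ''cnt'' (N 0)) (Seq (Assign ''zero'' (N 0))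
         (Assign ''w'' (N 1)))))
         (While (Less (V ''w'') (Plus (V ''k'') (N 1))) (Seq store_entry inspect_entry))"

definition compare_entry :: com where
  "compare_entry =
     Seq (Assign ''diff'' (Plus (V ''diff'')
            (Plus (Minus (Mem (Plus (V ''q'') (V ''w''))) (Mem (Plus (V ''end'') (V ''w''))))
                  (Minus (Mem (Plus (V ''end'') (V ''w''))) (Mem (Plus (V ''q'') (V ''w'')))))))
         (Assign ''w'' (Plus (V ''w'') (N 1)))"

definition compare :: com where
  "compare =
     Seq (Seq (Assign ''diff'' (N 0)) (Assign ''w'' (N 1)))
         (While (Less (V ''w'') (Plus (V ''k'') (N 1))) compare_entry)"

definition lookup_body :: com where
  "lookup_body =
     Seq compare
    (Seq (Assign ''dup'' (Plus (V ''dup'') (Not (V ''diff''))))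
         (Assign ''q'' (Plus (V ''q'') (V ''k''))))"

definition lookup :: com where
  "lookup =
     Seq (Seq (Assign ''dup'' (N 0)) (Assign ''q'' (V ''base'')))
         (While (Less (V ''q'') (V ''end'')) lookup_body)"

text \<open>The verdict is passed only after the whole block has been written. A rejected block
  stays behind \<open>end\<close> and is overwritten by the next attempt.\<close>

definition commit :: com where
  "commit =
     Cond (And (V ''ok'') (And (Not (Less (V ''lim'') (V ''cnt''))) (Not (V ''dup''))))
       (Seq (Cond (V ''zero'') Skip (Assign ''out'' (N 1)))
            (Assign ''end'' (Plus (V ''end'') (V ''k''))))
       Skip"

definition attempt :: com where
  "attempt = Seq build (Seq lookup commit)"

definition p_loop :: com where
  "p_loop = Seq (Assign ''p'' (N 1))
     (While (Less (V ''p'') (Plus (V ''n'') (N 2)))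
        (Seq attempt (Assign ''p'' (Plus (V ''p'') (N 1)))))"

definition v_loop :: com where
  "v_loop = Seq (Assign ''v'' (N 1))
     (While (Less (V ''v'') (Plus (V ''k'') (N 1)))
        (Seq p_loop (Assign ''v'' (Plus (V ''v'') (N 1)))))"

definition explore :: com where
  "explore = While (Less (V ''cur'') (V ''end''))
     (Seq v_loop (Assign ''cur'' (Plus (V ''cur'') (V ''k''))))"

text \<open>\<open>q\<close> runs through the squares of \<open>r\<close>. The factor is \<open>253 = 7 * 6\<^sup>2 + 1\<close>: the boundary of
  a prefix in a layout without \<open>K\<^sub>6\<close> minor, and the vertex that is being added.\<close>

definition compute_lim :: com where
  "compute_lim = While (Less (V ''q'') (V ''k''))
     (Seq (Assign ''q'' (Plus (V ''q'') (Plus (V ''r'') (Plus (V ''r'') (N 1)))))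
     (Seq (Assign ''r'' (Plus (V ''r'') (N 1)))
          (Assign ''lim'' (Plus (V ''lim'') (N 253)))))"

text \<open>Memory behind the input is initially zero, so the first block already holds the start
  configuration and only has to be claimed by \<open>end\<close>.\<close>

definition search :: com where
  "search =
     Seq compute_lim
    (Seq (Seq (Assign ''base'' (Plus (V ''n'') (V ''k'')))
         (Seq (Assign ''cur'' (V ''base''))
              (Assign ''end'' (Plus (V ''base'') (V ''k'')))))
         explore)"

text \<open>Patterns of length at most one occur whenever \<open>k \<le> n\<close>. They are
  answered in constant time, because for \<open>k = 0\<close> the exponent of the time bound is
  zero, and for \<open>n = 1\<close> powers of \<open>n\<close> do not grow.\<close>

definition program :: com where
  "program = Cond (Less (N 1) (V ''k'')) search (Assign ''out'' (N 1))"

section \<open>Correctness and running time of the loops\<close>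

lemma cost_entry: "cost (Seq store_entry inspect_entry) \<le> 380"
  by code_simp

lemma cost_compare_entry: "cost compare_entry \<le> 30"
  by code_simp

text \<open>The shape of the cost of a loop: initialisation \<open>i\<close>, then \<open>m\<close>
  rounds of guard \<open>g\<close> and body \<open>b\<close>, then the last guard.\<close>

lemma loop_bound:
  fixes a b g i m x :: nat
  assumes "b \<le> x" "i + g \<le> a" "g + x \<le> a"
  shows "i + (m * (g + b) + g) \<le> a * (m + 1)"
proof -
  have "m * (g + b) \<le> m * a" using assms(1,3) by (intro mult_le_mono2) simp
  with assms(2) show ?thesis by (simp add: algebra_simps)
qed

definition same_regs :: "string set \<Rightarrow> state \<Rightarrow> state \<Rightarrow> bool" where
  "same_regs X s s' \<longleftrightarrow> (\<forall>x. x \<notin> X \<longrightarrow> fst s' x = fst s x)"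

lemma same_regs_refl [simp]: "same_regs X s s"
  by (simp add: same_regs_def)

lemma ball_atLeastAtMost_Suc: "(\<forall>w\<in>{1..Suc i}. P w) \<longleftrightarrow> (\<forall>w\<in>{1..i}. P w) \<and> P (Suc i)"
  by (subst atLeastAtMostSuc_conv) auto

lemma le_iff_le_conv:
  fixes a b c d :: nat
  shows "(a \<le> b \<longleftrightarrow> c \<le> d) \<longleftrightarrow> (b < a \<longleftrightarrow> d < c)"
  by auto

context pattern_search
begin

definition reads :: "state \<Rightarrow> bool" where
  "reads s \<longleftrightarrow> fst s ''n'' = n \<and> fst s ''k'' = k \<and>
     (\<forall>a\<in>{1..n}. snd s a = t a) \<and> (\<forall>j\<in>{1..k}. snd s (n + j) = \<pi> j)"

lemma check_expr_correct:
  assumes "reads s" "fst s ''w'' = w" "fst s ''v'' = v" "fst s ''p'' = p"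
    and "w \<in> {1..k}" "v \<in> {1..k}" "p \<in> {1..Suc n}"
    and "snd s (fst s ''cur'' + w) = c w" "c w \<le> Suc n"
  shows "holds check_expr s \<longleftrightarrow> admits c v p w"
proof -
  have r: "snd s (n + w) = \<pi> w" "snd s (n + v) = \<pi> v" "fst s ''n'' = n"
    using assms by (auto simp: reads_def)
  have tp: "p \<le> n \<Longrightarrow> snd s p = t p" using assms by (auto simp: reads_def)
  have tc: "c w \<noteq> 0 \<Longrightarrow> c w \<noteq> Suc n \<Longrightarrow> snd s (c w) = t (c w)" using assms by (auto simp: reads_def)
  have ev: "holds check_expr s \<longleftrightarrow>
     (\<not> Suc n \<le> p \<and> (c w = 0 \<or> (w \<noteq> v \<and> (c w = Suc n \<or>
        ((w \<le> v \<longleftrightarrow> c w \<le> p) \<and> (v \<le> w \<longleftrightarrow> p \<le> c w) \<and> (\<pi> w \<le> \<pi> v \<longleftrightarrow> snd s (c w) \<le> snd s p)))))) \<or>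
     (Suc n \<le> p \<and> (c w \<noteq> 0 \<or> \<not> (w = v \<or> (w = Suc v \<or> v = Suc w) \<or> (\<pi> w = Suc (\<pi> v) \<or> \<pi> v = Suc (\<pi> w)))))"
    unfolding check_expr_def using assms r by (simp)
  show ?thesis
  proof (cases "p \<le> n")
    case True
    show ?thesis
    \<comment> \<open>Expressions are evaluated in full. For these two values the innermost read
      does not fetch a value of \<open>t\<close>, but the disjunction is already decided.\<close>
    proof (cases "c w = 0 \<or> c w = Suc n")
      case True
      then show ?thesis unfolding ev admits_def using \<open>p \<le> n\<close> by auto
    next
      case False
      then show ?thesis unfolding ev admits_def compatible_def le_iff_le_conv using \<open>p \<le> n\<close> tp tc by simp
    qed
  next
    case False
    then show ?thesis unfolding ev admits_def pattern_adj_def by auto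
  qed
qed

lemma readsI:
  assumes "reads s" "\<And>x. x \<in> {''n'', ''k''} \<Longrightarrow> fst s' x = fst s x" "\<And>a. a \<le> n + k \<Longrightarrow> snd s' a = snd s a"
  shows "reads s'"
  using assms by (auto simp: reads_def)

text \<open>The assumptions on \<open>cur\<close> and \<open>end\<close> keep the new block away
  from the input and from the block being read, so an entry can be tested as soon as it is
  stored.\<close>

lemma build_correct:
  assumes s: "reads s" "fst s ''v'' = v" "fst s ''p'' = p" "v \<in> {1..k}" "p \<in> {1..Suc n}"
    and base: "n + k \<le> fst s ''cur''" "fst s ''cur'' + k \<le> fst s ''end''"
    and c: "\<And>w. w \<in> {1..k} \<Longrightarrow> snd s (fst s ''cur'' + w) = c w" "\<And>w. c w \<le> Suc n"
  shows "runs build s (400 * (k + 1)) (\<lambda>s'. same_regs {''ok'', ''cnt'', ''zero'', ''w''} s s' \<and>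
     (\<forall>a\<le>fst s ''end''. snd s' a = snd s a) \<and>
     (\<forall>w\<in>{1..k}. snd s' (fst s ''end'' + w) = (c(v := p)) w) \<and>
     (fst s' ''ok'' \<noteq> 0 \<longleftrightarrow> (\<forall>w\<in>{1..k}. admits c v p w)) \<and>
     fst s' ''cnt'' = card (active (c(v := p))) \<and>
     (fst s' ''zero'' = 0 \<longleftrightarrow> complete (c(v := p))))" (is "runs _ _ _ ?Q")
proof -
  define E where "E = fst s ''end''"
  define C where "C = fst s ''cur''"
  define d where "d = c(v := p)"
  define I where "I i s' \<longleftrightarrow> i \<le> k \<and> same_regs {''ok'', ''cnt'', ''zero'', ''w''} s s' \<and>
     (\<forall>a\<le>E. snd s' a = snd s a) \<and>
     (\<forall>w\<in>{1..i}. snd s' (E + w) = d w) \<and>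
     (fst s' ''ok'' \<noteq> 0 \<longleftrightarrow> (\<forall>w\<in>{1..i}. admits c v p w)) \<and>
     fst s' ''cnt'' = card {w\<in>{1..i}. d w \<noteq> 0 \<and> d w < Suc n} \<and>
     (fst s' ''zero'' = 0 \<longleftrightarrow> (\<forall>w\<in>{1..i}. d w \<noteq> 0)) \<and> fst s' ''w'' = Suc i" for i :: nat and s'
  have CE: "n + k \<le> C" "C + k \<le> E" using base by (simp_all add: C_def E_def)
  have step: "i < k \<and> runs (Seq store_entry inspect_entry) s' (cost (Seq store_entry inspect_entry)) (I (Suc i))"
    if I: "I i s'" and h: "holds (Less (V ''w'') (Plus (V ''k'') (N 1))) s'" for i s'
  proof -
    have regs: "fst s' ''n'' = n" "fst s' ''k'' = k" "fst s' ''v'' = v" "fst s' ''p'' = p"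
      "fst s' ''cur'' = C" "fst s' ''end'' = E" "fst s' ''w'' = Suc i"
      using I s by (auto simp: I_def same_regs_def reads_def C_def E_def)
    then have i: "i < k" using h by simp
    define s1 where "s1 = (fst s', (snd s')(E + Suc i := d (Suc i)))"
    have w: "Suc i \<in> {1..k}" using i by auto
    have cur: "snd s' (C + Suc i) = c (Suc i)" using I c(1)[OF w] CE i by (auto simp: I_def C_def)
    have "reads s1"
      using s(1) by (rule readsI) (use regs I CE s(1) in \<open>auto simp: s1_def I_def reads_def\<close>)
    then have chk: "holds check_expr s1 \<longleftrightarrow> admits c v p (Suc i)"
      by (rule check_expr_correct) (use regs s c w cur CE i in \<open>auto simp: s1_def\<close>)
    have e1: "effect store_entry s' = s1"
      using regs cur by (auto simp: store_entry_def s1_def d_def)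
    define s2 where "s2 = ((fst s')(''ok'' := of_bool (fst s' ''ok'' \<noteq> 0 \<and> admits c v p (Suc i)),
       ''cnt'' := fst s' ''cnt'' + of_bool (d (Suc i) \<noteq> 0 \<and> d (Suc i) < Suc n),
       ''zero'' := fst s' ''zero'' + of_bool (d (Suc i) = 0), ''w'' := Suc (Suc i)), snd s1)"
    have r1: "fst s1 = fst s'" "snd s1 (E + Suc i) = d (Suc i)" by (auto simp: s1_def)
    have e2: "effect inspect_entry s1 = s2"
      using chk regs r1(2) by (simp add: inspect_entry_def r1(1) s2_def)
    have cnt: "card {w\<in>{1..Suc i}. d w \<noteq> 0 \<and> d w < Suc n} =
        card {w\<in>{1..i}. d w \<noteq> 0 \<and> d w < Suc n} + of_bool (d (Suc i) \<noteq> 0 \<and> d (Suc i) < Suc n)"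
    proof (cases "d (Suc i) \<noteq> 0 \<and> d (Suc i) < Suc n")
      case True
      then have "{w\<in>{1..Suc i}. d w \<noteq> 0 \<and> d w < Suc n} = insert (Suc i) {w\<in>{1..i}. d w \<noteq> 0 \<and> d w < Suc n}"
        by (auto simp: le_Suc_eq)
      then show ?thesis using True by simp
    next
      case False
      then have "{w\<in>{1..Suc i}. d w \<noteq> 0 \<and> d w < Suc n} = {w\<in>{1..i}. d w \<noteq> 0 \<and> d w < Suc n}"
        by (auto simp: le_Suc_eq)
      then show ?thesis using False by simp
    qed
    have "I (Suc i) s2"
      unfolding I_def ball_atLeastAtMost_Suc cnt
      using I i by (auto simp: I_def s2_def s1_def same_regs_def)
    then show ?thesis using i e1 e2
      by (intro conjI runs_straight) (simp_all add: store_entry_def inspect_entry_def)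
  qed
  have stop: "?Q s'" if I: "I i s'" and h: "\<not> holds (Less (V ''w'') (Plus (V ''k'') (N 1))) s'" for i s'
  proof -
    have "fst s' ''k'' = k" "fst s' ''w'' = Suc i" using I s(1) by (auto simp: I_def same_regs_def reads_def)
    then have "i = k" using I h by (simp add: I_def)
    then show ?thesis using I by (simp add: I_def E_def active_def complete_def d_def)
  qed
  have "runs build s (cost (Seq (Assign ''ok'' (N 1)) (Seq (Assign ''cnt'' (N 0)) (Seq (Assign ''zero'' (N 0))
         (Assign ''w'' (N 1))))) + (k * (acost (Less (V ''w'') (Plus (V ''k'') (N 1))) + 1 +
         cost (Seq store_entry inspect_entry)) + (acost (Less (V ''w'') (Plus (V ''k'') (N 1))) + 1))) ?Q"
    unfolding build_def
    by (rule runs_Seq, rule runs_straight, simp, rule runs_While[of I],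
        simp add: I_def same_regs_def, erule (1) step, erule (1) stop)
  then show ?thesis by (rule runs_bound[OF _ loop_bound[OF cost_entry]]) simp_all
qed

lemma compare_correct:
  assumes "fst s ''k'' = k"
  shows "runs compare s (60 * (k + 1)) (\<lambda>s'. same_regs {''diff'', ''w''} s s' \<and> snd s' = snd s \<and>
     (fst s' ''diff'' = 0 \<longleftrightarrow> (\<forall>w\<in>{1..k}. snd s (fst s ''q'' + w) = snd s (fst s ''end'' + w))))"
    (is "runs _ _ _ ?Q")
proof -
  define I where "I i s' \<longleftrightarrow> i \<le> k \<and> same_regs {''diff'', ''w''} s s' \<and> snd s' = snd s \<and>
     (fst s' ''diff'' = 0 \<longleftrightarrow> (\<forall>w\<in>{1..i}. snd s (fst s ''q'' + w) = snd s (fst s ''end'' + w))) \<and>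
     fst s' ''w'' = Suc i" for i :: nat and s'
  have step: "i < k \<and> runs compare_entry s' (cost compare_entry) (I (Suc i))"
    if I: "I i s'" and h: "holds (Less (V ''w'') (Plus (V ''k'') (N 1))) s'" for i s'
  proof -
    have regs: "fst s' ''k'' = k" "fst s' ''q'' = fst s ''q''" "fst s' ''end'' = fst s ''end''" "fst s' ''w'' = Suc i"
      using I assms by (auto simp: I_def same_regs_def)
    then have i: "i < k" using h by simp
    define x where "x = snd s (fst s ''q'' + Suc i)"
    define y where "y = snd s (fst s ''end'' + Suc i)"
    \<comment> \<open>Both truncated differences are added, so the sum stays zero only for equal
      entries.\<close>
    define z where "z = fst s' ''diff'' + ((x - y) + (y - x))"
    have z: "z = 0 \<longleftrightarrow> fst s' ''diff'' = 0 \<and> x = y" by (auto simp: z_def)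
    have "effect compare_entry s' = ((fst s')(''diff'' := z, ''w'' := Suc (Suc i)), snd s')"
      using I regs by (simp add: compare_entry_def I_def x_def y_def z_def)
    moreover have "I (Suc i) ((fst s')(''diff'' := z, ''w'' := Suc (Suc i)), snd s')"
      unfolding I_def ball_atLeastAtMost_Suc x_def[symmetric] y_def[symmetric]
      using I i z by (simp add: I_def same_regs_def)
    ultimately have "I (Suc i) (effect compare_entry s')" by simp
    then show ?thesis using i by (intro conjI runs_straight) (simp_all add: compare_entry_def)
  qed
  have stop: "?Q s'" if I: "I i s'" and h: "\<not> holds (Less (V ''w'') (Plus (V ''k'') (N 1))) s'" for i s'
  proof -
    have "fst s' ''k'' = k" "fst s' ''w'' = Suc i" using I assms by (auto simp: I_def same_regs_def)
    then have "i = k" using I h by (simp add: I_def)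
    then show ?thesis using I by (simp add: I_def)
  qed
  have "runs compare s (cost (Seq (Assign ''diff'' (N 0)) (Assign ''w'' (N 1))) +
       (k * (acost (Less (V ''w'') (Plus (V ''k'') (N 1))) + 1 +
         cost compare_entry) + (acost (Less (V ''w'') (Plus (V ''k'') (N 1))) + 1))) ?Q"
    unfolding compare_def
    by (rule runs_Seq, rule runs_straight, simp, rule runs_While[of I],
        simp add: I_def same_regs_def, erule (1) step, erule (1) stop)
  then show ?thesis by (rule runs_bound[OF _ loop_bound[OF cost_compare_entry]]) simp_all
qed

lemma lookup_correct:
  assumes s: "fst s ''k'' = k" "fst s ''end'' = fst s ''base'' + m * k" and k: "0 < k"
  shows "runs lookup s (100 * (k + 1) * (m + 1)) (\<lambda>s'. same_regs {''diff'', ''w'', ''dup'', ''q''} s s' \<and> snd s' = snd s \<and>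
     (fst s' ''dup'' \<noteq> 0 \<longleftrightarrow>
       (\<exists>l<m. \<forall>w\<in>{1..k}. snd s (fst s ''base'' + l * k + w) = snd s (fst s ''end'' + w))))"
    (is "runs _ _ _ ?Q")
proof -
  define b where "b = fst s ''base''"
  define same where "same l \<longleftrightarrow> (\<forall>w\<in>{1..k}. snd s (b + l * k + w) = snd s (fst s ''end'' + w))" for l
  define I where "I i s' \<longleftrightarrow> i \<le> m \<and> same_regs {''diff'', ''w'', ''dup'', ''q''} s s' \<and> snd s' = snd s \<and>
     (fst s' ''dup'' \<noteq> 0 \<longleftrightarrow> (\<exists>l<i. same l)) \<and> fst s' ''q'' = b + i * k" for i :: nat and s'
  let ?rest = "Seq (Assign ''dup'' (Plus (V ''dup'') (Not (V ''diff''))))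
         (Assign ''q'' (Plus (V ''q'') (V ''k'')))"
  let ?B = "60 * (k + 1) + cost ?rest"
  have step: "i < m \<and> runs lookup_body s' ?B (I (Suc i))"
    if I: "I i s'" and h: "holds (Less (V ''q'') (V ''end'')) s'" for i s'
  proof
    have regs: "fst s' ''k'' = k" "fst s' ''q'' = b + i * k" "fst s' ''end'' = b + m * k" "snd s' = snd s"
      using I s by (auto simp: I_def same_regs_def b_def)
    then show i: "i < m" using h by simp
    have ex: "(\<exists>l<Suc i. P l) \<longleftrightarrow> (\<exists>l<i. P l) \<or> P i" for P by (auto simp: less_Suc_eq)
    show "runs lookup_body s' ?B (I (Suc i))"
      unfolding lookup_body_def
    proof (rule runs_Seq, rule runs_weaken[OF compare_correct[OF regs(1)] order_refl])
      fix s'' assume s'': "same_regs {''diff'', ''w''} s' s'' \<and> snd s'' = snd s' \<and>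
        (fst s'' ''diff'' = 0 \<longleftrightarrow> (\<forall>w\<in>{1..k}. snd s' (fst s' ''q'' + w) = snd s' (fst s' ''end'' + w)))"
      then have diff: "fst s'' ''diff'' = 0 \<longleftrightarrow> same i"
        using regs s by (simp add: same_def b_def)
      have fr: "fst s'' x = fst s' x" if "x \<noteq> ''diff''" "x \<noteq> ''w''" for x
        using s'' that by (simp add: same_regs_def)
      have "I (Suc i) (effect ?rest s'')"
        unfolding I_def ex
        using I i s'' regs diff by (auto simp: I_def fr same_regs_def)
      then show "runs ?rest s'' (cost ?rest) (I (Suc i))"
        by (intro runs_straight) simp_all
    qed
  qed
  have stop: "?Q s'" if I: "I i s'" and h: "\<not> holds (Less (V ''q'') (V ''end'')) s'" for i s'
  proof -
    have "fst s' ''q'' = b + i * k" "fst s' ''end'' = b + m * k"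
      using I s by (auto simp: I_def same_regs_def b_def)
    \<comment> \<open>With \<open>0 < k\<close>, comparing addresses amounts to comparing block
      numbers.\<close>
    then have "\<not> i < m" using h k by auto
    then have "i = m" using I by (simp add: I_def)
    then show ?thesis using I by (simp add: I_def same_def b_def)
  qed
  have "runs lookup s (cost (Seq (Assign ''dup'' (N 0)) (Assign ''q'' (V ''base''))) +
       (m * (acost (Less (V ''q'') (V ''end'')) + 1 + ?B) + (acost (Less (V ''q'') (V ''end'')) + 1))) ?Q"
    unfolding lookup_def
    by (rule runs_Seq, rule runs_straight, simp, rule runs_While[of I],
        simp add: I_def same_regs_def b_def, erule (1) step, erule (1) stop)
  moreover have "cost (Seq (Assign ''dup'' (N 0)) (Assign ''q'' (V ''base''))) +
       (m * (acost (Less (V ''q'') (V ''end'')) + 1 + ?B) + (acost (Less (V ''q'') (V ''end'')) + 1))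
      \<le> (100 * (k + 1)) * (m + 1)"
    by (rule loop_bound[OF order_refl]) (simp_all add: Not_def)
  ultimately show ?thesis by (rule runs_bound)
qed

end

section \<open>Exploring all reachable configurations\<close>

context pattern_search
begin

text \<open>Distinctness matters for time: it bounds the list by \<open>max_configs\<close>, and
  thereby both each lookup and the number of configurations explored.\<close>

definition represents :: "(nat \<Rightarrow> nat) list \<Rightarrow> state \<Rightarrow> bool" where
  "represents cs s \<longleftrightarrow> reads s \<and> fst s ''lim'' = lim \<and> fst s ''base'' = n + k \<and>
     fst s ''end'' = n + k + length cs * k \<and>
     (\<forall>l<length cs. \<forall>w\<in>{1..k}. snd s (n + k + l * k + w) = (cs ! l) w) \<and>
     distinct cs \<and> set cs \<subseteq> reachable \<and> (fst s ''out'' \<noteq> 0 \<longleftrightarrow> (\<exists>c\<in>set cs. complete c))"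

text \<open>Time of the nested levels up to constants. The factors 700, 800, 900 and 1000 in the
  lemmas below leave room for the loop overhead added at each level.\<close>

definition attempt_bound :: nat where "attempt_bound = (k + 1) * (max_configs + 1)"
definition p_loop_bound :: nat where "p_loop_bound = attempt_bound * (n + 2)"
definition v_loop_bound :: nat where "v_loop_bound = p_loop_bound * (k + 1)"
definition explore_bound :: nat where "explore_bound = v_loop_bound * (max_configs + 1)"

lemma bounds_pos: "1 \<le> attempt_bound" "1 \<le> p_loop_bound" "1 \<le> v_loop_bound" "1 \<le> explore_bound"
  by (simp_all add: attempt_bound_def p_loop_bound_def v_loop_bound_def explore_bound_def)

lemma represents_length: "represents cs s \<Longrightarrow> length cs \<le> max_configs"
  using card_mono[OF card_reachable(1), of "set cs"] card_reachable(2)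
  by (auto simp: represents_def distinct_card)

lemma block_le: "l < m \<Longrightarrow> l * k + k \<le> m * k"
  using mult_le_mono1[of "Suc l" m k] by simp

lemma represents_frame:
  assumes "represents cs s"
    and "\<And>x. x \<in> {''n'', ''k'', ''lim'', ''base'', ''end'', ''out''} \<Longrightarrow> fst s' x = fst s x"
    and "\<And>a. a \<le> fst s ''end'' \<Longrightarrow> snd s' a = snd s a"
  shows "represents cs s'"
proof -
  have e: "fst s ''end'' = n + k + length cs * k" using assms(1) by (simp add: represents_def)
  have "reads s'"
  proof (rule readsI)
    show "reads s" using assms(1) by (simp add: represents_def)
    show "fst s' x = fst s x" if "x \<in> {''n'', ''k''}" for x by (rule assms(2)) (use that in auto)
    show "snd s' a = snd s a" if "a \<le> n + k" for a by (rule assms(3)) (use that e in simp)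
  qed
  moreover have "snd s' (n + k + l * k + w) = (cs ! l) w" if "l < length cs" "w \<in> {1..k}" for l w
  proof -
    have "n + k + l * k + w \<le> fst s ''end''" using block_le[OF that(1)] that(2) e by simp
    then show ?thesis using assms(1,3) that by (simp add: represents_def)
  qed
  ultimately show ?thesis using assms(1) by (simp add: represents_def assms(2))
qed

lemma represents_append:
  assumes rep: "represents cs s" and d: "d \<in> reachable" "d \<notin> set cs"
    and mem: "\<And>w. w \<in> {1..k} \<Longrightarrow> snd s (fst s ''end'' + w) = d w"
    and s': "\<And>x. x \<in> {''n'', ''k'', ''lim'', ''base''} \<Longrightarrow> fst s' x = fst s x" "snd s' = snd s"
      "fst s' ''end'' = fst s ''end'' + k" "fst s' ''out'' \<noteq> 0 \<longleftrightarrow> fst s ''out'' \<noteq> 0 \<or> complete d"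
  shows "represents (cs @ [d]) s'"
proof -
  have "reads s'"
  proof (rule readsI)
    show "reads s" using rep by (simp add: represents_def)
    show "fst s' x = fst s x" if "x \<in> {''n'', ''k''}" for x by (rule s'(1)) (use that in auto)
  qed (simp add: s'(2))
  moreover have "snd s' (n + k + l * k + w) = ((cs @ [d]) ! l) w"
    if "l < length (cs @ [d])" "w \<in> {1..k}" for l w
  proof (cases "l < length cs")
    case True
    then show ?thesis using rep that by (simp add: represents_def nth_append s')
  next
    case False
    then have "l = length cs" using that by simp
    then show ?thesis using rep mem[OF that(2)] by (simp add: represents_def s')
  qed
  moreover have "fst s' ''lim'' = lim" "fst s' ''base'' = n + k"
    "fst s' ''end'' = n + k + length (cs @ [d]) * k"
    using rep by (simp_all add: represents_def s'(1,3))
  moreover have "distinct (cs @ [d])" "set (cs @ [d]) \<subseteq> reachable"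
    using rep d by (auto simp: represents_def)
  moreover have "fst s' ''out'' \<noteq> 0 \<longleftrightarrow> (\<exists>c\<in>set (cs @ [d]). complete c)"
    unfolding s'(4) using rep by (auto simp: represents_def)
  ultimately show ?thesis unfolding represents_def by blast
qed

text \<open>Configurations vanish outside \<open>{1..k}\<close>, so comparing blocks decides
  equality. The second alternative covers results of moves not known to be legal, as the lookup
  precedes the verdict.\<close>

lemma config_eq_iff:
  assumes "c \<in> reachable" "d \<in> reachable \<or> (\<exists>e v p. e \<in> reachable \<and> v \<in> {1..k} \<and> d = e(v := p))"
  shows "c = d \<longleftrightarrow> (\<forall>w\<in>{1..k}. c w = d w)"
proof -
  have z: "e w = 0" if "e \<in> reachable" "w \<notin> {1..k}" for e w
    using reachable_wf[OF that(1)] that(2) by (simp add: wf_config_def)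
  have "c w = d w" if w: "w \<notin> {1..k}" for w
  proof -
    have "d w = 0"
      using assms(2)
    proof (elim disjE exE conjE)
      fix e v p assume "e \<in> reachable" "v \<in> {1..k}" "d = e(v := p)"
      moreover have "w \<noteq> v" using \<open>v \<in> {1..k}\<close> w by blast
      ultimately show ?thesis using z[OF _ w, of e] by simp
    qed (rule z[OF _ w])
    then show ?thesis using z[OF assms(1) w] by simp
  qed
  then show ?thesis by (auto intro!: ext)
qed

lemma attempt_correct:
  assumes rep: "represents cs s" and k: "0 < k" and i: "i < length cs"
    and cur: "fst s ''cur'' = n + k + i * k"
    and vp: "fst s ''v'' = v" "fst s ''p'' = p" "v \<in> {1..k}" "p \<in> {1..Suc n}"
  shows "runs attempt s (700 * attempt_bound) (\<lambda>s'.
     same_regs {''ok'', ''cnt'', ''zero'', ''w'', ''diff'', ''dup'', ''q'', ''out'', ''end''} s s' \<and>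
     (\<exists>cs'. represents cs' s' \<and> (\<exists>ys. cs' = cs @ ys) \<and>
        (legal (cs ! i) v p \<longrightarrow> (cs ! i)(v := p) \<in> set cs')))" (is "runs _ _ _ ?Q")
proof -
  define c where "c = cs ! i"
  define d where "d = c(v := p)"
  have c: "c \<in> reachable" using rep i by (auto simp: represents_def c_def)
  have cle: "c w \<le> Suc n" for w using reachable_wf[OF c] by (simp add: wf_config_def)
  have R: "reads s" "fst s ''base'' = n + k" "fst s ''end'' = n + k + length cs * k" "fst s ''lim'' = lim"
    "fst s ''k'' = k"
    using rep by (auto simp: represents_def reads_def)
  have cm: "snd s (fst s ''cur'' + w) = c w" if "w \<in> {1..k}" for w
    using rep i that by (simp add: represents_def cur c_def)
  have curend: "n + k \<le> fst s ''cur''" "fst s ''cur'' + k \<le> fst s ''end''"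
    using block_le[OF i] by (simp_all add: cur R)
  have "runs attempt s (400 * (k + 1) + (100 * (k + 1) * (length cs + 1) + cost commit)) ?Q"
    unfolding attempt_def
  proof (rule runs_Seq, rule runs_weaken[OF build_correct[OF R(1) vp curend cm cle] order_refl], assumption)
    fix s1 assume s1: "same_regs {''ok'', ''cnt'', ''zero'', ''w''} s s1 \<and>
     (\<forall>a\<le>fst s ''end''. snd s1 a = snd s a) \<and>
     (\<forall>w\<in>{1..k}. snd s1 (fst s ''end'' + w) = (c(v := p)) w) \<and>
     (fst s1 ''ok'' \<noteq> 0 \<longleftrightarrow> (\<forall>w\<in>{1..k}. admits c v p w)) \<and>
     fst s1 ''cnt'' = card (active (c(v := p))) \<and>
     (fst s1 ''zero'' = 0 \<longleftrightarrow> complete (c(v := p)))"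
    then have r1: "fst s1 x = fst s x" if "x \<notin> {''ok'', ''cnt'', ''zero'', ''w''}" for x
      using that by (simp add: same_regs_def)
    have dm: "snd s1 (fst s ''end'' + w) = d w" if "w \<in> {1..k}" for w
      using s1 that unfolding d_def by blast
    have fin1: "fst s1 ''ok'' \<noteq> 0 \<longleftrightarrow> (\<forall>w\<in>{1..k}. admits c v p w)" "fst s1 ''cnt'' = card (active d)"
      "fst s1 ''zero'' = 0 \<longleftrightarrow> complete d" using s1 unfolding d_def by blast+
    have rep1: "represents cs s1"
    proof (rule represents_frame[OF rep])
      show "fst s1 x = fst s x" if "x \<in> {''n'', ''k'', ''lim'', ''base'', ''end'', ''out''}" for x
        by (rule r1) (use that in auto)
      show "snd s1 a = snd s a" if "a \<le> fst s ''end''" for a using s1 that by blast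
    qed
    have k1: "fst s1 ''k'' = k" "fst s1 ''end'' = fst s1 ''base'' + length cs * k" by (simp_all add: r1 R)
    have found: "(\<exists>l<length cs. \<forall>w\<in>{1..k}. snd s1 (fst s1 ''base'' + l * k + w) = snd s1 (fst s1 ''end'' + w))
       \<longleftrightarrow> d \<in> set cs"
    proof -
      have "(\<forall>w\<in>{1..k}. snd s1 (fst s1 ''base'' + l * k + w) = snd s1 (fst s1 ''end'' + w)) \<longleftrightarrow> cs ! l = d"
        if l: "l < length cs" for l
      proof -
        have "cs ! l \<in> reachable" using rep l by (auto simp: represents_def)
        then have "cs ! l = d \<longleftrightarrow> (\<forall>w\<in>{1..k}. (cs ! l) w = d w)"
          using c vp(3) by (intro config_eq_iff) (auto simp: d_def)
        moreover have "snd s1 (fst s1 ''base'' + l * k + w) = (cs ! l) w" if "w \<in> {1..k}" for w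
          using rep1 l that by (simp add: represents_def)
        moreover have "snd s1 (fst s1 ''end'' + w) = d w" if "w \<in> {1..k}" for w
          using dm[OF that] by (simp add: r1)
        ultimately show ?thesis by simp
      qed
      then show ?thesis by (auto simp: in_set_conv_nth)
    qed
    show "runs (Seq lookup commit) s1 (100 * (k + 1) * (length cs + 1) + cost commit) ?Q"
    proof (rule runs_Seq, rule runs_weaken[OF lookup_correct[OF k1 k] order_refl], rule runs_straight)
      fix s2 assume s2: "same_regs {''diff'', ''w'', ''dup'', ''q''} s1 s2 \<and> snd s2 = snd s1 \<and>
        (fst s2 ''dup'' \<noteq> 0 \<longleftrightarrow>
          (\<exists>l<length cs. \<forall>w\<in>{1..k}. snd s1 (fst s1 ''base'' + l * k + w) = snd s1 (fst s1 ''end'' + w)))"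
      then have r2: "fst s2 x = fst s1 x" if "x \<notin> {''diff'', ''w'', ''dup'', ''q''}" for x
        using that by (simp add: same_regs_def)
      have m2: "snd s2 = snd s1" using s2 by blast
      have dup: "fst s2 ''dup'' \<noteq> 0 \<longleftrightarrow> d \<in> set cs" using s2 unfolding found by blast
      have rep2: "represents cs s2"
      proof (rule represents_frame[OF rep1])
        show "fst s2 x = fst s1 x" if "x \<in> {''n'', ''k'', ''lim'', ''base'', ''end'', ''out''}" for x
          by (rule r2) (use that in auto)
      qed (simp add: m2)
      have regs12: "fst s2 x = fst s x"
        if "x \<notin> {''ok'', ''cnt'', ''zero'', ''w'', ''diff'', ''dup'', ''q'', ''out'', ''end''}" for x
        using that r1[of x] r2[of x] by simp
      have acc: "holds (And (V ''ok'') (And (Not (Less (V ''lim'') (V ''cnt''))) (Not (V ''dup'')))) s2 \<longleftrightarrow>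
          legal c v p \<and> d \<notin> set cs"
      proof -
        have "fst s2 ''lim'' = lim" "fst s2 ''ok'' = fst s1 ''ok''" "fst s2 ''cnt'' = card (active d)"
          using fin1(2) by (simp_all add: r1 r2 R)
        moreover have "legal c v p \<longleftrightarrow> (\<forall>w\<in>{1..k}. admits c v p w) \<and> \<not> lim < card (active d)"
          by (auto simp: legal_def d_def)
        ultimately show ?thesis unfolding fin1(1)[symmetric] dup[symmetric] by auto
      qed
      show "?Q (effect commit s2)"
      proof (cases "legal c v p \<and> d \<notin> set cs")
        case True
        then have dr: "d \<in> reachable" unfolding d_def using c vp by (intro reachable.move) auto
        let ?s3 = "((fst s2)(''out'' := (if fst s2 ''zero'' = 0 then 1 else fst s2 ''out''),
            ''end'' := fst s2 ''end'' + k), snd s2)"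
        have eff: "effect commit s2 = ?s3"
          using acc True regs12[of "''k''"] R(5) by (simp add: commit_def del: aval_And)
        have rep3: "represents (cs @ [d]) ?s3"
          by (rule represents_append[OF rep2 dr])
            (use True dm fin1(3) in \<open>auto simp: r1 r2 m2\<close>)
        have "same_regs {''ok'', ''cnt'', ''zero'', ''w'', ''diff'', ''dup'', ''q'', ''out'', ''end''} s ?s3"
          using regs12 by (simp add: same_regs_def)
        then show ?thesis
          unfolding eff using rep3
          by (intro conjI exI[of _ "cs @ [d]"] exI[of _ "[d]"]) (simp_all add: c_def d_def)
      next
        case False
        with acc have "\<not> holds (And (V ''ok'') (And (Not (Less (V ''lim'') (V ''cnt''))) (Not (V ''dup'')))) s2"
          by blast
        then have eff: "effect commit s2 = s2" by (simp add: commit_def del: aval_And)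
        have "same_regs {''ok'', ''cnt'', ''zero'', ''w'', ''diff'', ''dup'', ''q'', ''out'', ''end''} s s2"
          using regs12 by (simp add: same_regs_def)
        then show ?thesis
          unfolding eff using rep2 False
          by (intro conjI exI[of _ cs] exI[of _ "[]"]) (auto simp: c_def d_def)
      qed
    qed (simp add: commit_def)
  qed
  moreover have "400 * (k + 1) + (100 * (k + 1) * (length cs + 1) + cost commit) \<le> 700 * attempt_bound"
  proof -
    define x where "x = (k + 1) * (length cs + 1)"
    have "cost commit \<le> 100" by code_simp
    moreover have "x \<le> attempt_bound"
      unfolding attempt_bound_def x_def using represents_length[OF rep] by (intro mult_le_mono2) simp
    moreover have "k + 1 \<le> attempt_bound" by (simp add: attempt_bound_def)
    ultimately have "400 * (k + 1) + (100 * x + cost commit) \<le>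
        400 * attempt_bound + (100 * attempt_bound + 100 * attempt_bound)"
      using bounds_pos(1) by (intro add_mono mult_le_mono2) auto
    also have "\<dots> \<le> 700 * attempt_bound" by simp
    finally have "400 * (k + 1) + (100 * x + cost commit) \<le> 700 * attempt_bound" .
    then show ?thesis by (simp only: x_def mult.assoc)
  qed
  ultimately show ?thesis by (rule runs_bound)
qed

text \<open>\<open>X\<close> collects the moves already tried from configuration \<open>i\<close>.
  The list only grows at its end, so the entry \<open>cs ! i\<close> and the earlier results remain
  valid.\<close>

definition progress :: "(nat \<Rightarrow> nat) list \<Rightarrow> nat \<Rightarrow> (nat \<times> nat) set \<Rightarrow> state \<Rightarrow> state \<Rightarrow> bool" where
  "progress cs i X s0 s \<longleftrightarrow>
     same_regs {''ok'', ''cnt'', ''zero'', ''w'', ''diff'', ''dup'', ''q'', ''out'', ''end'', ''v'', ''p''} s0 s \<and>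
     (\<exists>ys. represents (cs @ ys) s \<and>
        (\<forall>(v, p)\<in>X. legal (cs ! i) v p \<longrightarrow> (cs ! i)(v := p) \<in> set (cs @ ys)))"

lemma progress_update:
  assumes "progress cs i X s0 s" "x \<in> {''v'', ''p''}"
  shows "progress cs i X s0 ((fst s)(x := a), snd s)"
proof -
  have "represents ds ((fst s)(x := a), snd s)" if "represents ds s" for ds
    by (rule represents_frame[OF that]) (use assms(2) in auto)
  then show ?thesis using assms unfolding progress_def by (auto simp: same_regs_def)
qed

lemma attempt_progress:
  assumes prog: "progress cs i X s0 s" and k: "0 < k" and i: "i < length cs"
    and cur: "fst s0 ''cur'' = n + k + i * k"
    and vp: "fst s ''v'' = v" "fst s ''p'' = p" "v \<in> {1..k}" "p \<in> {1..Suc n}"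
  shows "runs attempt s (700 * attempt_bound)
     (\<lambda>s'. progress cs i (insert (v, p) X) s0 s' \<and> fst s' ''v'' = v \<and> fst s' ''p'' = p)"
proof -
  obtain ys where ys: "represents (cs @ ys) s"
      "\<forall>(v, p)\<in>X. legal (cs ! i) v p \<longrightarrow> (cs ! i)(v := p) \<in> set (cs @ ys)"
    using prog unfolding progress_def by blast
  have regs: "fst s x = fst s0 x"
    if "x \<notin> {''ok'', ''cnt'', ''zero'', ''w'', ''diff'', ''dup'', ''q'', ''out'', ''end'', ''v'', ''p''}" for x
  proof -
    have "same_regs {''ok'', ''cnt'', ''zero'', ''w'', ''diff'', ''dup'', ''q'', ''out'', ''end'', ''v'', ''p''} s0 s"
      using prog by (simp add: progress_def)
    then show ?thesis using that unfolding same_regs_def by simp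
  qed
  have nth: "(cs @ ys) ! i = cs ! i" using i by (simp add: nth_append)
  have len: "i < length (cs @ ys)" using i by simp
  have cur': "fst s ''cur'' = n + k + i * k" using cur regs[of "''cur''"] by simp
  show ?thesis
  proof (rule runs_weaken[OF attempt_correct[OF ys(1) k len cur' vp] order_refl], elim conjE exE)
    fix s' cs' zs
    assume s': "same_regs {''ok'', ''cnt'', ''zero'', ''w'', ''diff'', ''dup'', ''q'', ''out'', ''end''} s s'"
      and cs': "represents cs' s'" "cs' = (cs @ ys) @ zs"
        "legal ((cs @ ys) ! i) v p \<longrightarrow> ((cs @ ys) ! i)(v := p) \<in> set cs'"
    have "represents (cs @ (ys @ zs)) s'" using cs' by simp
    moreover have "\<forall>(v, p)\<in>insert (v, p) X. legal (cs ! i) v p \<longrightarrow> (cs ! i)(v := p) \<in> set (cs @ (ys @ zs))"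
      using ys(2) cs'(2,3) unfolding nth by auto
    moreover have "same_regs {''ok'', ''cnt'', ''zero'', ''w'', ''diff'', ''dup'', ''q'', ''out'', ''end'', ''v'', ''p''} s0 s'"
      using s' regs by (simp add: same_regs_def)
    ultimately have "progress cs i (insert (v, p) X) s0 s'"
      unfolding progress_def by (intro conjI exI[of _ "ys @ zs"])
    then show "progress cs i (insert (v, p) X) s0 s' \<and> fst s' ''v'' = v \<and> fst s' ''p'' = p"
      using s' vp(1,2) by (simp add: same_regs_def)
  qed
qed

lemma progress_reads: "progress cs i X s0 s \<Longrightarrow> fst s ''n'' = n \<and> fst s ''k'' = k"
  by (auto simp: progress_def represents_def reads_def)

lemma p_loop_progress:
  assumes prog: "progress cs i X s0 s" and k: "0 < k" and i: "i < length cs"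
    and cur: "fst s0 ''cur'' = n + k + i * k" and v: "fst s ''v'' = v" "v \<in> {1..k}"
  shows "runs p_loop s (800 * p_loop_bound)
     (\<lambda>s'. progress cs i (X \<union> {v} \<times> {1..Suc n}) s0 s' \<and> fst s' ''v'' = v)"
    (is "runs _ _ _ ?Q")
proof -
  define I where "I j s' \<longleftrightarrow> j \<le> Suc n \<and> progress cs i (X \<union> {v} \<times> {1..j}) s0 s' \<and> fst s' ''v'' = v \<and>
     fst s' ''p'' = Suc j" for j s'
  let ?A = "700 * attempt_bound"
  let ?e = "Less (V ''p'') (Plus (V ''n'') (N 2))"
  let ?inc = "Assign ''p'' (Plus (V ''p'') (N 1))"
  have step: "j < Suc n \<and> runs (Seq attempt ?inc) s' (?A + cost ?inc) (I (Suc j))"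
    if I: "I j s'" and h: "holds ?e s'" for j s'
  proof
    have regs: "fst s' ''n'' = n" "fst s' ''v'' = v" "fst s' ''p'' = Suc j" and
      prog': "progress cs i (X \<union> {v} \<times> {1..j}) s0 s'"
      using I progress_reads[of cs i _ s0 s'] by (auto simp: I_def)
    then show j: "j < Suc n" using h by simp
    have set: "insert (v, Suc j) (X \<union> {v} \<times> {1..j}) = X \<union> {v} \<times> {1..Suc j}"
      by (auto simp: le_Suc_eq)
    show "runs (Seq attempt ?inc) s' (?A + cost ?inc) (I (Suc j))"
    proof (rule runs_Seq, rule runs_weaken[OF attempt_progress[OF prog' k i cur regs(2,3) v(2)] order_refl],
        use j in simp, rule runs_straight, simp)
      fix s'' assume s'': "progress cs i (insert (v, Suc j) (X \<union> {v} \<times> {1..j})) s0 s'' \<and>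
        fst s'' ''v'' = v \<and> fst s'' ''p'' = Suc j"
      have "effect ?inc s'' = ((fst s'')(''p'' := Suc (Suc j)), snd s'')" using s'' by simp
      moreover have "progress cs i (X \<union> {v} \<times> {1..Suc j}) s0 ((fst s'')(''p'' := Suc (Suc j)), snd s'')"
        using s'' unfolding set by (intro progress_update) auto
      ultimately show "I (Suc j) (effect ?inc s'')" using s'' j by (simp add: I_def)
    qed
  qed
  have stop: "?Q s'" if I: "I j s'" and h: "\<not> holds ?e s'" for j s'
  proof -
    have "fst s' ''n'' = n" "fst s' ''p'' = Suc j" using I progress_reads[of cs i _ s0 s'] by (auto simp: I_def)
    then have "j = Suc n" using I h by (simp add: I_def)
    then show ?thesis using I by (simp add: I_def)
  qed
  have init: "I 0 (effect (Assign ''p'' (N 1)) s)"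
    using prog v progress_update[OF prog, of "''p''" 1] by (simp add: I_def)
  have "runs p_loop s (cost (Assign ''p'' (N 1)) + (Suc n * (acost ?e + 1 + (?A + cost ?inc)) + (acost ?e + 1))) ?Q"
    unfolding p_loop_def
    by (rule runs_Seq, rule runs_straight, simp, rule runs_While[of I, OF init], erule (1) step, erule (1) stop)
  moreover have "cost (Assign ''p'' (N 1)) + (Suc n * (acost ?e + 1 + (?A + cost ?inc)) + (acost ?e + 1))
      \<le> (800 * attempt_bound) * (Suc n + 1)"
  proof (rule loop_bound[OF order_refl])
    show "acost ?e + 1 + (?A + cost ?inc) \<le> 800 * attempt_bound"
      "cost (Assign ''p'' (N 1)) + (acost ?e + 1) \<le> 800 * attempt_bound"
      using bounds_pos by simp_all
  qed
  ultimately show ?thesis by (rule runs_bound[OF runs_bound]) (simp add: p_loop_bound_def)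
qed

lemma v_loop_progress:
  assumes prog: "progress cs i {} s0 s" and k: "0 < k" and i: "i < length cs"
    and cur: "fst s0 ''cur'' = n + k + i * k"
  shows "runs v_loop s (900 * v_loop_bound)
     (progress cs i ({1..k} \<times> {1..Suc n}) s0)"
    (is "runs _ _ _ ?Q")
proof -
  define I where "I j s' \<longleftrightarrow> j \<le> k \<and> progress cs i ({1..j} \<times> {1..Suc n}) s0 s' \<and>
     fst s' ''v'' = Suc j" for j s'
  let ?A = "800 * p_loop_bound"
  let ?e = "Less (V ''v'') (Plus (V ''k'') (N 1))"
  let ?inc = "Assign ''v'' (Plus (V ''v'') (N 1))"
  have step: "j < k \<and> runs (Seq p_loop ?inc) s' (?A + cost ?inc) (I (Suc j))"
    if I: "I j s'" and h: "holds ?e s'" for j s'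
  proof
    have regs: "fst s' ''k'' = k" "fst s' ''v'' = Suc j" and
      prog': "progress cs i ({1..j} \<times> {1..Suc n}) s0 s'"
      using I progress_reads[of cs i _ s0 s'] by (auto simp: I_def)
    then show j: "j < k" using h by simp
    have set: "{1..j} \<times> {1..Suc n} \<union> {Suc j} \<times> {1..Suc n} = {1..Suc j} \<times> {1..Suc n}"
      by (auto simp: le_Suc_eq)
    show "runs (Seq p_loop ?inc) s' (?A + cost ?inc) (I (Suc j))"
    proof (rule runs_Seq, rule runs_weaken[OF p_loop_progress[OF prog' k i cur regs(2)] order_refl],
        use j in simp, rule runs_straight, simp)
      fix s'' assume s'': "progress cs i ({1..j} \<times> {1..Suc n} \<union> {Suc j} \<times> {1..Suc n}) s0 s'' \<and>
        fst s'' ''v'' = Suc j"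
      have "effect ?inc s'' = ((fst s'')(''v'' := Suc (Suc j)), snd s'')" using s'' by simp
      moreover have "progress cs i ({1..Suc j} \<times> {1..Suc n}) s0 ((fst s'')(''v'' := Suc (Suc j)), snd s'')"
        using s'' unfolding set by (intro progress_update) auto
      ultimately show "I (Suc j) (effect ?inc s'')" using j by (simp add: I_def)
    qed
  qed
  have stop: "?Q s'" if I: "I j s'" and h: "\<not> holds ?e s'" for j s'
  proof -
    have "fst s' ''k'' = k" "fst s' ''v'' = Suc j" using I progress_reads[of cs i _ s0 s'] by (auto simp: I_def)
    then have "j = k" using I h by (simp add: I_def)
    then show ?thesis using I by (simp add: I_def)
  qed
  have init: "I 0 (effect (Assign ''v'' (N 1)) s)"
    using prog progress_update[OF prog, of "''v''" 1] by (simp add: I_def)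
  have "runs v_loop s (cost (Assign ''v'' (N 1)) + (k * (acost ?e + 1 + (?A + cost ?inc)) + (acost ?e + 1))) ?Q"
    unfolding v_loop_def
    by (rule runs_Seq, rule runs_straight, simp, rule runs_While[of I, OF init], erule (1) step, erule (1) stop)
  moreover have "cost (Assign ''v'' (N 1)) + (k * (acost ?e + 1 + (?A + cost ?inc)) + (acost ?e + 1))
      \<le> (900 * p_loop_bound) * (k + 1)"
  proof (rule loop_bound[OF order_refl])
    show "acost ?e + 1 + (?A + cost ?inc) \<le> 900 * p_loop_bound"
      "cost (Assign ''v'' (N 1)) + (acost ?e + 1) \<le> 900 * p_loop_bound"
      using bounds_pos by simp_all
  qed
  ultimately show ?thesis by (rule runs_bound[OF runs_bound]) (simp add: v_loop_bound_def)
qed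

lemma closed_imp_reachable:
  assumes "(\<lambda>_. 0) \<in> S"
    and "\<And>c v p. c \<in> S \<Longrightarrow> v \<in> {1..k} \<Longrightarrow> p \<in> {1..Suc n} \<Longrightarrow> legal c v p \<Longrightarrow> c(v := p) \<in> S"
  shows "reachable \<subseteq> S"
proof
  fix c assume "c \<in> reachable"
  then show "c \<in> S"
  proof induction
    case (move c v p)
    from assms(2)[OF move.IH move.hyps(2-4)] show ?case .
  qed (rule assms(1))
qed

text \<open>The moves of the first \<open>i\<close> configurations have all been followed. When
  \<open>i\<close> reaches the length, the list is closed under legal moves, so it comprises
  everything reachable, and \<open>out\<close> reflects whether some configuration is
  complete.\<close>

lemma explore_correct:
  assumes rep: "represents [\<lambda>_. 0] s" and k: "0 < k" and cur: "fst s ''cur'' = n + k"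
  shows "runs explore s (1000 * explore_bound)
     (\<lambda>s'. fst s' ''out'' \<noteq> 0 \<longleftrightarrow> (\<exists>c\<in>reachable. complete c))" (is "runs _ _ _ ?Q")
proof -
  define I where "I i s' \<longleftrightarrow> (\<exists>cs. represents cs s' \<and> (\<lambda>_. 0) \<in> set cs \<and> fst s' ''cur'' = n + k + i * k \<and>
     i \<le> length cs \<and> (\<forall>l<i. \<forall>(v, p)\<in>{1..k} \<times> {1..Suc n}. legal (cs ! l) v p \<longrightarrow> (cs ! l)(v := p) \<in> set cs))"
    for i s'
  let ?A = "900 * v_loop_bound"
  let ?e = "Less (V ''cur'') (V ''end'')"
  let ?inc = "Assign ''cur'' (Plus (V ''cur'') (V ''k''))"
  have step: "i < max_configs \<and> runs (Seq v_loop ?inc) s' (?A + cost ?inc) (I (Suc i))"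
    if I: "I i s'" and h: "holds ?e s'" for i s'
  proof -
    obtain cs where cs: "represents cs s'" "(\<lambda>_. 0) \<in> set cs" "fst s' ''cur'' = n + k + i * k"
       "\<forall>l<i. \<forall>(v, p)\<in>{1..k} \<times> {1..Suc n}. legal (cs ! l) v p \<longrightarrow> (cs ! l)(v := p) \<in> set cs"
      using I unfolding I_def by blast
    have "fst s' ''end'' = n + k + length cs * k" using cs(1) by (simp add: represents_def)
    then have i: "i < length cs" using h cs(3) by simp
    have prog: "progress cs i {} s' s'" using cs(1) by (auto simp: progress_def intro: exI[of _ "[]"])
    have "runs (Seq v_loop ?inc) s' (?A + cost ?inc) (I (Suc i))"
    proof (rule runs_Seq, rule runs_weaken[OF v_loop_progress[OF prog k i cs(3)] order_refl],
        rule runs_straight, simp)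
      fix s'' assume s'': "progress cs i ({1..k} \<times> {1..Suc n}) s' s''"
      then obtain ys where ys: "represents (cs @ ys) s''"
        "\<forall>(v, p)\<in>{1..k} \<times> {1..Suc n}. legal (cs ! i) v p \<longrightarrow> (cs ! i)(v := p) \<in> set (cs @ ys)"
        unfolding progress_def by blast
      have cur'': "fst s'' ''cur'' = n + k + i * k" "fst s'' ''k'' = k"
        using s'' cs(3) progress_reads[OF s''] by (auto simp: progress_def same_regs_def)
      have "represents (cs @ ys) (effect ?inc s'')"
        by (rule represents_frame[OF ys(1)]) auto
      moreover have "\<forall>l<Suc i. \<forall>(v, p)\<in>{1..k} \<times> {1..Suc n}.
          legal ((cs @ ys) ! l) v p \<longrightarrow> ((cs @ ys) ! l)(v := p) \<in> set (cs @ ys)"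
      proof (intro allI impI)
        fix l assume "l < Suc i"
        then consider "l < i" | "l = i" by linarith
        then show "\<forall>(v, p)\<in>{1..k} \<times> {1..Suc n}.
            legal ((cs @ ys) ! l) v p \<longrightarrow> ((cs @ ys) ! l)(v := p) \<in> set (cs @ ys)"
        proof cases
          case 1
          then have "(cs @ ys) ! l = cs ! l" using i by (simp add: nth_append)
          then show ?thesis using cs(4) 1 by fastforce
        next
          case 2
          then have "(cs @ ys) ! l = cs ! i" using i by (simp add: nth_append)
          then show ?thesis using ys(2) by simp
        qed
      qed
      ultimately show "I (Suc i) (effect ?inc s'')"
        unfolding I_def using cs(2) cur'' i by (intro exI[of _ "cs @ ys"]) auto
    qed
    then show ?thesis using i represents_length[OF cs(1)] by simp
  qed
  have stop: "?Q s'" if I: "I i s'" and h: "\<not> holds ?e s'" for i s'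
  proof -
    obtain cs where cs: "represents cs s'" "(\<lambda>_. 0) \<in> set cs" "fst s' ''cur'' = n + k + i * k" "i \<le> length cs"
       "\<forall>l<i. \<forall>(v, p)\<in>{1..k} \<times> {1..Suc n}. legal (cs ! l) v p \<longrightarrow> (cs ! l)(v := p) \<in> set cs"
      using I unfolding I_def by blast
    have "fst s' ''end'' = n + k + length cs * k" using cs(1) by (simp add: represents_def)
    then have "\<not> i < length cs" using h cs(3) k by auto
    then have i: "i = length cs" using cs(4) by simp
    have "reachable \<subseteq> set cs"
    proof (rule closed_imp_reachable[OF cs(2)])
      fix c v p assume "c \<in> set cs" and vp: "v \<in> {1..k}" "p \<in> {1..Suc n}" "legal c v p"
      then obtain l where l: "l < i" "c = cs ! l" using i by (auto simp: in_set_conv_nth)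
      then have "\<forall>(v, p)\<in>{1..k} \<times> {1..Suc n}. legal c v p \<longrightarrow> c(v := p) \<in> set cs" using cs(5) by blast
      then show "c(v := p) \<in> set cs" using vp by blast
    qed
    then have "set cs = reachable" using cs(1) by (auto simp: represents_def)
    then show ?thesis using cs(1) by (simp add: represents_def)
  qed
  have init: "I 0 s" using rep cur by (auto simp: I_def intro!: exI[of _ "[\<lambda>_. 0]"])
  have "runs explore s (max_configs * (acost ?e + 1 + (?A + cost ?inc)) + (acost ?e + 1)) ?Q"
    unfolding explore_def by (rule runs_While[of I, OF init], erule (1) step, erule (1) stop)
  moreover have "0 + (max_configs * (acost ?e + 1 + (?A + cost ?inc)) + (acost ?e + 1))
      \<le> (1000 * v_loop_bound) * (max_configs + 1)"
  proof (rule loop_bound[OF order_refl])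
    show "acost ?e + 1 + (?A + cost ?inc) \<le> 1000 * v_loop_bound"
      "0 + (acost ?e + 1) \<le> 1000 * v_loop_bound"
      using bounds_pos by simp_all
  qed
  then have "max_configs * (acost ?e + 1 + (?A + cost ?inc)) + (acost ?e + 1) \<le> 1000 * explore_bound"
    by (simp only: add_0 explore_bound_def mult.assoc)
  ultimately show ?thesis by (rule runs_bound)
qed

lemma represents_init:
  assumes "reads s" "fst s ''lim'' = lim" "fst s ''base'' = n + k" "fst s ''end'' = n + k + k"
    "fst s ''out'' = 0" "0 < k" "\<And>a. n + k < a \<Longrightarrow> snd s a = 0"
  shows "represents [\<lambda>_. 0] s"
proof -
  have "snd s (n + k + l * k + w) = ([\<lambda>_. 0] ! l) w" if "l < length [\<lambda>_. 0 :: nat]" "w \<in> {1..k}" for l w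
    using that assms(7) by simp
  moreover have "\<not> complete (\<lambda>_. 0)" using assms(6) by (auto simp: complete_def intro!: bexI[of _ 1])
  ultimately show ?thesis using assms(1-5) reachable.start by (simp add: represents_def)
qed

end

section \<open>The limit and the final time bound\<close>

definition ceil_root :: "nat \<Rightarrow> nat" where
  "ceil_root k = (LEAST r. k \<le> r * r)"

lemma ceil_root: "sqrt k \<le> ceil_root k" "ceil_root k \<le> sqrt k + 1"
proof -
  define r where "r = nat \<lceil>sqrt k\<rceil>"
  have "sqrt k \<le> real r" by (simp add: r_def)
  then have "sqrt k * sqrt k \<le> real r * real r" by (intro mult_mono) auto
  then have "real k \<le> real (r * r)" by simp
  then have r: "k \<le> r * r" by (simp only: of_nat_le_iff)
  have "ceil_root k \<le> r" unfolding ceil_root_def by (rule Least_le) (rule r)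
  moreover have "0 \<le> sqrt k" by simp
  then have "real r \<le> sqrt k + 1" unfolding r_def by linarith
  ultimately show "ceil_root k \<le> sqrt k + 1" by linarith
  have "k \<le> ceil_root k * ceil_root k" unfolding ceil_root_def by (rule LeastI[of _ r]) (rule r)
  then have "real k \<le> real (ceil_root k * ceil_root k)" by (simp only: of_nat_le_iff)
  then have "real k \<le> (real (ceil_root k))\<^sup>2" by (simp add: power2_eq_square)
  then show "sqrt k \<le> ceil_root k" by (simp add: real_le_lsqrt)
qed

lemma compute_lim_correct:
  assumes "fst s ''k'' = k" "fst s ''q'' = 0" "fst s ''r'' = 0" "fst s ''lim'' = 0"
  shows "runs compute_lim s (50 * (k + 1)) (\<lambda>s'. same_regs {''q'', ''r'', ''lim''} s s' \<and>
     snd s' = snd s \<and> fst s' ''lim'' = 253 * ceil_root k)" (is "runs _ _ _ ?Q")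
proof -
  define I where "I i s' \<longleftrightarrow> same_regs {''q'', ''r'', ''lim''} s s' \<and> snd s' = snd s \<and>
     fst s' ''q'' = i * i \<and> fst s' ''r'' = i \<and> fst s' ''lim'' = 253 * i \<and> (\<forall>j<i. j * j < k)"
    for i s'
  let ?e = "Less (V ''q'') (V ''k'')"
  let ?body = "Seq (Assign ''q'' (Plus (V ''q'') (Plus (V ''r'') (Plus (V ''r'') (N 1)))))
     (Seq (Assign ''r'' (Plus (V ''r'') (N 1))) (Assign ''lim'' (Plus (V ''lim'') (N 253))))"
  have step: "i < k \<and> runs ?body s' (cost ?body) (I (Suc i))" if I: "I i s'" and h: "holds ?e s'" for i s'
  proof -
    have "fst s' ''k'' = k" using I assms(1) by (simp add: I_def same_regs_def)
    then have ik: "i * i < k" using I h by (simp add: I_def)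
    then have "i < k" by (metis le_square le_less_trans)
    moreover have "I (Suc i) (effect ?body s')"
      using I ik by (simp add: I_def same_regs_def less_Suc_eq all_conj_distrib imp_conjL)
    ultimately show ?thesis by (intro conjI runs_straight) simp_all
  qed
  have stop: "?Q s'" if I: "I i s'" and h: "\<not> holds ?e s'" for i s'
  proof -
    have "fst s' ''k'' = k" using I assms(1) by (simp add: I_def same_regs_def)
    then have "k \<le> i * i" using I h by (simp add: I_def)
    moreover have "i \<le> j" if "k \<le> j * j" for j
      using I that unfolding I_def by (meson not_le)
    ultimately have "ceil_root k = i" unfolding ceil_root_def by (intro Least_equality)
    then show ?thesis using I by (simp add: I_def)
  qed
  have init: "I 0 s" using assms by (simp add: I_def)
  have "runs compute_lim s (k * (acost ?e + 1 + cost ?body) + (acost ?e + 1)) ?Q"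
    unfolding compute_lim_def by (rule runs_While[of I, OF init], erule (1) step, erule (1) stop)
  moreover have "0 + (k * (acost ?e + 1 + cost ?body) + (acost ?e + 1)) \<le> 50 * (k + 1)"
    by (rule loop_bound[OF order_refl]) simp_all
  then have "k * (acost ?e + 1 + cost ?body) + (acost ?e + 1) \<le> 50 * (k + 1)" by (simp only: add_0)
  ultimately show ?thesis by (rule runs_bound)
qed

lemma search_correct:
  assumes "pattern_search n t k \<pi>" "0 < k"
  defines "L \<equiv> 253 * ceil_root k"
  shows "runs search (input_state n t k \<pi>)
     (50 * (k + 1) + (20 + 1000 * pattern_search.explore_bound n k L))
     (\<lambda>s'. fst s' ''out'' \<noteq> 0 \<longleftrightarrow>
        (\<exists>c\<in>pattern_search.reachable n t k \<pi> L. pattern_search.complete k c))"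
    (is "runs _ _ _ ?Q")
proof -
  interpret pattern_search n t k \<pi> L by (rule assms(1))
  let ?s = "input_state n t k \<pi>"
  let ?init = "Seq (Assign ''base'' (Plus (V ''n'') (V ''k'')))
         (Seq (Assign ''cur'' (V ''base'')) (Assign ''end'' (Plus (V ''base'') (V ''k''))))"
  have s: "fst ?s ''n'' = n" "fst ?s ''k'' = k" "\<And>x. x \<notin> {''n'', ''k''} \<Longrightarrow> fst ?s x = 0"
    "\<And>a. n + k < a \<Longrightarrow> snd ?s a = 0" "reads ?s"
    by (auto simp: input_state_def reads_def)
  show ?thesis
    unfolding search_def
  proof (rule runs_Seq, rule runs_weaken[OF compute_lim_correct order_refl])
    fix s1 assume s1: "same_regs {''q'', ''r'', ''lim''} ?s s1 \<and> snd s1 = snd ?s \<and> fst s1 ''lim'' = 253 * ceil_root k"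
    then have r1: "fst s1 x = fst ?s x" if "x \<notin> {''q'', ''r'', ''lim''}" for x
      using that by (simp add: same_regs_def)
    let ?s2 = "((fst s1)(''base'' := n + k, ''cur'' := n + k, ''end'' := n + k + k), snd s1)"
    have e: "effect ?init s1 = ?s2" by (simp add: r1 s)
    have m1: "snd s1 = snd ?s" and l1: "fst s1 ''lim'' = L" using s1 by (simp_all add: L_def)
    have "reads ?s2"
    proof (rule readsI[OF s(5)])
      show "fst ?s2 x = fst ?s x" if "x \<in> {''n'', ''k''}" for x using that r1[of x] by auto
    qed (simp add: m1)
    then have rep: "represents [\<lambda>_. 0] ?s2"
      by (rule represents_init) (simp_all add: r1 s l1 m1 assms(2))
    have "runs (Seq ?init explore) s1 (cost ?init + 1000 * explore_bound) ?Q"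
    proof (rule runs_Seq, rule runs_straight)
      show "runs explore (effect ?init s1) (1000 * explore_bound) ?Q"
        unfolding e by (rule explore_correct[OF rep assms(2)]) simp
    qed simp
    then show "runs (Seq ?init explore) s1 (20 + 1000 * explore_bound) ?Q"
      by (rule runs_bound) simp
  qed (simp_all add: s)
qed

lemma pattern_search_correct:
  assumes "pattern_search n t k \<pi>" and jordan: "jordan_permutation k \<pi>" and "0 < k"
  defines "L \<equiv> 253 * ceil_root k"
  shows "(\<exists>c\<in>pattern_search.reachable n t k \<pi> L. pattern_search.complete k c) \<longleftrightarrow> contains_pattern n t k \<pi>"
proof -
  interpret pattern_search n t k \<pi> L by (rule assms(1))
  interpret symmetric_graph "pattern_adj \<pi>" by (rule symmetric_pattern_adj)
  obtain xs where xs: "layout {1..k} (7 * (real 6)\<^sup>2 * sqrt (card {1..k})) xs"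
    using clique_minor_free_layout[OF _ jordan_no_clique_minor[OF jordan]] by auto
  have "Suc (card (boundary (pattern_adj \<pi>) {1..k} (set (take m xs)))) \<le> L" for m
  proof -
    have "real (card (boundary (pattern_adj \<pi>) {1..k} (set (take m xs)))) \<le> 252 * sqrt k"
      using xs by (simp add: layout_def)
    moreover have "sqrt k \<le> ceil_root k" by (rule ceil_root)
    \<comment> \<open>The additional vertex is absorbed by
      \<open>252 * sqrt k + 1 \<le> 253 * sqrt k\<close>.\<close>
    moreover have "1 \<le> sqrt k" using assms(3) by simp
    ultimately have "real (card (boundary (pattern_adj \<pi>) {1..k} (set (take m xs)))) + 1 \<le> 253 * real (ceil_root k)"
      by linarith
    then have "real (Suc (card (boundary (pattern_adj \<pi>) {1..k} (set (take m xs))))) \<le> real L"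
      unfolding L_def by simp
    then show ?thesis by (simp only: of_nat_le_iff)
  qed
  then show ?thesis
    using complete_imp_contains contains_imp_complete[of xs] xs by (auto simp: layout_def)
qed

text \<open>With \<open>2 \<le> n\<close>, constants become powers of \<open>n\<close>. The factors
  are bounded with exponents \<open>2\<close>, \<open>3 + 6 * L\<close>, \<open>2\<close>,
  \<open>2\<close> and \<open>3 + 6 * L\<close>; the two large ones stem from the lookups and from
  the exploration.\<close>

lemma explore_bound_le:
  assumes "pattern_search n t k \<pi>" "k \<le> n" "2 \<le> n"
  shows "pattern_search.explore_bound n k L \<le> n ^ (12 + 12 * L)"
proof -
  interpret pattern_search n t k \<pi> L by (rule assms(1))
  have "2 * n \<le> n ^ 2" using mult_le_mono1[OF assms(3), of n] by (simp add: power2_eq_square)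
  then have n2: "n + 2 \<le> n ^ 2" and k2: "k + 1 \<le> n ^ 2" using assms(2,3) by linarith+
  have "k * (n + 2)\<^sup>2 \<le> n * (n ^ 2)\<^sup>2"
    using assms(2) n2 by (intro mult_le_mono power_mono) auto
  also have "\<dots> = n ^ 5" by (simp add: eval_nat_numeral)
  finally have "Suc (k * (n + 2)\<^sup>2) \<le> n ^ 5 + n ^ 5"
    using one_le_power[of n 5] assms(3) by linarith
  also have "\<dots> \<le> n * n ^ 5" using mult_le_mono1[OF assms(3), of "n ^ 5"] by (simp only: mult_2)
  also have "\<dots> = n ^ 6" by (simp add: eval_nat_numeral)
  finally have "Suc (k * (n + 2)\<^sup>2) ^ L \<le> (n ^ 6) ^ L" by (rule power_mono) simp
  then have "max_configs \<le> n ^ 2 * n ^ (6 * L)"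
    unfolding max_configs_def power_mult[symmetric] using n2 by (intro mult_le_mono)
  then have m: "max_configs \<le> n ^ (2 + 6 * L)" by (simp only: power_add)
  have "max_configs + 1 \<le> n ^ (2 + 6 * L) + n ^ (2 + 6 * L)"
    using m one_le_power[of n "2 + 6 * L"] assms(3) by linarith
  also have "\<dots> \<le> n * n ^ (2 + 6 * L)" using mult_le_mono1[OF assms(3), of "n ^ (2 + 6 * L)"] by (simp only: mult_2)
  finally have m1: "max_configs + 1 \<le> n ^ (3 + 6 * L)" by (simp add: eval_nat_numeral)
  have "explore_bound \<le> n ^ 2 * n ^ (3 + 6 * L) * n ^ 2 * n ^ 2 * n ^ (3 + 6 * L)"
    unfolding explore_bound_def v_loop_bound_def p_loop_bound_def attempt_bound_def
    by (intro mult_le_mono k2 n2 m1)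
  also have "\<dots> = n ^ (12 + 12 * L)" by (simp flip: power_add)
  finally show ?thesis .
qed

lemma contains_short_pattern:
  assumes "k \<le> 1" "k \<le> n"
  shows "contains_pattern n t k \<pi>"
proof -
  have "k = 0 \<or> k = 1" using assms by auto
  then show ?thesis
    using assms(2) unfolding contains_pattern_def
    by (intro exI[of _ id]) (auto simp: strict_mono_on_def)
qed

theorem theorem3:
  "\<exists>(A :: com) (C :: real). \<forall>(n :: nat) (k :: nat) (t :: nat \<Rightarrow> nat) (\<pi> :: nat \<Rightarrow> nat).
     t permutes {1..n} \<longrightarrow> jordan_permutation k \<pi> \<longrightarrow> k \<le> n \<longrightarrow>
       (\<exists>(T :: nat) (s :: state).
          exec A (input_state n t k \<pi>) T s \<and>
          (accepting s \<longleftrightarrow> contains_pattern n t k \<pi>) \<and>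
          real T \<le> C * real n ^ nat \<lceil>C * sqrt (real k)\<rceil>)"
proof (rule exI[of _ program], rule exI[of _ 6084], intro allI impI)
  fix n k t \<pi>
  assume t: "t permutes {1..n}" and jordan: "jordan_permutation k \<pi>" and kn: "k \<le> n"
  let ?s = "input_state n t k \<pi>"
  let ?e = "Less (N 1) (V ''k'')"
  let ?X = "n ^ nat \<lceil>6084 * sqrt (real k)\<rceil>"
  have e: "holds ?e ?s \<longleftrightarrow> 1 < k" by (auto simp: input_state_def)
  have "runs program ?s (6084 * ?X) (\<lambda>s. accepting s \<longleftrightarrow> contains_pattern n t k \<pi>)"
  proof (cases "1 < k")
    case False
    have "runs program ?s (acost ?e + 1 + 2) (\<lambda>s. accepting s \<longleftrightarrow> contains_pattern n t k \<pi>)"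
      unfolding program_def
    proof (rule runs_Cond)
      have "runs (Assign ''out'' (N 1)) ?s (acost (N 1) + 1) (\<lambda>s. accepting s \<longleftrightarrow> contains_pattern n t k \<pi>)"
        by (rule runs_Assign) (use False kn contains_short_pattern in \<open>auto simp: accepting_def\<close>)
      then show "runs (Assign ''out'' (N 1)) ?s 2 (\<lambda>s. accepting s \<longleftrightarrow> contains_pattern n t k \<pi>)"
        by (rule runs_bound) simp
    qed (use e False in blast)
    \<comment> \<open>For \<open>n = 0\<close> also \<open>k = 0\<close>, and the power is
      \<open>0 ^ 0 = 1\<close>.\<close>
    moreover have "1 \<le> ?X"
    proof (cases "n = 0")
      case True
      then show ?thesis using kn by simp
    qed (use one_le_power in auto)
    then have "acost ?e + 1 + 2 \<le> 6084 * ?X" by simp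
    ultimately show ?thesis by (rule runs_bound)
  next
    case True
    define L where "L = 253 * ceil_root k"
    have n2: "2 \<le> n" using True kn by simp
    interpret pattern_search n t k \<pi> L
      using t jordan by unfold_locales (auto simp: jordan_permutation_def)
    note ps = pattern_search_axioms
    have k0: "0 < k" using True by simp
    have "runs search ?s (50 * (k + 1) + (20 + 1000 * explore_bound)) (\<lambda>s. accepting s \<longleftrightarrow> contains_pattern n t k \<pi>)"
      using search_correct[OF ps k0] pattern_search_correct[OF ps jordan k0]
      unfolding accepting_def L_def by simp
    then have "runs program ?s (acost ?e + 1 + (50 * (k + 1) + (20 + 1000 * explore_bound)))
        (\<lambda>s. accepting s \<longleftrightarrow> contains_pattern n t k \<pi>)"
      unfolding program_def by (rule runs_Cond) (use e True in blast)
    moreover have "acost ?e + 1 + (50 * (k + 1) + (20 + 1000 * explore_bound)) \<le> 6084 * ?X"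
    proof -
      let ?Y = "n ^ (12 + 12 * L)"
      have "explore_bound \<le> ?Y" by (rule explore_bound_le[OF ps kn n2])
      moreover have "n ^ 1 \<le> ?Y" using n2 by (intro power_increasing) auto
      then have "n \<le> ?Y" by simp
      ultimately have 1: "acost ?e + 1 + (50 * (k + 1) + (20 + 1000 * explore_bound)) \<le> 6084 * ?Y"
        using kn n2 by simp
      \<comment> \<open>Origin of 6084:
        \<open>12 + 12 * 253 * (sqrt k + 1) = 3048 + 3036 * sqrt k\<close>, and
        \<open>1 \<le> sqrt k\<close> turns the constant into a multiple of
        \<open>sqrt k\<close>.\<close>
      have "1 \<le> sqrt k" using k0 by simp
      moreover have "real (12 + 12 * L) = 12 + 3036 * real (ceil_root k)" by (simp add: L_def)
      ultimately have "real (12 + 12 * L) \<le> 6084 * sqrt k" using ceil_root(2)[of k] by linarith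
      then have "12 + 12 * L \<le> nat \<lceil>6084 * sqrt k\<rceil>" by linarith
      then have "?Y \<le> ?X" using n2 by (intro power_increasing) auto
      with 1 show ?thesis by linarith
    qed
    ultimately show ?thesis by (rule runs_bound)
  qed
  then obtain T s where "exec program ?s T s" "T \<le> 6084 * ?X" "accepting s \<longleftrightarrow> contains_pattern n t k \<pi>"
    unfolding runs_def by blast
  moreover from this(2) have "real T \<le> 6084 * real n ^ nat \<lceil>6084 * sqrt (real k)\<rceil>"
    by (metis of_nat_le_iff of_nat_mult of_nat_numeral of_nat_power)
  ultimately show "\<exists>T s. exec program ?s T s \<and> (accepting s \<longleftrightarrow> contains_pattern n t k \<pi>) \<and>
      real T \<le> 6084 * real n ^ nat \<lceil>6084 * sqrt (real k)\<rceil>" by blast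
qed

end
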